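(* Let $L>0$, $0<v<1$, $\phi^0\in H_0^1(\mathbf{I}_0)$ and $\phi^1\in L^2(\mathbf{I}_0)$, where $\mathbf{I}_t=(vt,L+vt)$. Let $\phi$ be the solution of $$\phi_{tt}-\phi_{xx}=0 \ \ (x\in\mathbf{I}_t,\ t>0),\qquad \phi(vt,t)=\phi(L+vt,t)=0\ \ (t>0),\qquad \phi(x,0)=\phi^0(x),\ \phi_t(x,0)=\phi^1(x)\ \ (x\in\mathbf{I}_0).$$ Put $\tilde T_v=L/(1-v)$. Then: (i) $$\int_0^{\frac{L}{1+v}}\phi_x^2(vt,t)\,dt+\int_0^{\frac{L}{1-v}}\phi_x^2(L+vt,t)\,dt=\frac{4\,\mathcal{E}_v(0)}{(1-v^2)^2}.$$ (ii) Consequently, the direct inequality $$\int_0^T\phi_x^2(vt,t)+\phi_x^2(L+vt,t)\,dt\le K_2(v,T)\,\mathcal{E}_v(0)\qquad\text{for every }T\ge0$$ holds with a constant $K_2(v,T)$ depending only on $v$ and $T$ (the length $L$ being fixed). (iii) If $T\ge\tilde T_v$, the problem is observable at both endpoints $x=vt$, $x=L+vt$, and $$\mathcal{E}_v(0)\le\frac{(1-v^2)^2}{4}\int_0^T\phi_x^2(vt,t)+\phi_x^2(L+vt,t)\,dt.$$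
   Context: Subscripts $t,x$ denote partial derivatives; all data and solutions are real valued. For $0<v<1$ and the given data, "the solution" is the (known to exist) weak solution satisfying, for every $T>0$, $\phi\in C([0,T];H_0^1(\mathbf{I}_t))$ and $\phi_t\in C([0,T];L^2(\mathbf{I}_t))$. Energy: $\mathcal{E}_v(t)=\frac12\int_{vt}^{L+vt}(\phi_t+v\phi_x)^2+(1-v^2)\phi_x^2\,dx$ for $t\ge0$; in particular $\mathcal{E}_v(0)=\frac12\int_0^L(\phi^1+v\phi^0_x)^2+(1-v^2)(\phi^0_x)^2\,dx$. Observability at both endpoints in time $T$ means: there is a constant $C(T)>0$ such that $\mathcal{E}_v(0)\le C(T)\int_0^T\phi_x^2(vt,t)+\phi_x^2(L+vt,t)\,dt$ for all solutions of the problem. The boundary values $\phi_x(vt,t)$, $\phi_x(L+vt,t)$ are understood as the traces on the endpoint curves obtained by termwise differentiation of the series representation of the solution $$\phi(x,t)=\sum_{n\in\mathbb{Z}\setminus\{0\}}c_n\left(e^{n\pi i(1-v)(t+x)/L}-e^{n\pi i(1+v)(t-x)/L}\right),\qquad (nc_n)\in\ell^2,$$ evaluated at $x=vt$ and $x=L+vt$ (with convergence in $L^2_{loc}$ in $t$). *)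

theory Defs
  imports "HOL-Analysis.Analysis"
begin

section \<open>Function spaces on an interval\<close>

definition L2_on :: "real set \<Rightarrow> (real \<Rightarrow> real) \<Rightarrow> bool" where
  "L2_on S f \<longleftrightarrow>
     f \<in> borel_measurable (lebesgue_on S) \<and> (\<lambda>x. (f x)\<^sup>2) integrable_on S"

text \<open>The space \<open>C\<^sub>c\<^sup>\<infinity>(a,b)\<close>.\<close>

definition test_fun :: "real \<Rightarrow> real \<Rightarrow> (real \<Rightarrow> real) \<Rightarrow> bool" where
  "test_fun a b \<psi> \<longleftrightarrow>
     (\<forall>k x. (deriv ^^ k) \<psi> differentiable (at x)) \<and>
     (\<exists>K. compact K \<and> K \<subseteq> {a<..<b} \<and> (\<forall>x. x \<notin> K \<longrightarrow> \<psi> x = 0))"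

definition weak_deriv :: "real \<Rightarrow> real \<Rightarrow> (real \<Rightarrow> real) \<Rightarrow> (real \<Rightarrow> real) \<Rightarrow> bool" where
  "weak_deriv a b f g \<longleftrightarrow>
     (\<forall>\<psi>. test_fun a b \<psi> \<longrightarrow>
        integral {a..b} (\<lambda>x. f x * deriv \<psi> x) = - integral {a..b} (\<lambda>x. g x * \<psi> x))"

text \<open>\<open>H1_0_with_deriv a b f g\<close>: \<open>f\<close> is the continuous representative of an element of
  \<open>H\<^sub>0\<^sup>1(a,b)\<close>, the closure of \<open>C\<^sub>c\<^sup>\<infinity>(a,b)\<close> in \<open>H\<^sup>1(a,b)\<close>, and \<open>g\<close> is
  (a representative of) its weak derivative.\<close>

definition H1_0_with_deriv :: "real \<Rightarrow> real \<Rightarrow> (real \<Rightarrow> real) \<Rightarrow> (real \<Rightarrow> real) \<Rightarrow> bool" where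
  "H1_0_with_deriv a b f g \<longleftrightarrow>
     L2_on {a..b} f \<and> L2_on {a..b} g \<and> weak_deriv a b f g \<and>
     continuous_on {a..b} f \<and>
     (\<exists>\<psi> :: nat \<Rightarrow> real \<Rightarrow> real. (\<forall>k. test_fun a b (\<psi> k)) \<and>
        (\<lambda>k. integral {a..b} (\<lambda>x. (\<psi> k x - f x)\<^sup>2)) \<longlonglongrightarrow> 0 \<and>
        (\<lambda>k. integral {a..b} (\<lambda>x. (deriv (\<psi> k) x - g x)\<^sup>2)) \<longlonglongrightarrow> 0)"

definition H1_0 :: "real \<Rightarrow> real \<Rightarrow> (real \<Rightarrow> real) \<Rightarrow> bool" where
  "H1_0 a b f \<longleftrightarrow> (\<exists>g. H1_0_with_deriv a b f g)"

section \<open>Weak solutions on the moving interval\<close>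

text \<open>Functions of position and time take the position \<open>x\<close> first and the time \<open>t\<close> second.\<close>

definition dx :: "(real \<Rightarrow> real \<Rightarrow> real) \<Rightarrow> real \<Rightarrow> real \<Rightarrow> real" where
  "dx \<eta> x t = deriv (\<lambda>y. \<eta> y t) x"

definition dt :: "(real \<Rightarrow> real \<Rightarrow> real) \<Rightarrow> real \<Rightarrow> real \<Rightarrow> real" where
  "dt \<eta> x t = deriv (\<lambda>s. \<eta> x s) t"

primrec C_k2 :: "nat \<Rightarrow> (real \<Rightarrow> real \<Rightarrow> real) \<Rightarrow> bool" where
  "C_k2 0 \<eta> \<longleftrightarrow> continuous_on UNIV (\<lambda>(x, t). \<eta> x t)"
| "C_k2 (Suc k) \<eta> \<longleftrightarrow> continuous_on UNIV (\<lambda>(x, t). \<eta> x t) \<and>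
     (\<forall>x t. (\<lambda>y. \<eta> y t) differentiable (at x) \<and> (\<lambda>s. \<eta> x s) differentiable (at t)) \<and>
     C_k2 k (dx \<eta>) \<and> C_k2 k (dt \<eta>)"

definition moving_domain :: "real \<Rightarrow> real \<Rightarrow> (real \<times> real) set" where
  "moving_domain L v = {(x, t). 0 < t \<and> v * t < x \<and> x < L + v * t}"

text \<open>The space \<open>C\<^sub>c\<^sup>\<infinity>\<close> of the open space-time domain.\<close>

definition test_fun2 :: "real \<Rightarrow> real \<Rightarrow> (real \<Rightarrow> real \<Rightarrow> real) \<Rightarrow> bool" where
  "test_fun2 L v \<eta> \<longleftrightarrow>
     (\<forall>k. C_k2 k \<eta>) \<and>
     (\<exists>K. compact K \<and> K \<subseteq> moving_domain L v \<and> (\<forall>x t. (x, t) \<notin> K \<longrightarrow> \<eta> x t = 0))"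

definition domain_integral :: "real \<Rightarrow> real \<Rightarrow> (real \<Rightarrow> real \<Rightarrow> real) \<Rightarrow> real" where
  "domain_integral L v F = integral {0..} (\<lambda>t. integral {v * t..L + v * t} (\<lambda>x. F x t))"

text \<open>\<open>u \<in> C([0,T]; L\<^sup>2(I\<^sub>t))\<close> with \<open>I\<^sub>t = (vt, L + vt)\<close>; as the interval moves, values at
  different times are compared after translation to the fixed interval \<open>(0, L)\<close>.\<close>

definition C_L2 :: "real \<Rightarrow> real \<Rightarrow> real \<Rightarrow> (real \<Rightarrow> real \<Rightarrow> real) \<Rightarrow> bool" where
  "C_L2 L v T u \<longleftrightarrow>
     (\<forall>t\<in>{0..T}. L2_on {v * t..L + v * t} (\<lambda>x. u x t)) \<and>
     (\<forall>s\<in>{0..T}.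
        ((\<lambda>t. integral {0..L} (\<lambda>y. (u (y + v * t) t - u (y + v * s) s)\<^sup>2)) \<longlongrightarrow> 0)
          (at s within {0..T}))"

text \<open>\<open>weak_solution L v \<phi>0 \<phi>1 \<phi> \<phi>x \<phi>t\<close>: \<open>\<phi>\<close> is the weak solution with initial data
  \<open>\<phi>0, \<phi>1\<close>, where \<open>\<phi>x\<close>, \<open>\<phi>t\<close> are (representatives of) its weak partial derivatives.\<close>

definition weak_solution :: "real \<Rightarrow> real \<Rightarrow> (real \<Rightarrow> real) \<Rightarrow> (real \<Rightarrow> real) \<Rightarrow>
    (real \<Rightarrow> real \<Rightarrow> real) \<Rightarrow> (real \<Rightarrow> real \<Rightarrow> real) \<Rightarrow> (real \<Rightarrow> real \<Rightarrow> real) \<Rightarrow> bool" where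
  "weak_solution L v \<phi>0 \<phi>1 \<phi> \<phi>x \<phi>t \<longleftrightarrow>
     \<comment> \<open>regularity: \<open>\<phi> \<in> C([0,T]; H\<^sub>0\<^sup>1(I\<^sub>t))\<close> and \<open>\<phi>t \<in> C([0,T]; L\<^sup>2(I\<^sub>t))\<close>\<close>
     (\<forall>t\<ge>0. H1_0_with_deriv (v * t) (L + v * t) (\<lambda>x. \<phi> x t) (\<lambda>x. \<phi>x x t)) \<and>
     (\<forall>T>0. C_L2 L v T \<phi> \<and> C_L2 L v T \<phi>x \<and> C_L2 L v T \<phi>t) \<and>
     (\<forall>\<eta>. test_fun2 L v \<eta> \<longrightarrow>
        domain_integral L v (\<lambda>x t. \<phi> x t * dt \<eta> x t)
          = - domain_integral L v (\<lambda>x t. \<phi>t x t * \<eta> x t)) \<and>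
     \<comment> \<open>the wave equation in the sense of distributions\<close>
     (\<forall>\<eta>. test_fun2 L v \<eta> \<longrightarrow>
        domain_integral L v (\<lambda>x t. \<phi> x t * (dt (dt \<eta>) x t - dx (dx \<eta>) x t)) = 0) \<and>
     \<comment> \<open>boundary and initial conditions\<close>
     (\<forall>t>0. \<phi> (v * t) t = 0 \<and> \<phi> (L + v * t) t = 0) \<and>
     (\<forall>x\<in>{0..L}. \<phi> x 0 = \<phi>0 x) \<and>
     (AE x in lebesgue_on {0..L}. \<phi>t x 0 = \<phi>1 x)"

definition energy :: "real \<Rightarrow> real \<Rightarrow> (real \<Rightarrow> real \<Rightarrow> real) \<Rightarrow> (real \<Rightarrow> real \<Rightarrow> real) \<Rightarrow> real \<Rightarrow> real"
  where
  "energy L v \<phi>x \<phi>t t =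
     1 / 2 * integral {v * t..L + v * t}
       (\<lambda>x. (\<phi>t x t + v * \<phi>x x t)\<^sup>2 + (1 - v\<^sup>2) * (\<phi>x x t)\<^sup>2)"

section \<open>Series representation and boundary traces\<close>

definition mode :: "real \<Rightarrow> real \<Rightarrow> int \<Rightarrow> real \<Rightarrow> real \<Rightarrow> complex" where
  "mode L v n x t =
     exp (of_int n * of_real pi * \<i> * of_real ((1 - v) * (t + x) / L)) -
     exp (of_int n * of_real pi * \<i> * of_real ((1 + v) * (t - x) / L))"

definition series_rep :: "real \<Rightarrow> real \<Rightarrow> (real \<Rightarrow> real \<Rightarrow> real) \<Rightarrow> (int \<Rightarrow> complex) \<Rightarrow> bool" where
  "series_rep L v \<phi> c \<longleftrightarrow>
     (\<lambda>n. (cmod (of_int n * c n))\<^sup>2) summable_on (UNIV - {0}) \<and>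
     (\<forall>t\<ge>0. \<forall>x\<in>{v * t..L + v * t}.
        ((\<lambda>n. c n * mode L v n x t) has_sum complex_of_real (\<phi> x t)) (UNIV - {0}))"

definition series_coeff :: "real \<Rightarrow> real \<Rightarrow> (real \<Rightarrow> real \<Rightarrow> real) \<Rightarrow> int \<Rightarrow> complex" where
  "series_coeff L v \<phi> = (SOME c. series_rep L v \<phi> c)"

text \<open>\<open>is_dx_trace L v \<phi> \<gamma> g\<close>: along the curve \<open>x = \<gamma> t\<close>, the symmetric partial sums of the
  series differentiated termwise in \<open>x\<close> converge to \<open>g\<close> in \<open>L\<^sup>2(0,T)\<close> for every \<open>T\<close>.\<close>

definition is_dx_trace :: "real \<Rightarrow> real \<Rightarrow> (real \<Rightarrow> real \<Rightarrow> real) \<Rightarrow> (real \<Rightarrow> real) \<Rightarrow>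
    (real \<Rightarrow> real) \<Rightarrow> bool" where
  "is_dx_trace L v \<phi> \<gamma> g \<longleftrightarrow>
     (\<forall>T>0. L2_on {0..T} g \<and>
        (\<lambda>N::nat. integral {0..T} (\<lambda>t.
           (cmod ((\<Sum>n\<in>{- int N..int N} - {0}.
                     series_coeff L v \<phi> n * vector_derivative (\<lambda>x. mode L v n x t) (at (\<gamma> t)))
                  - of_real (g t)))\<^sup>2)) \<longlonglongrightarrow> 0)"

text \<open>The choices in \<open>series_coeff\<close> and \<open>dx_trace\<close> are harmless: for a weak solution the
  coefficients are unique, and the trace is unique almost everywhere. That they exist for every
  weak solution is not assumed anywhere; it is part of what a proof about \<open>dx_trace\<close> has to
  provide.\<close>

definition dx_trace :: "real \<Rightarrow> real \<Rightarrow> (real \<Rightarrow> real \<Rightarrow> real) \<Rightarrow> (real \<Rightarrow> real) \<Rightarrow> real \<Rightarrow> real" where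
  "dx_trace L v \<phi> \<gamma> = (SOME g. is_dx_trace L v \<phi> \<gamma> g)"

definition left_trace :: "real \<Rightarrow> real \<Rightarrow> (real \<Rightarrow> real \<Rightarrow> real) \<Rightarrow> real \<Rightarrow> real" where
  "left_trace L v \<phi> = dx_trace L v \<phi> (\<lambda>t. v * t)"

definition right_trace :: "real \<Rightarrow> real \<Rightarrow> (real \<Rightarrow> real \<Rightarrow> real) \<Rightarrow> real \<Rightarrow> real" where
  "right_trace L v \<phi> = dx_trace L v \<phi> (\<lambda>t. L + v * t)"

section \<open>Observability at both endpoints\<close>

definition observable_both :: "real \<Rightarrow> real \<Rightarrow> real \<Rightarrow> bool" where
  "observable_both L v T \<longleftrightarrow>
     (\<exists>C>0. \<forall>\<phi>0 \<phi>1 \<phi> \<phi>x \<phi>t.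
        H1_0 0 L \<phi>0 \<longrightarrow> L2_on {0..L} \<phi>1 \<longrightarrow> weak_solution L v \<phi>0 \<phi>1 \<phi> \<phi>x \<phi>t \<longrightarrow>
        energy L v \<phi>x \<phi>t 0
          \<le> C * integral {0..T} (\<lambda>t. (left_trace L v \<phi> t)\<^sup>2 + (right_trace L v \<phi> t)\<^sup>2))"

end

theory Submission
  imports Defs
begin

text \<open>
  In the characteristic coordinates \<open>p = (1 - v)(t + x)/L\<close> and \<open>q = (1 + v)(t - x)/L\<close> the two ends of
  the string are the lines \<open>p = q\<close> and \<open>p = q + 2\<close>, so a solution that vanishes on them has the
  form \<open>\<phi> = H(p) - H(q)\<close> with a function \<open>H\<close> of period \<open>2\<close>. At time \<open>0\<close> the variable \<open>p\<close> runs
  through \<open>[0, 1 - v]\<close> and \<open>q\<close> through \<open>[-(1 + v), 0]\<close>, together exactly one period. The cross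
  term in the energy cancels, and \<open>E(0) = (1 - v\<^sup>2)/L \<integral> H'\<^sup>2\<close> over a period. On the left end
  \<open>\<phi>\<^sub>x = (2/L) H'((1 - v\<^sup>2) t/L)\<close>, and on the right end the same holds with the argument increased by
  \<open>1 - v\<close>. During the time \<open>L/(1 + v)\<close> the left end sees \<open>H'\<close> on \<open>[0, 1 - v]\<close>, during \<open>L/(1 - v)\<close> the
  right end sees it on \<open>[1 - v, 2]\<close>: again one period. This is the identity
  (\<open>trace_energy_identity\<close>); the direct inequality counts the periods that a longer time can cover
  (\<open>trace_direct_inequality\<close>), and observability holds because \<open>L/(1 - v)\<close> is the longer of the
  two windows (\<open>observability_inequality\<close>).

  Most of the work is to reach this picture from a weak solution. Membership of \<open>\<phi>\<close> in
  \<open>C([0,T]; H\<^sub>0\<^sup>1)\<close> makes \<open>\<phi>\<close> continuous up to the boundary (\<open>continuous_phi\<close>). Testing the wave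
  equation with \<open>A(t + x) B(t - x)\<close>, where \<open>A'\<close> and \<open>B'\<close> are differences of narrow bumps, gives the
  identity \<open>\<phi>(P\<^sub>1) + \<phi>(P\<^sub>3) = \<phi>(P\<^sub>2) + \<phi>(P\<^sub>4)\<close> at the corners of characteristic rectangles
  (\<open>parallelogram_identity\<close>), and with the boundary condition this yields \<open>H\<close>
  (\<open>dAlembert_representation\<close>). The initial position determines \<open>H(p) - H(q)\<close>. The initial velocity
  enters only through the weak time derivative, which is tested with \<open>A(x) B(t)\<close> and followed down to
  time \<open>0\<close>; it determines \<open>H(p) + H(q)\<close> up to a constant (\<open>profile_eq_integral\<close>). Hence \<open>H\<close> is
  absolutely continuous with \<open>H' \<in> L\<^sup>2\<close>.

  The traces are defined by the series of \<open>\<phi>\<close>. The Fourier series of \<open>H'\<close> converges in mean square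
  (\<open>fourier_series_converges\<close>), and integrating it gives a series representation of \<open>\<phi>\<close>. Coefficients
  of such a representation are unique (\<open>trig_series_unique\<close>), so whichever coefficients and traces
  are chosen in the definitions, the differentiated series is the Fourier series of \<open>H'\<close> along the
  boundary curves (\<open>series_coeff_properties\<close>, \<open>trace_square_integral\<close>).
\<close>

section \<open>Square integrable functions on intervals\<close>

lemma
  fixes f :: "real \<Rightarrow> 'b::euclidean_space" and m :: real
  assumes "0 < m"
  shows integrable_affine_iff:
      "(\<lambda>x. f (m * x + k)) integrable_on {a..b} \<longleftrightarrow> f integrable_on {m * a + k..m * b + k}"
    and integral_affine:
      "integral {a..b} (\<lambda>x. f (m * x + k)) = integral {m * a + k..m * b + k} f /\<^sub>R m"
proof -
  have eq: "((\<lambda>x. f (m * x + k)) has_integral (I /\<^sub>R m)) {a..b} \<longleftrightarrow>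
      (f has_integral I) {m * a + k..m * b + k}" for I
    using has_integral_affinity_iff[OF assms, of f k I "m * a + k" "m * b + k"] assms
    by (simp add: field_simps)
  have eq': "((\<lambda>x. f (m * x + k)) has_integral I) {a..b} \<longleftrightarrow>
      (f has_integral (m *\<^sub>R I)) {m * a + k..m * b + k}" for I
    using eq[of "m *\<^sub>R I"] assms by simp
  show 1: "(\<lambda>x. f (m * x + k)) integrable_on {a..b} \<longleftrightarrow> f integrable_on {m * a + k..m * b + k}"
    unfolding integrable_on_def using eq eq' by meson
  show "integral {a..b} (\<lambda>x. f (m * x + k)) = integral {m * a + k..m * b + k} f /\<^sub>R m"
  proof (cases "f integrable_on {m * a + k..m * b + k}")
    case True
    then show ?thesis
      by (intro integral_unique eq[THEN iffD2] integrable_integral)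
  next
    case False
    then show ?thesis
      using 1 by (simp add: not_integrable_integral)
  qed
qed

lemma L2_on_mult:
  assumes "L2_on {a..b} f" "L2_on {a..b} g"
  shows "(\<lambda>x. f x * g x) absolutely_integrable_on {a..b}"
proof (rule measurable_bounded_by_integrable_imp_absolutely_integrable)
  show "(\<lambda>x. f x * g x) \<in> borel_measurable (lebesgue_on {a..b})"
    using assms by (auto simp: L2_on_def)
  show "(\<lambda>x. (f x)\<^sup>2 + (g x)\<^sup>2) integrable_on {a..b}"
    using assms by (auto simp: L2_on_def intro: integrable_add)
  show "norm (f x * g x) \<le> (f x)\<^sup>2 + (g x)\<^sup>2" for x
  proof -
    have "2 * (\<bar>f x\<bar> * \<bar>g x\<bar>) \<le> (f x)\<^sup>2 + (g x)\<^sup>2"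
      using sum_squares_bound[of "\<bar>f x\<bar>" "\<bar>g x\<bar>"] by (simp add: mult.assoc)
    moreover have "0 \<le> \<bar>f x\<bar> * \<bar>g x\<bar>"
      by simp
    ultimately show ?thesis
      by (simp only: real_norm_def abs_mult)
  qed
qed auto

lemmas L2_on_mult_integrable = L2_on_mult[THEN set_lebesgue_integral_eq_integral(1)]

lemma L2_on_measurable: "L2_on S f \<Longrightarrow> f \<in> borel_measurable (lebesgue_on S)"
  by (simp add: L2_on_def)

lemma L2_on_square: "L2_on S f \<Longrightarrow> (\<lambda>x. (f x)\<^sup>2) integrable_on S"
  by (simp add: L2_on_def)

lemma L2_on_continuous:
  assumes "continuous_on {a..b} f"
  shows "L2_on {a..b} f"
  unfolding L2_on_def
  by (intro conjI integrable_continuous_interval continuous_intros assms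
      continuous_imp_measurable_on_sets_lebesgue) auto

lemma L2_on_add:
  assumes "L2_on {a..b} f" "L2_on {a..b} g"
  shows "L2_on {a..b} (\<lambda>x. f x + g x)"
proof -
  have "(\<lambda>x. (f x)\<^sup>2 + (g x)\<^sup>2 + 2 * (f x * g x)) integrable_on {a..b}"
    using assms L2_on_mult_integrable[OF assms]
    by (intro integrable_add integrable_on_mult_right) (auto simp: L2_on_def)
  then show ?thesis
    using assms by (auto simp: L2_on_def power2_sum mult.assoc)
qed

lemma L2_on_cmult:
  assumes "L2_on S f"
  shows "L2_on S (\<lambda>x. c * f x)"
  using assms unfolding L2_on_def power_mult_distrib by (auto intro: integrable_on_mult_right)

lemma L2_on_diff:
  assumes "L2_on {a..b} f" "L2_on {a..b} g"
  shows "L2_on {a..b} (\<lambda>x. f x - g x)"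
  using L2_on_add[OF assms(1) L2_on_cmult[OF assms(2), of "-1"]] by simp

lemma L2_on_integrable:
  assumes "L2_on {a..b} f"
  shows "f integrable_on {a..b}"
  using L2_on_mult_integrable[OF assms L2_on_continuous[of a b "\<lambda>_. 1"]] by simp

lemma L2_on_subinterval:
  assumes "L2_on {a..b} f" "{c..d} \<subseteq> {a..b}"
  shows "L2_on {c..d} f"
proof -
  have "f integrable_on {c..d}"
    using integrable_on_subinterval[OF L2_on_integrable[OF assms(1)] assms(2)] .
  moreover have "(\<lambda>x. (f x)\<^sup>2) integrable_on {c..d}"
    using integrable_on_subinterval[OF L2_on_square[OF assms(1)] assms(2)] .
  ultimately show ?thesis
    unfolding L2_on_def by (auto intro: integrable_imp_measurable)
qed

lemma L2_onI_integrable: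
  fixes f :: "real \<Rightarrow> real"
  assumes "f integrable_on S" "(\<lambda>x. (f x)\<^sup>2) integrable_on S"
  shows "L2_on S f"
  using assms unfolding L2_on_def by (auto intro: integrable_imp_measurable)

lemma L2_on_affine:
  assumes "0 < m" "L2_on {m * a + k..m * b + k} f"
  shows "L2_on {a..b} (\<lambda>x. f (m * x + k))"
  using assms L2_on_integrable L2_on_square[OF assms(2)]
  by (intro L2_onI_integrable)
    (simp_all add: integrable_affine_iff integrable_affine_iff[of m "\<lambda>x. (f x)\<^sup>2"])

lemma L2_on_reflect:
  assumes "L2_on {a..b} f"
  shows "L2_on {-b..-a} (\<lambda>x. f (- x))"
  using L2_on_integrable[OF assms] L2_on_square[OF assms]
  by (intro L2_onI_integrable)
    (use L2_on_square[OF assms] in \<open>simp_all add: Henstock_Kurzweil_Integration.integrable_reflect_real[where f = "\<lambda>x. (f x)\<^sup>2"]\<close>)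

lemma L2_on_cong:
  assumes "L2_on {a..b} f" "\<And>x. a < x \<Longrightarrow> x < b \<Longrightarrow> f x = g x"
  shows "L2_on {a..b} g"
proof (rule L2_onI_integrable)
  show "g integrable_on {a..b}"
    using integrable_spike_finite[of "{a, b}" "{a..b}" g f] L2_on_integrable[OF assms(1)] assms(2)
    by force
  show "(\<lambda>x. (g x)\<^sup>2) integrable_on {a..b}"
    using integrable_spike_finite[of "{a, b}" "{a..b}" "\<lambda>x. (g x)\<^sup>2" "\<lambda>x. (f x)\<^sup>2"]
      L2_on_square[OF assms(1)] assms(2)
    by force
qed

lemma L2_on_combine:
  fixes f :: "real \<Rightarrow> real"
  assumes "a \<le> c" "c \<le> b" "L2_on {a..c} f" "L2_on {c..b} f"
  shows "L2_on {a..b} f"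
  using Henstock_Kurzweil_Integration.integrable_combine[OF assms(1,2)] L2_on_integrable[OF assms(3)] L2_on_integrable[OF assms(4)]
    L2_on_square[OF assms(3)] L2_on_square[OF assms(4)]
  by (intro L2_onI_integrable) auto

lemma Cauchy_Schwarz_integral:
  assumes f: "L2_on {a..b} f" and g: "L2_on {a..b} g"
  shows "(integral {a..b} (\<lambda>x. f x * g x))\<^sup>2
           \<le> integral {a..b} (\<lambda>x. (f x)\<^sup>2) * integral {a..b} (\<lambda>x. (g x)\<^sup>2)"
proof -
  define F G I where "F = integral {a..b} (\<lambda>x. (f x)\<^sup>2)" and "G = integral {a..b} (\<lambda>x. (g x)\<^sup>2)"
    and "I = integral {a..b} (\<lambda>x. f x * g x)"
  note int = L2_on_square[OF f] L2_on_square[OF g] L2_on_mult_integrable[OF f g]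
  have quad: "0 \<le> F + 2 * r * I + r\<^sup>2 * G" for r
  proof -
    have "((\<lambda>x. (f x)\<^sup>2 + 2 * r * (f x * g x) + r\<^sup>2 * (g x)\<^sup>2) has_integral F + 2 * r * I + r\<^sup>2 * G) {a..b}"
      unfolding F_def G_def I_def using int
      by (intro has_integral_add has_integral_mult_right integrable_integral)
    then have "((\<lambda>x. (f x + r * g x)\<^sup>2) has_integral F + 2 * r * I + r\<^sup>2 * G) {a..b}"
      by (simp add: power2_sum power_mult_distrib algebra_simps)
    then show ?thesis
      by (rule has_integral_nonneg) auto
  qed
  have "F \<ge> 0" "G \<ge> 0"
    unfolding F_def G_def using int by (auto intro: integral_nonneg)
  have "I\<^sup>2 \<le> F * G"
  proof (cases "G = 0")
    case True
    have "I = 0"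
    proof (rule ccontr)
      assume "I \<noteq> 0"
      have "0 \<le> F + 2 * (- (F + 1) / (2 * I)) * I"
        using quad[of "- (F + 1) / (2 * I)"] True by simp
      also have "\<dots> = -1"
        using \<open>I \<noteq> 0\<close> by (simp add: field_simps)
      finally show False by simp
    qed
    then show ?thesis using True by simp
  next
    case False
    then have "G > 0" using \<open>G \<ge> 0\<close> by simp
    then have "0 \<le> (F + 2 * (- I / G) * I + (- I / G)\<^sup>2 * G) * G"
      using quad[of "- I / G"] by (intro mult_nonneg_nonneg) auto
    also have "\<dots> = F * G - I\<^sup>2"
      using \<open>G > 0\<close> by (simp add: field_simps power2_eq_square)
    finally show ?thesis by simp
  qed
  then show ?thesis
    unfolding F_def G_def I_def .
qed

lemma Cauchy_Schwarz_integral_abs: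
  assumes f: "L2_on {a..b} f" and g: "L2_on {a..b} g"
  shows "\<bar>integral {a..b} (\<lambda>x. f x * g x)\<bar>
           \<le> sqrt (integral {a..b} (\<lambda>x. (f x)\<^sup>2)) * sqrt (integral {a..b} (\<lambda>x. (g x)\<^sup>2))"
  using real_sqrt_le_mono[OF Cauchy_Schwarz_integral[OF assms]]
  by (simp add: real_sqrt_mult)

text \<open>On a bounded interval convergence in mean square controls every integral over a
  subinterval, uniformly in the subinterval.\<close>

lemma integral_subinterval_L2_bound:
  assumes f: "L2_on {a..b} f" and "a \<le> c" "c \<le> d" "d \<le> b"
  shows "\<bar>integral {c..d} f\<bar> \<le> sqrt (b - a) * sqrt (integral {a..b} (\<lambda>x. (f x)\<^sup>2))"
proof -
  have f': "L2_on {c..d} f"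
    using L2_on_subinterval[OF f] assms by auto
  have "\<bar>integral {c..d} (\<lambda>x. f x * 1)\<bar>
      \<le> sqrt (integral {c..d} (\<lambda>x. (f x)\<^sup>2)) * sqrt (integral {c..d} (\<lambda>x::real. 1\<^sup>2))"
    by (rule Cauchy_Schwarz_integral_abs[OF f' L2_on_continuous]) auto
  also have "\<dots> \<le> sqrt (integral {a..b} (\<lambda>x. (f x)\<^sup>2)) * sqrt (b - a)"
    using assms L2_on_square[OF f] L2_on_square[OF f']
    by (intro mult_mono real_sqrt_le_mono integral_subset_le) (auto intro!: integral_nonneg)
  finally show ?thesis
    by (simp add: mult.commute)
qed

lemma square_integral_add_le:
  assumes "L2_on {a..b} f" "L2_on {a..b} g"
  shows "integral {a..b} (\<lambda>x. (f x + g x)\<^sup>2)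
    \<le> 2 * integral {a..b} (\<lambda>x. (f x)\<^sup>2) + 2 * integral {a..b} (\<lambda>x. (g x)\<^sup>2)"
proof -
  have "integral {a..b} (\<lambda>x. (f x + g x)\<^sup>2)
      \<le> integral {a..b} (\<lambda>x. 2 * (f x)\<^sup>2 + 2 * (g x)\<^sup>2)"
    using L2_on_square[OF L2_on_add[OF assms]] L2_on_square[OF assms(1)] L2_on_square[OF assms(2)]
      sum_squares_bound[of "f x" "g x" for x]
    by (intro integral_le integrable_add integrable_on_mult_right) (auto simp: power2_sum add.commute)
  also have "\<dots> = 2 * integral {a..b} (\<lambda>x. (f x)\<^sup>2) + 2 * integral {a..b} (\<lambda>x. (g x)\<^sup>2)"
    using L2_on_square[OF assms(1)] L2_on_square[OF assms(2)]
    by (simp add: Henstock_Kurzweil_Integration.integral_add)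
  finally show ?thesis .
qed

section \<open>Smooth cutoffs\<close>

definition smooth :: "(real \<Rightarrow> real) \<Rightarrow> bool" where
  "smooth f \<longleftrightarrow> (\<forall>k x. (deriv ^^ k) f differentiable (at x))"

lemma smooth_coinduct:
  assumes "P f"
    and diff: "\<And>f x. P f \<Longrightarrow> f differentiable (at x)"
    and closed: "\<And>f. P f \<Longrightarrow> P (deriv f)"
  shows "smooth f"
proof -
  have "P ((deriv ^^ k) f)" for k
    by (induction k) (auto simp: assms)
  then show ?thesis
    using diff by (auto simp: smooth_def)
qed

lemma smooth_deriv: "smooth f \<Longrightarrow> smooth (deriv f)"
proof -
  assume "smooth f"
  moreover have "(deriv ^^ k) (deriv f) = (deriv ^^ Suc k) f" for k
    by (simp add: funpow_swap1)
  ultimately show "smooth (deriv f)"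
    unfolding smooth_def by metis
qed

lemma smooth_has_deriv: "smooth f \<Longrightarrow> (f has_real_derivative deriv f x) (at x)"
  unfolding smooth_def DERIV_deriv_iff_real_differentiable by (drule spec[of _ 0]) simp

lemma smooth_continuous: "smooth f \<Longrightarrow> continuous_on S f"
  by (rule DERIV_continuous_on) (rule has_field_derivative_at_within[OF smooth_has_deriv])

lemma smooth_const: "smooth (\<lambda>_. c)"
  by (rule smooth_coinduct[where P = "\<lambda>f. \<exists>c. f = (\<lambda>_. c)"]) auto

text \<open>All closure properties of smooth functions follow at once from \<open>smooth_coinduct\<close>: the
  algebra generated by the smooth functions, reciprocals and affine substitutions consists of
  differentiable functions and is closed under differentiation.\<close>

inductive smooth_algebra :: "(real \<Rightarrow> real) \<Rightarrow> bool" where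
  base: "smooth f \<Longrightarrow> smooth_algebra f"
| add: "smooth_algebra f \<Longrightarrow> smooth_algebra g \<Longrightarrow> smooth_algebra (\<lambda>x. f x + g x)"
| mult: "smooth_algebra f \<Longrightarrow> smooth_algebra g \<Longrightarrow> smooth_algebra (\<lambda>x. f x * g x)"
| inverse: "smooth_algebra f \<Longrightarrow> (\<And>x. f x \<noteq> 0) \<Longrightarrow> smooth_algebra (\<lambda>x. inverse (f x))"
| affine: "smooth_algebra f \<Longrightarrow> smooth_algebra (\<lambda>x. f (m * x + k))"

lemma smooth_algebra_deriv:
  "smooth_algebra f \<Longrightarrow> \<exists>f'. smooth_algebra f' \<and> (\<forall>x. (f has_real_derivative f' x) (at x))"
proof (induction rule: smooth_algebra.induct)
  case (base f)
  then show ?case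
    using smooth_has_deriv smooth_deriv smooth_algebra.base by blast
next
  case (add f g)
  then obtain f' g' where "smooth_algebra f'" "smooth_algebra g'"
    and d: "\<And>x. (f has_real_derivative f' x) (at x)" "\<And>x. (g has_real_derivative g' x) (at x)"
    by blast
  then show ?case
    by (intro exI[of _ "\<lambda>x. f' x + g' x"]) (auto intro: smooth_algebra.add derivative_intros d)
next
  case (mult f g)
  then obtain f' g' where *: "smooth_algebra f'" "smooth_algebra g'"
    and d: "\<And>x. (f has_real_derivative f' x) (at x)" "\<And>x. (g has_real_derivative g' x) (at x)"
    by blast
  have "((\<lambda>x. f x * g x) has_real_derivative f' x * g x + f x * g' x) (at x)" for x
    using DERIV_mult[OF d(1)[of x] d(2)[of x]] by (simp add: algebra_simps)
  moreover have "smooth_algebra (\<lambda>x. f' x * g x + f x * g' x)"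
    using * mult by (intro smooth_algebra.add smooth_algebra.mult)
  ultimately show ?case
    by (intro exI[of _ "\<lambda>x. f' x * g x + f x * g' x"]) auto
next
  case (inverse f)
  then obtain f' where *: "smooth_algebra f'" and d: "\<And>x. (f has_real_derivative f' x) (at x)"
    by blast
  have "((\<lambda>x. inverse (f x)) has_real_derivative - 1 * (f' x * (inverse (f x) * inverse (f x)))) (at x)" for x
    using DERIV_inverse'[OF d[of x] inverse(2)[of x]] by (simp add: algebra_simps)
  moreover have "smooth_algebra (\<lambda>x. - 1 * (f' x * (inverse (f x) * inverse (f x))))"
    using * inverse
    by (intro smooth_algebra.mult[of "\<lambda>_. - 1"] smooth_algebra.mult[of f'] smooth_algebra.mult
        smooth_algebra.base[OF smooth_const] smooth_algebra.inverse)
  ultimately show ?case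
    by (intro exI[of _ "\<lambda>x. - 1 * (f' x * (inverse (f x) * inverse (f x)))"]) auto
next
  case (affine f m k)
  then obtain f' where *: "smooth_algebra f'" and d: "\<And>x. (f has_real_derivative f' x) (at x)"
    by blast
  have "((\<lambda>x. f (m * x + k)) has_real_derivative m * f' (m * x + k)) (at x)" for x
    by (rule DERIV_cong[OF DERIV_chain2[where g = "\<lambda>x. m * x + k", OF d]])
      (auto intro!: derivative_eq_intros)
  moreover have "smooth_algebra (\<lambda>x. m * f' (m * x + k))"
    using * by (intro smooth_algebra.mult smooth_algebra.base[OF smooth_const] smooth_algebra.affine)
  ultimately show ?case
    by (intro exI[of _ "\<lambda>x. m * f' (m * x + k)"]) auto
qed

lemma smooth_algebra_iff: "smooth_algebra f \<longleftrightarrow> smooth f"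
proof
  assume "smooth_algebra f"
  then show "smooth f"
  proof (rule smooth_coinduct)
    fix f assume "smooth_algebra f"
    then obtain f' where *: "smooth_algebra f'" "\<And>x. (f has_real_derivative f' x) (at x)"
      using smooth_algebra_deriv by blast
    then show "f differentiable (at x)" for x
      by (auto simp: real_differentiable_def)
    have "deriv f = f'"
      using * by (auto intro: DERIV_imp_deriv)
    then show "smooth_algebra (deriv f)"
      using * by simp
  qed
qed (rule smooth_algebra.base)

lemmas smooth_add = smooth_algebra.add[unfolded smooth_algebra_iff]
  and smooth_mult = smooth_algebra.mult[unfolded smooth_algebra_iff]
  and smooth_inverse = smooth_algebra.inverse[unfolded smooth_algebra_iff]
  and smooth_affine = smooth_algebra.affine[unfolded smooth_algebra_iff]

text \<open>The functions \<open>P(1/x) exp(-1/x)\<close>, extended by \<open>0\<close> to \<open>x \<le> 0\<close>: the derivative of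
  each of them is again of this form, which makes the flat function \<open>exp(-1/x)\<close> smooth.\<close>

definition flat :: "real poly \<Rightarrow> real \<Rightarrow> real" where
  "flat p x = (if x > 0 then poly p (inverse x) * exp (- inverse x) else 0)"

lemma poly_times_exp_minus_tendsto_0:
  "((\<lambda>y::real. poly p y * exp (- y)) \<longlongrightarrow> 0) at_top"
proof -
  have "((\<lambda>y. \<Sum>i\<le>degree p. coeff p i * (y ^ i / exp y)) \<longlongrightarrow> (\<Sum>i\<le>degree p. coeff p i * 0)) at_top"
    by (intro tendsto_intros tendsto_power_div_exp_0)
  then show ?thesis
    by (simp add: poly_altdef sum_distrib_right exp_minus divide_inverse mult.assoc)
qed

lemma flat_has_deriv:
  "(flat p has_real_derivative flat ([:0, 0, 1:] * (p - pderiv p)) x) (at x)"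
proof -
  consider "x > 0" | "x < 0" | "x = 0" by linarith
  then show ?thesis
  proof cases
    case 1
    have "((\<lambda>y. poly p (inverse y) * exp (- inverse y)) has_real_derivative
        flat ([:0, 0, 1:] * (p - pderiv p)) x) (at x)"
      using 1 unfolding flat_def
      by (auto intro!: derivative_eq_intros DERIV_chain2[OF poly_DERIV]
          simp: algebra_simps power2_eq_square)
    moreover have "\<forall>\<^sub>F y in nhds x. poly p (inverse y) * exp (- inverse y) = flat p y"
      using eventually_nhds_in_open[of "{0<..}" x] 1
      by (auto simp: flat_def elim!: eventually_mono)
    ultimately show ?thesis
      by (subst (asm) DERIV_cong_ev[OF refl _ refl])
  next
    case 2
    have "((\<lambda>x. 0) has_real_derivative flat ([:0, 0, 1:] * (p - pderiv p)) x) (at x)"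
      using 2 by (simp add: flat_def)
    moreover have "\<forall>\<^sub>F y in nhds x. 0 = flat p y"
      using eventually_nhds_in_open[of "{..<0}" x] 2
      by (auto simp: flat_def elim!: eventually_mono)
    ultimately show ?thesis
      by (subst (asm) DERIV_cong_ev[OF refl _ refl])
  next
    case 3
    have "((\<lambda>h. flat p h / h) \<longlongrightarrow> 0) (at_right 0)"
    proof (rule Lim_transform_eventually)
      show "((\<lambda>h. poly (pCons 0 p) (inverse h) * exp (- inverse h)) \<longlongrightarrow> 0) (at_right (0::real))"
        by (rule filterlim_compose[OF poly_times_exp_minus_tendsto_0 filterlim_inverse_at_top_right])
      show "\<forall>\<^sub>F h in at_right 0. poly (pCons 0 p) (inverse h) * exp (- inverse h) = flat p h / h"
        by (auto simp: flat_def divide_inverse eventually_at_filter)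
    qed
    moreover have "((\<lambda>h. flat p h / h) \<longlongrightarrow> 0) (at_left 0)"
      by (rule Lim_transform_eventually[of "\<lambda>_. 0"])
        (auto simp: flat_def eventually_at_filter)
    ultimately have "((\<lambda>h. flat p h / h) \<longlongrightarrow> 0) (at 0)"
      by (intro filterlim_split_at_real)
    then show ?thesis
      using 3 by (simp add: DERIV_def flat_def)
  qed
qed

lemma smooth_flat: "smooth (flat p)"
proof (rule smooth_coinduct[where P = "\<lambda>f. \<exists>p. f = flat p"])
  fix f assume "\<exists>p. f = flat p"
  then obtain p where p: "f = flat p" by blast
  show "f differentiable (at x)" for x
    using flat_has_deriv unfolding p real_differentiable_def by blast
  show "\<exists>p. deriv f = flat p"
    using DERIV_imp_deriv[OF flat_has_deriv] unfolding p by blast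
qed blast

text \<open>A transition from \<open>0\<close> on \<open>(-\<infinity>, -1]\<close> to \<open>1\<close> on \<open>[1, \<infinity>)\<close>.\<close>

definition smooth_step :: "real \<Rightarrow> real" where
  "smooth_step x = flat 1 (1 + x) * inverse (flat 1 (1 + x) + flat 1 (1 - x))"

lemma flat_1_mono: "x \<le> y \<Longrightarrow> flat 1 x \<le> flat 1 y"
  by (auto simp: flat_def intro: le_imp_inverse_le)

lemma flat_1_nonneg: "0 \<le> flat 1 x"
  by (simp add: flat_def)

lemma step_denominator_pos: "0 < flat 1 (1 + x) + flat 1 (1 - x)"
  by (cases "1 + x > 0") (auto simp: flat_def add_pos_nonneg)

lemma smooth_step: "smooth smooth_step"
proof -
  have "smooth (\<lambda>x. flat 1 (1 + x))" "smooth (\<lambda>x. flat 1 (1 - x))"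
    using smooth_affine[OF smooth_flat[of 1], of 1 1] smooth_affine[OF smooth_flat[of 1], of "-1" 1]
    by (simp_all add: add.commute)
  then have "smooth (\<lambda>x. flat 1 (1 + x) * inverse (flat 1 (1 + x) + flat 1 (1 - x)))"
    using step_denominator_pos by (intro smooth_mult smooth_inverse smooth_add) (auto simp: less_le)
  then show ?thesis
    unfolding smooth_step_def[abs_def] .
qed

lemma smooth_step_left: "x \<le> -1 \<Longrightarrow> smooth_step x = 0"
  by (simp add: smooth_step_def flat_def)

lemma smooth_step_right: "x \<ge> 1 \<Longrightarrow> smooth_step x = 1"
  using step_denominator_pos[of x] by (simp add: smooth_step_def flat_def)

lemma smooth_step_mono: "mono smooth_step"
proof (rule monoI)
  fix x y :: real assume "x \<le> y"
  define a b c d where "a = flat 1 (1 + x)" "b = flat 1 (1 - x)" "c = flat 1 (1 + y)" "d = flat 1 (1 - y)"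
  note defs = this
  have "a \<le> c" "d \<le> b" "0 \<le> a" "0 \<le> d" "0 < a + b" "0 < c + d"
    using \<open>x \<le> y\<close> step_denominator_pos by (auto simp: defs flat_1_mono flat_1_nonneg)
  then have "a * d \<le> c * b"
    by (intro mult_mono) auto
  then have "a / (a + b) \<le> c / (c + d)"
    using \<open>0 < a + b\<close> \<open>0 < c + d\<close> by (simp add: divide_le_eq pos_le_divide_eq algebra_simps)
  then show "smooth_step x \<le> smooth_step y"
    by (simp add: smooth_step_def defs divide_inverse)
qed

lemma smooth_step_bounds: "0 \<le> smooth_step x" "smooth_step x \<le> 1"
  using monoD[OF smooth_step_mono, of "-1" x] monoD[OF smooth_step_mono, of x 1]
    monoD[OF smooth_step_mono, of x "-1"] monoD[OF smooth_step_mono, of 1 x]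
  by (cases "x \<ge> 1"; cases "x \<le> -1"; simp add: smooth_step_left smooth_step_right)+

text \<open>The derivative of the step, rescaled, is a nonnegative bump of integral \<open>1\<close> on
  \<open>[x\<^sub>0 - \<epsilon>, x\<^sub>0 + \<epsilon>]\<close>.\<close>

definition bump :: "real \<Rightarrow> real \<Rightarrow> real \<Rightarrow> real" where
  "bump \<epsilon> x0 x = deriv smooth_step ((x - x0) / \<epsilon>) / \<epsilon>"

definition ramp :: "real \<Rightarrow> real \<Rightarrow> real \<Rightarrow> real" where
  "ramp \<epsilon> x0 x = smooth_step ((x - x0) / \<epsilon>)"

lemma smooth_ramp: "smooth (ramp \<epsilon> x0)"
proof -
  have "ramp \<epsilon> x0 = (\<lambda>x. smooth_step (inverse \<epsilon> * x + - x0 / \<epsilon>))"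
    by (auto simp: ramp_def divide_inverse algebra_simps)
  then show ?thesis
    using smooth_affine[OF smooth_step, of "inverse \<epsilon>" "- x0 / \<epsilon>"] by simp
qed

lemma ramp_has_deriv: "\<epsilon> \<noteq> 0 \<Longrightarrow> (ramp \<epsilon> x0 has_real_derivative bump \<epsilon> x0 x) (at x)"
  unfolding ramp_def bump_def
  by (rule DERIV_cong[OF DERIV_chain2[where g = "\<lambda>x. (x - x0) / \<epsilon>" and x = x,
          OF smooth_has_deriv[OF smooth_step]]])
    (auto intro!: derivative_eq_intros)

lemma deriv_ramp: "\<epsilon> \<noteq> 0 \<Longrightarrow> deriv (ramp \<epsilon> x0) = bump \<epsilon> x0"
  by (rule ext) (rule DERIV_imp_deriv[OF ramp_has_deriv])

lemma smooth_bump: "\<epsilon> \<noteq> 0 \<Longrightarrow> smooth (bump \<epsilon> x0)"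
  using smooth_deriv[OF smooth_ramp] deriv_ramp by metis

lemma bump_nonneg:
  assumes "0 < \<epsilon>"
  shows "0 \<le> bump \<epsilon> x0 x"
proof -
  have "mono_on UNIV (ramp \<epsilon> x0)"
    using assms by (auto simp: ramp_def intro!: monoI monoD[OF smooth_step_mono] divide_right_mono)
  then show ?thesis
    by (rule mono_on_imp_deriv_nonneg[OF _ ramp_has_deriv]) (use assms in auto)
qed

lemma ramp_left: "0 < \<epsilon> \<Longrightarrow> x \<le> x0 - \<epsilon> \<Longrightarrow> ramp \<epsilon> x0 x = 0"
  unfolding ramp_def by (intro smooth_step_left) (simp add: divide_le_eq)

lemma ramp_right: "0 < \<epsilon> \<Longrightarrow> x \<ge> x0 + \<epsilon> \<Longrightarrow> ramp \<epsilon> x0 x = 1"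
  unfolding ramp_def by (intro smooth_step_right) (simp add: le_divide_eq)

lemma ramp_bounds: "0 \<le> ramp \<epsilon> x0 x" "ramp \<epsilon> x0 x \<le> 1"
  unfolding ramp_def by (rule smooth_step_bounds)+

lemma bump_eq_0:
  assumes "0 < \<epsilon>" "\<bar>x - x0\<bar> \<ge> \<epsilon>"
  shows "bump \<epsilon> x0 x = 0"
proof (rule ccontr)
  define a where "a = bump \<epsilon> x0 x"
  assume "bump \<epsilon> x0 x \<noteq> 0"
  then have "a > 0"
    using bump_nonneg[OF assms(1)] by (auto simp: a_def less_le)
  have d: "(ramp \<epsilon> x0 has_real_derivative a) (at x)"
    unfolding a_def using assms by (intro ramp_has_deriv) auto
  consider "x \<ge> x0 + \<epsilon>" | "x \<le> x0 - \<epsilon>"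
    using assms(2) by linarith
  then show False
  proof cases
    case 1
    obtain e where "e > 0" "\<And>h. 0 < h \<Longrightarrow> h < e \<Longrightarrow> ramp \<epsilon> x0 x < ramp \<epsilon> x0 (x + h)"
      using DERIV_pos_inc_right[OF d \<open>a > 0\<close>] by blast
    from this(2)[of "e / 2"] this(1) show False
      using 1 assms(1) by (simp add: ramp_right)
  next
    case 2
    obtain e where "e > 0" "\<And>h. 0 < h \<Longrightarrow> h < e \<Longrightarrow> ramp \<epsilon> x0 (x - h) < ramp \<epsilon> x0 x"
      using DERIV_pos_inc_left[OF d \<open>a > 0\<close>] by blast
    from this(2)[of "e / 2"] this(1) show False
      using 2 assms(1) by (simp add: ramp_left)
  qed
qed

lemma bump_has_integral:
  assumes "0 < \<epsilon>" "a \<le> x0 - \<epsilon>" "x0 + \<epsilon> \<le> b"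
  shows "(bump \<epsilon> x0 has_integral 1) {a..b}"
proof -
  have "(bump \<epsilon> x0 has_integral ramp \<epsilon> x0 b - ramp \<epsilon> x0 a) {a..b}"
    using assms
    by (intro fundamental_theorem_of_calculus)
      (auto simp: has_real_derivative_iff_has_vector_derivative[symmetric]
        intro!: has_field_derivative_at_within ramp_has_deriv)
  then show ?thesis
    using assms by (simp add: ramp_left ramp_right)
qed

lemma bump_approximate_identity:
  fixes f :: "real \<Rightarrow> real"
  assumes f: "continuous_on {a..b} f" and "a < x0" "x0 < b"
  shows "((\<lambda>\<epsilon>. integral {a..b} (\<lambda>x. f x * bump \<epsilon> x0 x)) \<longlongrightarrow> f x0) (at_right 0)"
proof (rule tendstoI)
  fix e :: real assume "e > 0"
  have "isCont f x0"
    using f assms continuous_on_interior[of "{a..b}" f x0] by simp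
  then obtain d where "d > 0" and d: "\<And>x. \<bar>x - x0\<bar> < d \<Longrightarrow> \<bar>f x - f x0\<bar> < e / 2"
    unfolding continuous_at_eps_delta dist_real_def using \<open>e > 0\<close> by (meson half_gt_zero)
  have *: "dist (integral {a..b} (\<lambda>x. f x * bump \<epsilon> x0 x)) (f x0) < e"
    if \<epsilon>: "0 < \<epsilon>" "\<epsilon> < min d (min (x0 - a) (b - x0))" for \<epsilon>
  proof -
    have hi: "(bump \<epsilon> x0 has_integral 1) {a..b}"
      using \<epsilon> by (intro bump_has_integral) auto
    have int: "(\<lambda>x. f x * bump \<epsilon> x0 x) integrable_on {a..b}"
      using \<epsilon> by (intro integrable_continuous_interval continuous_on_mult f smooth_continuous smooth_bump) auto
    have "((\<lambda>x. (f x - f x0) * bump \<epsilon> x0 x) has_integral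
        (integral {a..b} (\<lambda>x. f x * bump \<epsilon> x0 x) - f x0 * 1)) {a..b}"
      unfolding left_diff_distrib
      by (intro has_integral_diff has_integral_mult_right hi integrable_integral int)
    then have eq: "integral {a..b} (\<lambda>x. f x * bump \<epsilon> x0 x) - f x0
        = integral {a..b} (\<lambda>x. (f x - f x0) * bump \<epsilon> x0 x)"
      and int': "(\<lambda>x. (f x - f x0) * bump \<epsilon> x0 x) integrable_on {a..b}"
      by (auto simp: has_integral_iff)
    have "norm (integral {a..b} (\<lambda>x. (f x - f x0) * bump \<epsilon> x0 x))
        \<le> integral {a..b} (\<lambda>x. (e / 2) * bump \<epsilon> x0 x)"
    proof (rule integral_norm_bound_integral[OF int'])
      show "(\<lambda>x. (e / 2) * bump \<epsilon> x0 x) integrable_on {a..b}"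
        using hi by (intro integrable_on_mult_right) auto
      fix x assume "x \<in> {a..b}"
      show "norm ((f x - f x0) * bump \<epsilon> x0 x) \<le> (e / 2) * bump \<epsilon> x0 x"
      proof (cases "\<bar>x - x0\<bar> < \<epsilon>")
        case True
        then show ?thesis
          using d[of x] \<epsilon> bump_nonneg[of \<epsilon> x0 x]
            mult_right_mono[of "\<bar>f x - f x0\<bar>" "e / 2" "bump \<epsilon> x0 x"]
          by (simp add: abs_mult)
      next
        case False
        then show ?thesis
          using \<epsilon> by (simp add: bump_eq_0)
      qed
    qed
    also have "\<dots> = e / 2"
      using integral_unique[OF hi] by simp
    finally show ?thesis
      using \<open>e > 0\<close> eq by (simp add: dist_real_def)
  qed
  show "\<forall>\<^sub>F \<epsilon> in at_right 0. dist (integral {a..b} (\<lambda>x. f x * bump \<epsilon> x0 x)) (f x0) < e"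
    unfolding eventually_at_right_field
    using * \<open>d > 0\<close> assms by (intro exI[of _ "min d (min (x0 - a) (b - x0))"]) auto
qed

section \<open>Space-time test functions\<close>

lemma C_k2_add:
  "C_k2 k \<eta> \<Longrightarrow> C_k2 k \<theta> \<Longrightarrow> C_k2 k (\<lambda>x t. \<eta> x t + \<theta> x t)"
proof (induction k arbitrary: \<eta> \<theta>)
  case 0
  then show ?case
    by (auto simp: case_prod_beta intro: continuous_on_add)
next
  case (Suc k)
  have diff: "(\<lambda>y. \<eta> y t) differentiable (at x)" "(\<lambda>s. \<eta> x s) differentiable (at t)"
    "(\<lambda>y. \<theta> y t) differentiable (at x)" "(\<lambda>s. \<theta> x s) differentiable (at t)" for x t
    using Suc.prems by auto
  have "dx (\<lambda>x t. \<eta> x t + \<theta> x t) = (\<lambda>x t. dx \<eta> x t + dx \<theta> x t)"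
    unfolding dx_def using diff
    by (intro ext DERIV_imp_deriv DERIV_add) (simp_all add: DERIV_deriv_iff_real_differentiable)
  moreover have "dt (\<lambda>x t. \<eta> x t + \<theta> x t) = (\<lambda>x t. dt \<eta> x t + dt \<theta> x t)"
    unfolding dt_def using diff
    by (intro ext DERIV_imp_deriv DERIV_add) (simp_all add: DERIV_deriv_iff_real_differentiable)
  ultimately show ?case
    using Suc diff by (auto simp: case_prod_beta intro: continuous_on_add differentiable_add)
qed

lemma plane_wave_product_derivs:
  assumes A: "smooth A" and B: "smooth B"
  shows "((\<lambda>y. A (a * y + b * t) * B (c * y + d * t)) has_real_derivative
        a * deriv A (a * x + b * t) * B (c * x + d * t) + A (a * x + b * t) * (c * deriv B (c * x + d * t))) (at x)"
    and "((\<lambda>s. A (a * x + b * s) * B (c * x + d * s)) has_real_derivative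
        b * deriv A (a * x + b * t) * B (c * x + d * t) + A (a * x + b * t) * (d * deriv B (c * x + d * t))) (at t)"
  by (auto intro!: derivative_eq_intros DERIV_chain2[OF smooth_has_deriv] A B)

lemma dx_plane_wave_product:
  assumes "smooth A" "smooth B"
  shows "dx (\<lambda>x t. A (a * x + b * t) * B (c * x + d * t)) =
    (\<lambda>x t. a * deriv A (a * x + b * t) * B (c * x + d * t) + A (a * x + b * t) * (c * deriv B (c * x + d * t)))"
  unfolding dx_def by (intro ext DERIV_imp_deriv plane_wave_product_derivs assms)

lemma dt_plane_wave_product:
  assumes "smooth A" "smooth B"
  shows "dt (\<lambda>x t. A (a * x + b * t) * B (c * x + d * t)) =
    (\<lambda>x t. b * deriv A (a * x + b * t) * B (c * x + d * t) + A (a * x + b * t) * (d * deriv B (c * x + d * t)))"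
  unfolding dt_def by (intro ext DERIV_imp_deriv plane_wave_product_derivs assms)

lemma continuous_plane_wave_product:
  assumes "smooth A" "smooth B"
  shows "continuous_on S (\<lambda>(x, t). A (a * x + b * t) * B (c * x + d * t))"
proof -
  have *: "continuous_on S (\<lambda>z. F (r * fst z + s * snd z))" if "smooth F" for F r s
    by (rule continuous_on_compose2[OF smooth_continuous[OF that, of UNIV]])
      (auto intro!: continuous_intros)
  show ?thesis
    unfolding case_prod_beta by (intro continuous_on_mult * assms)
qed

lemma C_k2_plane_wave_product:
  "smooth A \<Longrightarrow> smooth B \<Longrightarrow> C_k2 k (\<lambda>x t. A (a * x + b * t) * B (c * x + d * t))"
proof (induction k arbitrary: A B)
  case 0
  then show ?case
    by (simp add: continuous_plane_wave_product)
next
  case (Suc k)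
  note continuous_plane_wave_product[OF Suc.prems, of UNIV a b c d]
  moreover have smooth_dA: "smooth (\<lambda>x. r * deriv F x)" if "smooth F" for F r
    using that by (intro smooth_mult smooth_const smooth_deriv)
  have 1: "C_k2 k (\<lambda>x t. r * deriv A (a * x + b * t) * B (c * x + d * t))" for r
    using Suc.IH[OF smooth_dA[OF Suc.prems(1)] Suc.prems(2)] .
  have 2: "C_k2 k (\<lambda>x t. A (a * x + b * t) * (r * deriv B (c * x + d * t)))" for r
    using Suc.IH[OF Suc.prems(1) smooth_dA[OF Suc.prems(2)]] .
  have "C_k2 k (dx (\<lambda>x t. A (a * x + b * t) * B (c * x + d * t)))"
    "C_k2 k (dt (\<lambda>x t. A (a * x + b * t) * B (c * x + d * t)))"
    unfolding dx_plane_wave_product[OF Suc.prems] dt_plane_wave_product[OF Suc.prems]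
    by (rule C_k2_add[OF 1 2])+
  moreover have "(\<lambda>y. A (a * y + b * t) * B (c * y + d * t)) differentiable (at x)"
    "(\<lambda>s. A (a * x + b * s) * B (c * x + d * s)) differentiable (at t)" for x t
    using plane_wave_product_derivs[OF Suc.prems] real_differentiable_def by blast+
  ultimately show ?case
    by simp
qed

lemma compact_char_rectangle:
  "compact {(x::real, t). a \<le> t + x \<and> t + x \<le> b \<and> c \<le> t - x \<and> t - x \<le> d}"
proof -
  have "{(x, t). a \<le> t + x \<and> t + x \<le> b \<and> c \<le> t - x \<and> t - x \<le> d} =
      (\<lambda>z. ((fst z - snd z) / 2, (fst z + snd z) / 2)) ` ({a..b} \<times> {c..d})"
  proof safe
    fix x t :: real assume "a \<le> t + x" "t + x \<le> b" "c \<le> t - x" "t - x \<le> d"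
    then show "(x, t) \<in> (\<lambda>z. ((fst z - snd z) / 2, (fst z + snd z) / 2)) ` ({a..b} \<times> {c..d})"
      by (intro image_eqI[of _ _ "(t + x, t - x)"]) auto
  qed (auto simp: field_simps)
  moreover have "compact ((\<lambda>z. ((fst z - snd z) / 2, (fst z + snd z) / 2)) ` ({a..b} \<times> {c..d}))"
    by (intro compact_continuous_image continuous_intros compact_Times compact_Icc) auto
  ultimately show ?thesis
    by simp
qed

text \<open>In characteristic coordinates the wave operator is \<open>4 \<partial>\<^sub>\<xi> \<partial>\<^sub>\<eta>\<close>.\<close>

lemma wave_operator_plane_wave_product:
  assumes A: "smooth A" and B: "smooth B"
  defines "\<eta> \<equiv> \<lambda>x t. A (1 * x + 1 * t) * B ((-1) * x + 1 * t)"
  shows "dt (dt \<eta>) x t - dx (dx \<eta>) x t = 4 * (deriv A (t + x) * deriv B (t - x))"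
proof -
  note d = dx_plane_wave_product[OF A B, of 1 1 "-1" 1] dt_plane_wave_product[OF A B, of 1 1 "-1" 1]
  have "((\<lambda>s. dt \<eta> x s) has_real_derivative
      deriv (deriv A) (t + x) * B (t - x) + deriv A (t + x) * deriv B (t - x) +
      (deriv A (t + x) * deriv B (t - x) + A (t + x) * deriv (deriv B) (t - x))) (at t)"
    unfolding \<eta>_def d using A B
    by (auto intro!: derivative_eq_intros DERIV_chain2[OF smooth_has_deriv] smooth_deriv
        simp: algebra_simps)
  then have 1: "dt (dt \<eta>) x t = deriv (deriv A) (t + x) * B (t - x) + deriv A (t + x) * deriv B (t - x) +
      (deriv A (t + x) * deriv B (t - x) + A (t + x) * deriv (deriv B) (t - x))"
    unfolding dt_def[of "dt \<eta>"] by (rule DERIV_imp_deriv)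
  have "((\<lambda>y. dx \<eta> y t) has_real_derivative
      deriv (deriv A) (t + x) * B (t - x) - deriv A (t + x) * deriv B (t - x) +
      (- (deriv A (t + x) * deriv B (t - x)) + A (t + x) * deriv (deriv B) (t - x))) (at x)"
    unfolding \<eta>_def d using A B
    by (auto intro!: derivative_eq_intros DERIV_chain2[OF smooth_has_deriv] smooth_deriv
        simp: algebra_simps)
  then have 2: "dx (dx \<eta>) x t = deriv (deriv A) (t + x) * B (t - x) - deriv A (t + x) * deriv B (t - x) +
      (- (deriv A (t + x) * deriv B (t - x)) + A (t + x) * deriv (deriv B) (t - x))"
    unfolding dx_def[of "dx \<eta>"] by (rule DERIV_imp_deriv)
  show ?thesis
    unfolding 1 2 by simp
qed

text \<open>An integrand supported in a compact subset of the domain may be integrated over the whole plane,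
  where the iterated integral becomes a planar one that is insensitive to the moving boundary.\<close>

lemma domain_integral_eq_lborel:
  assumes K: "compact K" "K \<subseteq> moving_domain L v"
    and cont: "continuous_on K (\<lambda>(x, t). F x t)"
    and zero: "\<And>x t. (x, t) \<notin> K \<Longrightarrow> F x t = 0"
  shows "integrable lborel (\<lambda>(x, t). F x t)"
    and "domain_integral L v F = (\<integral>z. (case z of (x, t) \<Rightarrow> F x t) \<partial>lborel)"
proof -
  have eq: "(\<lambda>(x, t). F x t) = (\<lambda>z. indicator K z *\<^sub>R (case z of (x, t) \<Rightarrow> F x t))"
    using zero by (auto simp: fun_eq_iff indicator_def)
  show int: "integrable lborel (\<lambda>(x, t). F x t)"
    by (subst eq) (rule borel_integrable_compact[OF K(1) cont])
  then have int2: "integrable (lborel \<Otimes>\<^sub>M lborel) (\<lambda>(x, t). F x t)"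
    by (simp add: lborel_prod)
  have inner: "integral {v * t..L + v * t} (\<lambda>x. F x t) = (\<integral>x. F x t \<partial>lborel)" for t
  proof -
    define S where "S = {x. (x, t) \<in> K}"
    have "compact S"
    proof -
      have "S = fst ` (K \<inter> (UNIV \<times> {t}))"
        by (force simp: S_def image_def)
      moreover have "compact (fst ` (K \<inter> (UNIV \<times> {t})))"
        by (intro compact_continuous_image compact_Int_closed K closed_Times) (auto intro: continuous_intros)
      ultimately show ?thesis by simp
    qed
    moreover have "continuous_on S (\<lambda>x. F x t)"
      by (rule continuous_on_compose2[OF cont, of S "\<lambda>x. (x, t)", simplified])
        (auto simp: S_def intro!: continuous_intros)
    ultimately have "integrable lborel (\<lambda>x. indicator S x *\<^sub>R F x t)"
      by (rule borel_integrable_compact)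
    moreover have "(\<lambda>x. indicator S x *\<^sub>R F x t) = (\<lambda>x. F x t)"
      using zero by (auto simp: S_def indicator_def fun_eq_iff)
    ultimately have "integrable lborel (\<lambda>x. F x t)"
      by simp
    then have "integral UNIV (\<lambda>x. F x t) = (\<integral>x. F x t \<partial>lborel)"
      by (rule integral_lborel)
    moreover have "(\<lambda>x. F x t) = (\<lambda>x. if x \<in> {v * t..L + v * t} then F x t else 0)"
      using zero K(2) by (force simp: fun_eq_iff moving_domain_def)
    ultimately show ?thesis
      by (metis integral_restrict_UNIV)
  qed
  have "(\<lambda>t. \<integral>x. F x t \<partial>lborel) = (\<lambda>t. if t \<in> {0..} then \<integral>x. F x t \<partial>lborel else 0)"
  proof
    fix t
    have "F x t = 0" if "t < 0" for x
      using that zero K(2) by (force simp: moving_domain_def)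
    then show "(\<integral>x. F x t \<partial>lborel) = (if t \<in> {0..} then \<integral>x. F x t \<partial>lborel else 0)"
      by simp
  qed
  then have "domain_integral L v F = integral UNIV (\<lambda>t. \<integral>x. F x t \<partial>lborel)"
    unfolding domain_integral_def inner by (metis integral_restrict_UNIV)
  also have "\<dots> = (\<integral>t. (\<integral>x. F x t \<partial>lborel) \<partial>lborel)"
    by (rule integral_lborel) (rule lborel_pair.integrable_snd[OF int2])
  also have "\<dots> = (\<integral>z. (case z of (x, t) \<Rightarrow> F x t) \<partial>lborel)"
    using lborel_pair.integral_snd[OF int2] by (simp add: lborel_prod)
  finally show "domain_integral L v F = (\<integral>z. (case z of (x, t) \<Rightarrow> F x t) \<partial>lborel)" .
qed

text \<open>A bump of integral \<open>1\<close> in each characteristic variable; the factor \<open>1/2\<close> is the Jacobian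
  of \<open>(x, t) \<mapsto> (t + x, t - x)\<close>.\<close>

definition char_bump :: "real \<Rightarrow> real \<Rightarrow> real \<Rightarrow> real \<times> real \<Rightarrow> real" where
  "char_bump \<epsilon> \<xi> \<eta> = (\<lambda>(x, t). bump \<epsilon> \<xi> (t + x) * bump \<epsilon> \<eta> (t - x))"

lemma bump_lborel:
  assumes "0 < \<epsilon>"
  shows "integrable lborel (bump \<epsilon> x0)" "(\<integral>x. bump \<epsilon> x0 x \<partial>lborel) = 1"
proof -
  have "integrable lborel (\<lambda>x. indicator {x0 - \<epsilon>..x0 + \<epsilon>} x *\<^sub>R bump \<epsilon> x0 x)"
    using assms by (intro borel_integrable_compact smooth_continuous smooth_bump) auto
  moreover have out: "bump \<epsilon> x0 x = 0" if "\<not> (x0 - \<epsilon> \<le> x \<and> x \<le> x0 + \<epsilon>)" for x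
    using assms that by (intro bump_eq_0) auto
  have eq: "(\<lambda>x. indicator {x0 - \<epsilon>..x0 + \<epsilon>} x *\<^sub>R bump \<epsilon> x0 x) = bump \<epsilon> x0"
    "(\<lambda>x. if x \<in> {x0 - \<epsilon>..x0 + \<epsilon>} then bump \<epsilon> x0 x else 0) = bump \<epsilon> x0"
    using out by (auto simp: fun_eq_iff indicator_def)
  ultimately show int: "integrable lborel (bump \<epsilon> x0)"
    by simp
  have "integral UNIV (bump \<epsilon> x0) = 1"
    using bump_has_integral[OF assms, of "x0 - \<epsilon>" x0 "x0 + \<epsilon>"] eq(2)
    by (metis integral_restrict_UNIV integral_unique order_refl)
  then show "(\<integral>x. bump \<epsilon> x0 x \<partial>lborel) = 1"
    using integral_lborel[OF int] by simp
qed

lemma char_bump_nonneg: "0 < \<epsilon> \<Longrightarrow> 0 \<le> char_bump \<epsilon> \<xi> \<eta> z"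
  by (auto simp: char_bump_def bump_nonneg case_prod_beta)

lemma continuous_char_bump:
  assumes "0 < \<epsilon>"
  shows "continuous_on S (char_bump \<epsilon> \<xi> \<eta>)"
  using continuous_plane_wave_product[of "bump \<epsilon> \<xi>" "bump \<epsilon> \<eta>" S 1 1 "-1" 1] assms
  by (simp add: smooth_bump char_bump_def add.commute)

lemma char_bump_support:
  assumes "0 < \<epsilon>" "char_bump \<epsilon> \<xi> \<eta> (x, t) \<noteq> 0"
  shows "\<bar>t + x - \<xi>\<bar> < \<epsilon>" "\<bar>t - x - \<eta>\<bar> < \<epsilon>"
  using assms bump_eq_0[of \<epsilon>] by (force simp: char_bump_def not_le[symmetric])+

text \<open>The shear \<open>(x, t) \<mapsto> (t + x, t)\<close> followed by Fubini decouples the two factors; only the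
  stretching \<open>t \<mapsto> 2 t\<close> in the second one changes the integral.\<close>

lemma char_bump_integral:
  assumes "0 < \<epsilon>"
  shows "integrable lborel (char_bump \<epsilon> \<xi> \<eta>)"
    and "(\<integral>z. char_bump \<epsilon> \<xi> \<eta> z \<partial>lborel) = 1 / 2"
proof -
  define K where "K = {(x::real, t). \<xi> - \<epsilon> \<le> t + x \<and> t + x \<le> \<xi> + \<epsilon> \<and> \<eta> - \<epsilon> \<le> t - x \<and> t - x \<le> \<eta> + \<epsilon>}"
  have "compact K"
    unfolding K_def by (rule compact_char_rectangle)
  then have "integrable lborel (\<lambda>z. indicator K z *\<^sub>R char_bump \<epsilon> \<xi> \<eta> z)"
    by (rule borel_integrable_compact) (rule continuous_char_bump[OF assms])
  moreover have "(\<lambda>z. indicator K z *\<^sub>R char_bump \<epsilon> \<xi> \<eta> z) = char_bump \<epsilon> \<xi> \<eta>"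
  proof
    fix z show "indicator K z *\<^sub>R char_bump \<epsilon> \<xi> \<eta> z = char_bump \<epsilon> \<xi> \<eta> z"
      using char_bump_support[OF assms, of \<xi> \<eta> "fst z" "snd z"]
      by (cases z; cases "char_bump \<epsilon> \<xi> \<eta> z = 0") (auto simp: K_def indicator_def)
  qed
  ultimately show int: "integrable lborel (char_bump \<epsilon> \<xi> \<eta>)"
    by simp
  define g where "g = (\<lambda>y t. bump \<epsilon> \<xi> y * bump \<epsilon> \<eta> (2 * t - y))"
  have shear: "integrable lborel (\<lambda>(y, t). g y t)"
  proof -
    define K' where "K' = (\<lambda>z. (fst z, (fst z + snd z) / 2)) ` ({\<xi> - \<epsilon>..\<xi> + \<epsilon>} \<times> {\<eta> - \<epsilon>..\<eta> + \<epsilon>})"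
    have "compact K'"
      unfolding K'_def
      by (intro compact_continuous_image continuous_intros compact_Times compact_Icc) auto
    moreover have "continuous_on K' (\<lambda>(y, t). g y t)"
      using continuous_plane_wave_product[of "bump \<epsilon> \<xi>" "bump \<epsilon> \<eta>" K' 1 0 "-1" 2] assms
      by (simp add: smooth_bump g_def)
    ultimately have "integrable lborel (\<lambda>z. indicator K' z *\<^sub>R (case z of (y, t) \<Rightarrow> g y t))"
      by (rule borel_integrable_compact)
    moreover have "(\<lambda>z. indicator K' z *\<^sub>R (case z of (y, t) \<Rightarrow> g y t)) = (\<lambda>(y, t). g y t)"
    proof (intro ext, clarify)
      fix y t
      have "(y, t) \<in> K'" if "g y t \<noteq> 0"
      proof -
        have "\<bar>y - \<xi>\<bar> < \<epsilon>" "\<bar>2 * t - y - \<eta>\<bar> < \<epsilon>"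
          using that bump_eq_0[OF assms] by (force simp: g_def not_le[symmetric])+
        then show ?thesis
          unfolding K'_def by (intro image_eqI[of _ _ "(y, 2 * t - y)"]) (auto simp: abs_less_iff)
      qed
      then show "indicator K' (y, t) *\<^sub>R g y t = g y t"
        by (auto simp: indicator_def)
    qed
    ultimately show ?thesis
      by simp
  qed
  have "(\<integral>z. char_bump \<epsilon> \<xi> \<eta> z \<partial>lborel) = (\<integral>t. (\<integral>x. bump \<epsilon> \<xi> (t + x) * bump \<epsilon> \<eta> (t - x) \<partial>lborel) \<partial>lborel)"
    using lborel_pair.integral_snd[of "\<lambda>x t. bump \<epsilon> \<xi> (t + x) * bump \<epsilon> \<eta> (t - x)"] int
    by (simp add: lborel_prod char_bump_def)
  also have "\<dots> = (\<integral>t. (\<integral>y. g y t \<partial>lborel) \<partial>lborel)"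
  proof (rule Bochner_Integration.integral_cong[OF refl])
    fix t
    show "(\<integral>x. bump \<epsilon> \<xi> (t + x) * bump \<epsilon> \<eta> (t - x) \<partial>lborel) = (\<integral>y. g y t \<partial>lborel)"
      using lborel_integral_real_affine[of 1 "\<lambda>x. bump \<epsilon> \<xi> (t + x) * bump \<epsilon> \<eta> (t - x)" "- t"]
      by (simp add: g_def algebra_simps)
  qed
  also have "\<dots> = (\<integral>y. (\<integral>t. g y t \<partial>lborel) \<partial>lborel)"
    by (rule lborel_pair.Fubini_integral) (use shear in \<open>simp add: lborel_prod\<close>)
  also have "\<dots> = (\<integral>y. bump \<epsilon> \<xi> y * (1 / 2) \<partial>lborel)"
  proof -
    have "(\<integral>t. bump \<epsilon> \<eta> (2 * t - y) \<partial>lborel) = 1 / 2" for y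
      using lborel_integral_real_affine[of 2 "bump \<epsilon> \<eta>" "- y"] bump_lborel(2)[OF assms, of \<eta>]
      by (simp add: add.commute)
    then show ?thesis
      by (simp only: g_def integral_mult_right_zero)
  qed
  also have "\<dots> = 1 / 2"
    using bump_lborel[OF assms] by simp
  finally show "(\<integral>z. char_bump \<epsilon> \<xi> \<eta> z \<partial>lborel) = 1 / 2" .
qed

section \<open>Continuity of weak solutions\<close>

text \<open>The approximating test functions are primitives of their derivatives, which converge in mean
  square. So the test functions converge uniformly to the primitive of \<open>g\<close>, and the continuous
  function \<open>f\<close> must be this primitive. The value \<open>0\<close> at both ends is inherited from the test functions.\<close>

lemma H1_0_integral:
  assumes H: "H1_0_with_deriv a b f g" and ab: "a < b"
  shows "x \<in> {a..b} \<Longrightarrow> f x = integral {a..x} g" and "f b = 0"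
proof -
  have f: "L2_on {a..b} f" "continuous_on {a..b} f" and g: "L2_on {a..b} g"
    using H by (auto simp: H1_0_with_deriv_def)
  obtain \<psi> where \<psi>: "\<And>k. test_fun a b (\<psi> k)"
    and lim0: "(\<lambda>k. integral {a..b} (\<lambda>x. (\<psi> k x - f x)\<^sup>2)) \<longlonglongrightarrow> 0"
    and lim1: "(\<lambda>k. integral {a..b} (\<lambda>x. (deriv (\<psi> k) x - g x)\<^sup>2)) \<longlonglongrightarrow> 0"
    using H by (auto simp: H1_0_with_deriv_def)
  have smooth: "smooth (\<psi> k)" for k
    using \<psi> by (auto simp: test_fun_def smooth_def)
  have ends: "\<psi> k a = 0" "\<psi> k b = 0" for k
    using \<psi>[of k] by (force simp: test_fun_def)+
  define G where "G = (\<lambda>x. integral {a..x} g)"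
  define e where "e = (\<lambda>k. sqrt (b - a) * sqrt (integral {a..b} (\<lambda>x. (deriv (\<psi> k) x - g x)\<^sup>2)))"
  have e: "e \<longlonglongrightarrow> 0"
    unfolding e_def by (rule tendsto_eq_intros lim1 | simp)+
  have close: "\<bar>\<psi> k x - G x\<bar> \<le> e k" if x: "x \<in> {a..b}" for k x
  proof -
    have d: "L2_on {a..b} (\<lambda>x. deriv (\<psi> k) x)"
      by (intro L2_on_continuous smooth_continuous smooth_deriv smooth)
    have "(deriv (\<psi> k) has_integral \<psi> k x - \<psi> k a) {a..x}"
      using x by (intro fundamental_theorem_of_calculus)
        (auto simp: has_real_derivative_iff_has_vector_derivative[symmetric]
          intro!: has_field_derivative_at_within smooth_has_deriv smooth)
    moreover have "(g has_integral G x) {a..x}"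
      unfolding G_def using x
      by (intro integrable_integral L2_on_integrable L2_on_subinterval[OF g]) auto
    ultimately have "((\<lambda>x. deriv (\<psi> k) x - g x) has_integral \<psi> k x - G x) {a..x}"
      using has_integral_diff[of "deriv (\<psi> k)" "\<psi> k x - \<psi> k a"] ends by simp
    then show ?thesis
      using integral_subinterval_L2_bound[OF L2_on_diff[OF d g], of a x] x
      by (simp add: integral_unique e_def)
  qed
  have G: "continuous_on {a..b} G"
    unfolding G_def by (rule indefinite_integral_continuous_1[OF L2_on_integrable[OF g]])
  have le: "integral {a..b} (\<lambda>x. (f x - G x)\<^sup>2)
      \<le> 2 * integral {a..b} (\<lambda>x. (\<psi> k x - f x)\<^sup>2) + 2 * ((b - a) * (e k)\<^sup>2)" for k
  proof -
    have L2: "L2_on {a..b} (\<lambda>x. \<psi> k x - f x)" "L2_on {a..b} (\<lambda>x. f x - \<psi> k x)"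
      "L2_on {a..b} (\<lambda>x. \<psi> k x - G x)"
      by (intro L2_on_diff f G L2_on_continuous smooth_continuous smooth)+
    have "integral {a..b} (\<lambda>x. (\<psi> k x - G x)\<^sup>2) \<le> integral {a..b} (\<lambda>x. (e k)\<^sup>2)"
    proof (rule integral_le)
      show "(\<lambda>x. (\<psi> k x - G x)\<^sup>2) integrable_on {a..b}"
        by (rule L2_on_square[OF L2(3)])
      fix x assume "x \<in> {a..b}"
      then show "(\<psi> k x - G x)\<^sup>2 \<le> (e k)\<^sup>2"
        using power_mono[OF close[of x k], of 2] by simp
    qed auto
    then have "integral {a..b} (\<lambda>x. (\<psi> k x - G x)\<^sup>2) \<le> (b - a) * (e k)\<^sup>2"
      using ab by simp
    moreover have "integral {a..b} (\<lambda>x. (f x - G x)\<^sup>2)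
        \<le> 2 * integral {a..b} (\<lambda>x. (f x - \<psi> k x)\<^sup>2) + 2 * integral {a..b} (\<lambda>x. (\<psi> k x - G x)\<^sup>2)"
      using square_integral_add_le[OF L2(2,3)] by simp
    ultimately show ?thesis
      by (simp add: power2_commute)
  qed
  have "(\<lambda>k. 2 * integral {a..b} (\<lambda>x. (\<psi> k x - f x)\<^sup>2) + 2 * ((b - a) * (e k)\<^sup>2)) \<longlonglongrightarrow>
      2 * 0 + 2 * ((b - a) * 0\<^sup>2)"
    by (intro tendsto_intros lim0 e)
  then have "integral {a..b} (\<lambda>x. (f x - G x)\<^sup>2) \<le> 0"
    using le by (intro LIMSEQ_le_const) auto
  moreover have "0 \<le> integral {a..b} (\<lambda>x. (f x - G x)\<^sup>2)"
    by (intro integral_nonneg L2_on_square L2_on_diff f L2_on_continuous G) auto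
  ultimately have "\<forall>x\<in>{a..b}. (f x - G x)\<^sup>2 = 0"
    using ab by (subst integral_eq_0_iff[symmetric]) (auto intro!: continuous_intros f G)
  then have fG: "f x = G x" if "x \<in> {a..b}" for x
    using that by simp
  then show "x \<in> {a..b} \<Longrightarrow> f x = integral {a..x} g"
    by (simp add: G_def)
  have "\<bar>f b\<bar> \<le> e k" for k
    using close[of b k] ends(2)[of k] fG[of b] ab by simp
  then have "\<bar>f b\<bar> \<le> 0"
    using e by (intro LIMSEQ_le_const) auto
  then show "f b = 0"
    by simp
qed

locale moving_string =
  fixes L v :: real and \<phi>0 \<phi>1 :: "real \<Rightarrow> real" and \<phi> \<phi>x \<phi>t :: "real \<Rightarrow> real \<Rightarrow> real"
  assumes L: "0 < L" and v: "0 < v" "v < 1"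
    and sol: "weak_solution L v \<phi>0 \<phi>1 \<phi> \<phi>x \<phi>t"
begin

lemma phi_H1: "0 \<le> t \<Longrightarrow> H1_0_with_deriv (v * t) (L + v * t) (\<lambda>x. \<phi> x t) (\<lambda>x. \<phi>x x t)"
  using sol by (simp add: weak_solution_def)

lemma phi_C_L2: "0 < T \<Longrightarrow> C_L2 L v T \<phi>x" "0 < T \<Longrightarrow> C_L2 L v T \<phi>t"
  using sol by (auto simp: weak_solution_def)

lemma phi_eq_integral:
  assumes "0 \<le> t" "x \<in> {v * t..L + v * t}"
  shows "\<phi> x t = integral {v * t..x} (\<lambda>x. \<phi>x x t)"
  using H1_0_integral(1)[OF phi_H1[OF assms(1)]] assms(2) L by simp

lemma phi_ends:
  assumes "0 \<le> t"
  shows "\<phi> (v * t) t = 0" "\<phi> (L + v * t) t = 0"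
  using H1_0_integral(2)[OF phi_H1[OF assms]] phi_eq_integral[OF assms, of "v * t"] L by auto

lemma L2_moving_frame:
  assumes "C_L2 L v T u" "t \<in> {0..T}"
  shows "L2_on {0..L} (\<lambda>y. u (y + v * t) t)"
  using L2_on_affine[of 1 0 "v * t" L "\<lambda>x. u x t"] assms by (simp add: C_L2_def)

definition string_domain :: "(real \<times> real) set" where
  "string_domain = {(x, t). 0 \<le> t \<and> v * t \<le> x \<and> x \<le> L + v * t}"

text \<open>The Sobolev embedding on \<open>[0, L]\<close> turns continuity in time with values in \<open>H\<^sup>1\<close> into joint
  continuity up to the boundary.\<close>

lemma continuous_phi: "continuous_on string_domain (\<lambda>(x, t). \<phi> x t)"
  unfolding continuous_on_iff
proof (intro ballI allI impI)
  fix z0 :: "real \<times> real" and e :: real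
  assume z0: "z0 \<in> string_domain" and "0 < e"
  obtain x0 s where z0_eq: "z0 = (x0, s)" by fastforce
  have s: "0 \<le> s" and x0: "v * s \<le> x0" "x0 \<le> L + v * s"
    using z0 by (auto simp: string_domain_def z0_eq)
  define T where "T = s + 1"
  have "0 < T" "s \<in> {0..T}"
    using s by (auto simp: T_def)
  define N where "N = (\<lambda>t. integral {0..L} (\<lambda>y. (\<phi>x (y + v * t) t - \<phi>x (y + v * s) s)\<^sup>2))"
  have "((\<lambda>t. sqrt L * sqrt (N t)) \<longlongrightarrow> sqrt L * sqrt 0) (at s within {0..T})"
    using phi_C_L2(1)[OF \<open>0 < T\<close>] \<open>s \<in> {0..T}\<close> unfolding C_L2_def N_def
    by (intro tendsto_intros) auto
  then obtain d1 where "d1 > 0" and d1: "\<And>t. t \<in> {0..T} \<Longrightarrow> t \<noteq> s \<Longrightarrow> \<bar>t - s\<bar> < d1 \<Longrightarrow> \<bar>sqrt L * sqrt (N t)\<bar> < e / 2"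
    using \<open>0 < e\<close> unfolding tendsto_iff eventually_at dist_real_def by (metis diff_zero half_gt_zero mult_zero_right real_sqrt_zero)
  have d1': "\<bar>sqrt L * sqrt (N t)\<bar> < e / 2" if "t \<in> {0..T}" "\<bar>t - s\<bar> < d1" for t
    using d1[OF that(1) _ that(2)] \<open>0 < e\<close> by (cases "t = s") (auto simp: N_def)
  have "continuous_on {v * s..L + v * s} (\<lambda>x. \<phi> x s)"
    using phi_H1[OF s] by (simp add: H1_0_with_deriv_def)
  then obtain d2 where "d2 > 0" and d2: "\<And>x. x \<in> {v * s..L + v * s} \<Longrightarrow> \<bar>x - x0\<bar> < d2 \<Longrightarrow> \<bar>\<phi> x s - \<phi> x0 s\<bar> < e / 2"
    using \<open>0 < e\<close> x0 unfolding continuous_on_iff dist_real_def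
    by (metis atLeastAtMost_iff half_gt_zero)
  define d where "d = min (min 1 d1) (d2 / 2)"
  have "d > 0"
    using \<open>d1 > 0\<close> \<open>d2 > 0\<close> by (simp add: d_def)
  moreover have "dist (case z of (x, t) \<Rightarrow> \<phi> x t) (case z0 of (x, t) \<Rightarrow> \<phi> x t) < e"
    if z: "z \<in> string_domain" "dist z z0 < d" for z
  proof -
    obtain x t where z_eq: "z = (x, t)" by fastforce
    have t: "0 \<le> t" and x: "v * t \<le> x" "x \<le> L + v * t"
      using z by (auto simp: string_domain_def z_eq)
    have dt: "\<bar>t - s\<bar> < d" and dx: "\<bar>x - x0\<bar> < d"
      using dist_snd_le[of z z0] dist_fst_le[of z z0] z(2) by (auto simp: z_eq z0_eq dist_real_def)
    have tT: "t \<in> {0..T}"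
      using dt t by (auto simp: T_def d_def)
    define y where "y = x - v * t"
    have y: "0 \<le> y" "y \<le> L"
      using x by (auto simp: y_def)
    have mf: "\<phi> (y + v * r) r = integral {0..y} (\<lambda>z. \<phi>x (z + v * r) r)" if "0 \<le> r" for r
      using phi_eq_integral[of r "y + v * r"] that y integral_affine[where m = 1 and f = "\<lambda>x. \<phi>x x r" and k = "v * r" and a = 0 and b = y]
      by simp
    have L2: "L2_on {0..L} (\<lambda>z. \<phi>x (z + v * t) t)" "L2_on {0..L} (\<lambda>z. \<phi>x (z + v * s) s)"
      using L2_moving_frame[OF phi_C_L2(1)[OF \<open>0 < T\<close>]] tT \<open>s \<in> {0..T}\<close> by auto
    have "\<bar>\<phi> (y + v * t) t - \<phi> (y + v * s) s\<bar> = \<bar>integral {0..y} (\<lambda>z. \<phi>x (z + v * t) t - \<phi>x (z + v * s) s)\<bar>"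
      unfolding mf[OF t] mf[OF s] using L2 y
      by (subst Henstock_Kurzweil_Integration.integral_diff)
        (auto intro!: L2_on_integrable elim!: L2_on_subinterval)
    also have "\<dots> \<le> sqrt L * sqrt (N t)"
      using integral_subinterval_L2_bound[OF L2_on_diff[OF L2], of 0 y] y by (simp add: N_def)
    also have "\<dots> < e / 2"
      using d1'[OF tT] dt by (simp add: d_def)
    finally have 1: "\<bar>\<phi> x t - \<phi> (y + v * s) s\<bar> < e / 2"
      by (simp add: y_def)
    have "\<bar>v * (s - t)\<bar> = v * \<bar>t - s\<bar>"
      using v by (simp add: abs_mult abs_minus_commute)
    moreover have "y + v * s - x0 = (x - x0) + v * (s - t)"
      by (simp add: y_def algebra_simps)
    ultimately have "\<bar>y + v * s - x0\<bar> \<le> \<bar>x - x0\<bar> + v * \<bar>t - s\<bar>"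
      using abs_triangle_ineq[of "x - x0" "v * (s - t)"] by simp
    also have "\<dots> < d + 1 * d"
      using dx dt v by (intro add_strict_mono mult_strict_mono') auto
    also have "\<dots> \<le> d2"
      by (simp add: d_def)
    finally have "\<bar>\<phi> (y + v * s) s - \<phi> x0 s\<bar> < e / 2"
      using y by (intro d2) auto
    with 1 show ?thesis
      unfolding z_eq z0_eq dist_real_def prod.case by linarith
  qed
  ultimately show "\<exists>d>0. \<forall>z\<in>string_domain. dist z z0 < d \<longrightarrow>
      dist (case z of (x, t) \<Rightarrow> \<phi> x t) (case z0 of (x, t) \<Rightarrow> \<phi> x t) < e"
    by blast
qed

end

section \<open>The parallelogram identity and d'Alembert's representation\<close>

context moving_string
begin

text \<open>\<open>\<phi>\<close> at the point with characteristic coordinates \<open>\<xi> = t + x\<close>, \<open>\<eta> = t - x\<close>.\<close>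

definition phi_char :: "real \<Rightarrow> real \<Rightarrow> real" where
  "phi_char \<xi> \<eta> = \<phi> ((\<xi> - \<eta>) / 2) ((\<xi> + \<eta>) / 2)"

lemma char_rectangle_subset:
  assumes "(1 + v) * d < (1 - v) * a" "(1 - v) * b < (1 + v) * c + 2 * L" "0 < a + c"
  shows "{(x, t). a \<le> t + x \<and> t + x \<le> b \<and> c \<le> t - x \<and> t - x \<le> d} \<subseteq> moving_domain L v"
proof clarify
  fix x t assume *: "a \<le> t + x" "t + x \<le> b" "c \<le> t - x" "t - x \<le> d"
  have "(1 - v) * a \<le> (1 - v) * (t + x)" "(1 - v) * (t + x) \<le> (1 - v) * b"
    "(1 + v) * c \<le> (1 + v) * (t - x)" "(1 + v) * (t - x) \<le> (1 + v) * d"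
    using * v by (auto intro!: mult_left_mono)
  then have "(1 + v) * (t - x) < (1 - v) * (t + x)" "(1 - v) * (t + x) < (1 + v) * (t - x) + 2 * L"
    using assms by linarith+
  then show "(x, t) \<in> moving_domain L v"
    using * assms(3) by (simp add: moving_domain_def algebra_simps)
qed

lemma moving_domain_subset: "moving_domain L v \<subseteq> string_domain"
  by (auto simp: moving_domain_def string_domain_def)

text \<open>The factor \<open>1/2\<close> is the total mass of \<open>char_bump\<close>. The bound on \<open>\<epsilon>\<close> in the proof is
  at most half the slack in each inequality that defines the domain, so that the support stays inside.\<close>

lemma char_bump_approximates_phi:
  assumes "(1 + v) * \<eta> < (1 - v) * \<xi>" "(1 - v) * \<xi> < (1 + v) * \<eta> + 2 * L" "0 < \<xi> + \<eta>"
  shows "((\<lambda>\<epsilon>. \<integral>(x, t). \<phi> x t * char_bump \<epsilon> \<xi> \<eta> (x, t) \<partial>lborel) \<longlongrightarrow> phi_char \<xi> \<eta> / 2) (at_right 0)"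
proof (rule tendstoI)
  fix e :: real assume "e > 0"
  define z0 where "z0 = ((\<xi> - \<eta>) / 2, (\<xi> + \<eta>) / 2)"
  have "z0 \<in> string_domain"
    using char_rectangle_subset[OF assms] moving_domain_subset by (force simp: z0_def field_simps)
  then obtain d where "d > 0" and d: "\<And>z. z \<in> string_domain \<Longrightarrow> dist z z0 < d \<Longrightarrow>
      dist (case z of (x, t) \<Rightarrow> \<phi> x t) (phi_char \<xi> \<eta>) < e"
    using continuous_phi \<open>e > 0\<close> unfolding continuous_on_iff by (force simp: z0_def phi_char_def)
  define m where "m = min (d / 2) (min ((\<xi> + \<eta>) / 2)
      (min (((1 - v) * \<xi> - (1 + v) * \<eta>) / 2) (((1 + v) * \<eta> + 2 * L - (1 - v) * \<xi>) / 2)))"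
  have "m > 0"
    using assms \<open>d > 0\<close> by (simp add: m_def)
  have *: "dist (\<integral>(x, t). \<phi> x t * char_bump \<epsilon> \<xi> \<eta> (x, t) \<partial>lborel) (phi_char \<xi> \<eta> / 2) < e"
    if \<epsilon>: "0 < \<epsilon>" "\<epsilon> < m" for \<epsilon>
  proof -
    define K where "K = {(x::real, t). \<xi> - \<epsilon> \<le> t + x \<and> t + x \<le> \<xi> + \<epsilon> \<and> \<eta> - \<epsilon> \<le> t - x \<and> t - x \<le> \<eta> + \<epsilon>}"
    have K: "compact K" "K \<subseteq> moving_domain L v"
      unfolding K_def using \<epsilon>
      by (intro compact_char_rectangle char_rectangle_subset; simp add: m_def algebra_simps)+
    have outside: "char_bump \<epsilon> \<xi> \<eta> (x, t) = 0" if "(x, t) \<notin> K" for x t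
    proof (rule ccontr)
      assume "char_bump \<epsilon> \<xi> \<eta> (x, t) \<noteq> 0"
      from char_bump_support[OF \<epsilon>(1) this] that show False
        by (auto simp: K_def abs_less_iff)
    qed
    have cont: "continuous_on K (\<lambda>(x, t). \<phi> x t * char_bump \<epsilon> \<xi> \<eta> (x, t))"
      using continuous_on_subset[OF continuous_phi] K(2) moving_domain_subset continuous_char_bump[OF \<epsilon>(1), of K \<xi> \<eta>]
      by (auto simp: case_prod_beta' intro!: continuous_on_mult)
    have int: "integrable lborel (\<lambda>(x, t). \<phi> x t * char_bump \<epsilon> \<xi> \<eta> (x, t))"
      by (rule domain_integral_eq_lborel(1)[OF K cont]) (simp add: outside)
    note cb = char_bump_integral[OF \<epsilon>(1), of \<xi> \<eta>]
    have int': "integrable lborel (\<lambda>(x, t). (\<phi> x t - phi_char \<xi> \<eta>) * char_bump \<epsilon> \<xi> \<eta> (x, t))"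
      using Bochner_Integration.integrable_diff[OF int integrable_mult_right[OF cb(1), of "phi_char \<xi> \<eta>"]]
      by (simp add: case_prod_beta' left_diff_distrib)
    have "(\<integral>(x, t). \<phi> x t * char_bump \<epsilon> \<xi> \<eta> (x, t) \<partial>lborel) - phi_char \<xi> \<eta> / 2
        = (\<integral>(x, t). (\<phi> x t - phi_char \<xi> \<eta>) * char_bump \<epsilon> \<xi> \<eta> (x, t) \<partial>lborel)"
      using Bochner_Integration.integral_diff[OF int integrable_mult_right[OF cb(1), of "phi_char \<xi> \<eta>"]] cb(2)
      by (simp add: case_prod_beta' left_diff_distrib)
    also have "norm \<dots> \<le> (\<integral>z. e * char_bump \<epsilon> \<xi> \<eta> z \<partial>lborel)"
    proof (rule order_trans[OF integral_norm_bound integral_mono])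
      show "integrable lborel (\<lambda>z. norm (case z of (x, t) \<Rightarrow> (\<phi> x t - phi_char \<xi> \<eta>) * char_bump \<epsilon> \<xi> \<eta> (x, t)))"
        by (rule integrable_norm[OF int'])
      show "integrable lborel (\<lambda>z. e * char_bump \<epsilon> \<xi> \<eta> z)"
        by (rule integrable_mult_right) (rule cb(1))
      fix z :: "real \<times> real"
      obtain x t where z: "z = (x, t)" by fastforce
      show "norm (case z of (x, t) \<Rightarrow> (\<phi> x t - phi_char \<xi> \<eta>) * char_bump \<epsilon> \<xi> \<eta> (x, t)) \<le> e * char_bump \<epsilon> \<xi> \<eta> z"
      proof (cases "z \<in> K")
        case True
        have "dist z z0 \<le> dist x (fst z0) + dist t (snd z0)"
          unfolding z dist_prod_def using sqrt_sum_squares_le_sum[of "dist x (fst z0)" "dist t (snd z0)"] by simp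
        also have "\<dots> \<le> \<epsilon> + \<epsilon>"
        proof (intro add_mono)
          have "\<bar>(t + x) - \<xi>\<bar> \<le> \<epsilon>" "\<bar>(t - x) - \<eta>\<bar> \<le> \<epsilon>"
            using True by (auto simp: K_def z abs_le_iff)
          then show "dist x (fst z0) \<le> \<epsilon>" "dist t (snd z0) \<le> \<epsilon>"
            by (simp_all add: z0_def dist_real_def abs_le_iff field_simps)
        qed
        also have "\<dots> < d"
          using \<epsilon> by (simp add: m_def)
        finally have "\<bar>\<phi> x t - phi_char \<xi> \<eta>\<bar> < e"
          using d[of z] True K(2) moving_domain_subset by (auto simp: z dist_real_def)
        then show ?thesis
          using char_bump_nonneg[OF \<epsilon>(1), of \<xi> \<eta> z] by (auto simp: z abs_mult intro!: mult_right_mono)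
      next
        case False
        then show ?thesis
          using outside by (simp add: z)
      qed
    qed
    also have "\<dots> = e / 2"
      using cb by simp
    finally show ?thesis
      using \<open>e > 0\<close> by (simp add: dist_real_def)
  qed
  show "\<forall>\<^sub>F \<epsilon> in at_right 0. dist (\<integral>(x, t). \<phi> x t * char_bump \<epsilon> \<xi> \<eta> (x, t) \<partial>lborel) (phi_char \<xi> \<eta> / 2) < e"
    unfolding eventually_at_right_field using * \<open>m > 0\<close> by blast
qed

text \<open>The test function is a product \<open>A(t + x) B(t - x)\<close> of two smoothed indicator functions.
  The wave operator maps it to \<open>4 A'(t + x) B'(t - x)\<close>, which is a signed combination of four
  bumps at the corners of a characteristic rectangle.\<close>

lemma parallelogram_identity_interior:
  assumes le: "\<xi>1 \<le> \<xi>2" "\<eta>1 \<le> \<eta>2"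
    and dom: "(1 + v) * \<eta>2 < (1 - v) * \<xi>1" "(1 - v) * \<xi>2 < (1 + v) * \<eta>1 + 2 * L" "0 < \<xi>1 + \<eta>1"
  shows "phi_char \<xi>2 \<eta>2 + phi_char \<xi>1 \<eta>1 = phi_char \<xi>2 \<eta>1 + phi_char \<xi>1 \<eta>2"
proof -
  define f where "f = (\<lambda>\<epsilon> \<xi> \<eta> (x, t). \<phi> x t * char_bump \<epsilon> \<xi> \<eta> (x, t))"
  define I where "I = (\<lambda>\<xi> \<eta> \<epsilon>. \<integral>z. f \<epsilon> \<xi> \<eta> z \<partial>lborel)"
  have mono: "(1 - v) * \<xi>1 \<le> (1 - v) * \<xi>2" "(1 + v) * \<eta>1 \<le> (1 + v) * \<eta>2"
    using le v by (auto intro!: mult_left_mono)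
  have lim: "((\<lambda>\<epsilon>. I \<xi>1 \<eta>1 \<epsilon> - I \<xi>1 \<eta>2 \<epsilon> - (I \<xi>2 \<eta>1 \<epsilon> - I \<xi>2 \<eta>2 \<epsilon>)) \<longlongrightarrow>
      phi_char \<xi>1 \<eta>1 / 2 - phi_char \<xi>1 \<eta>2 / 2 - (phi_char \<xi>2 \<eta>1 / 2 - phi_char \<xi>2 \<eta>2 / 2)) (at_right 0)"
    unfolding I_def f_def using le dom mono by (intro tendsto_diff char_bump_approximates_phi) linarith+
  define m where "m = min ((\<xi>1 + \<eta>1) / 2)
      (min (((1 - v) * \<xi>1 - (1 + v) * \<eta>2) / 2) (((1 + v) * \<eta>1 + 2 * L - (1 - v) * \<xi>2) / 2))"
  have "m > 0"
    using dom by (simp add: m_def)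
  have zero: "I \<xi>1 \<eta>1 \<epsilon> - I \<xi>1 \<eta>2 \<epsilon> - (I \<xi>2 \<eta>1 \<epsilon> - I \<xi>2 \<eta>2 \<epsilon>) = 0" if \<epsilon>: "0 < \<epsilon>" "\<epsilon> < m" for \<epsilon>
  proof -
    define K where "K = {(x::real, t). \<xi>1 - \<epsilon> \<le> t + x \<and> t + x \<le> \<xi>2 + \<epsilon> \<and> \<eta>1 - \<epsilon> \<le> t - x \<and> t - x \<le> \<eta>2 + \<epsilon>}"
    have K: "compact K" "K \<subseteq> moving_domain L v"
      unfolding K_def using \<epsilon>
      by (intro compact_char_rectangle char_rectangle_subset; simp add: m_def algebra_simps)+
    define A where "A = (\<lambda>x. ramp \<epsilon> \<xi>1 x - ramp \<epsilon> \<xi>2 x)"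
    define B where "B = (\<lambda>x. ramp \<epsilon> \<eta>1 x - ramp \<epsilon> \<eta>2 x)"
    have smooth_diff: "smooth (\<lambda>x. ramp \<epsilon> a x - ramp \<epsilon> b x)" for a b
      using smooth_add[OF smooth_ramp smooth_mult[OF smooth_const smooth_ramp], of \<epsilon> a "-1" \<epsilon> b] by simp
    then have AB: "smooth A" "smooth B"
      unfolding A_def B_def by auto
    have deriv_diff: "deriv (\<lambda>x. ramp \<epsilon> a x - ramp \<epsilon> b x) y = bump \<epsilon> a y - bump \<epsilon> b y" for a b y
      using \<epsilon> by (intro DERIV_imp_deriv DERIV_diff ramp_has_deriv) auto
    define \<theta> where "\<theta> = (\<lambda>x t. A (1 * x + 1 * t) * B ((-1) * x + 1 * t))"
    have A0: "A s = 0" if "\<not> (\<xi>1 - \<epsilon> \<le> s \<and> s \<le> \<xi>2 + \<epsilon>)" for s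
      using that le \<epsilon>(1) by (auto simp: A_def ramp_left ramp_right not_le)
    have B0: "B s = 0" if "\<not> (\<eta>1 - \<epsilon> \<le> s \<and> s \<le> \<eta>2 + \<epsilon>)" for s
      using that le \<epsilon>(1) by (auto simp: B_def ramp_left ramp_right not_le)
    have "test_fun2 L v \<theta>"
      unfolding test_fun2_def
    proof (intro conjI allI exI[of _ K])
      show "C_k2 k \<theta>" for k
        unfolding \<theta>_def by (rule C_k2_plane_wave_product[OF AB])
      show "(x, t) \<notin> K \<longrightarrow> \<theta> x t = 0" for x t
        using A0[of "t + x"] B0[of "t - x"] by (auto simp: K_def \<theta>_def add.commute)
    qed (use K in auto)
    then have "domain_integral L v (\<lambda>x t. \<phi> x t * (dt (dt \<theta>) x t - dx (dx \<theta>) x t)) = 0"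
      using sol by (simp add: weak_solution_def)
    moreover have wave: "dt (dt \<theta>) x t - dx (dx \<theta>) x t = 4 * ((char_bump \<epsilon> \<xi>1 \<eta>1 (x, t) - char_bump \<epsilon> \<xi>1 \<eta>2 (x, t))
        - (char_bump \<epsilon> \<xi>2 \<eta>1 (x, t) - char_bump \<epsilon> \<xi>2 \<eta>2 (x, t)))" for x t
      unfolding \<theta>_def wave_operator_plane_wave_product[OF AB]
      by (simp add: A_def B_def deriv_diff char_bump_def algebra_simps)
    ultimately have D0: "domain_integral L v (\<lambda>x t. \<phi> x t * (4 * ((char_bump \<epsilon> \<xi>1 \<eta>1 (x, t) - char_bump \<epsilon> \<xi>1 \<eta>2 (x, t))
        - (char_bump \<epsilon> \<xi>2 \<eta>1 (x, t) - char_bump \<epsilon> \<xi>2 \<eta>2 (x, t))))) = 0"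
      by simp
    have outside: "char_bump \<epsilon> \<xi> \<eta> (x, t) = 0" if "(x, t) \<notin> K" "\<xi> \<in> {\<xi>1, \<xi>2}" "\<eta> \<in> {\<eta>1, \<eta>2}" for x t \<xi> \<eta>
    proof (rule ccontr)
      assume "char_bump \<epsilon> \<xi> \<eta> (x, t) \<noteq> 0"
      from char_bump_support[OF \<epsilon>(1) this] that le show False
        by (auto simp: K_def abs_less_iff)
    qed
    have contphi: "continuous_on K (\<lambda>z. \<phi> (fst z) (snd z))"
      using continuous_on_subset[OF continuous_phi, of K] K(2) moving_domain_subset by (auto simp: case_prod_beta')
    have cont: "continuous_on K (\<lambda>(x, t). \<phi> x t * char_bump \<epsilon> \<xi> \<eta> (x, t))" for \<xi> \<eta>
      using contphi continuous_char_bump[OF \<epsilon>(1), of K \<xi> \<eta>]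
      by (auto simp: case_prod_beta' intro!: continuous_on_mult)
    have int: "integrable lborel (f \<epsilon> \<xi> \<eta>)" if "\<xi> \<in> {\<xi>1, \<xi>2}" "\<eta> \<in> {\<eta>1, \<eta>2}" for \<xi> \<eta>
      unfolding f_def by (rule domain_integral_eq_lborel(1)[OF K cont]) (simp add: outside[OF _ that])
    have "0 = (\<integral>(x, t). \<phi> x t * (4 * ((char_bump \<epsilon> \<xi>1 \<eta>1 (x, t) - char_bump \<epsilon> \<xi>1 \<eta>2 (x, t))
        - (char_bump \<epsilon> \<xi>2 \<eta>1 (x, t) - char_bump \<epsilon> \<xi>2 \<eta>2 (x, t)))) \<partial>lborel)"
      unfolding D0[symmetric]
    proof (rule domain_integral_eq_lborel(2)[OF K])
      show "continuous_on K (\<lambda>(x, t). \<phi> x t * (4 * ((char_bump \<epsilon> \<xi>1 \<eta>1 (x, t) - char_bump \<epsilon> \<xi>1 \<eta>2 (x, t))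
        - (char_bump \<epsilon> \<xi>2 \<eta>1 (x, t) - char_bump \<epsilon> \<xi>2 \<eta>2 (x, t)))))"
        unfolding case_prod_beta' prod.collapse
        by (intro continuous_on_mult continuous_on_diff continuous_on_const contphi continuous_char_bump \<epsilon>)
    qed (simp add: outside)
    also have "\<dots> = (\<integral>z. 4 * ((f \<epsilon> \<xi>1 \<eta>1 z - f \<epsilon> \<xi>1 \<eta>2 z) - (f \<epsilon> \<xi>2 \<eta>1 z - f \<epsilon> \<xi>2 \<eta>2 z)) \<partial>lborel)"
      by (intro Bochner_Integration.integral_cong) (auto simp: f_def algebra_simps)
    also have "\<dots> = 4 * (I \<xi>1 \<eta>1 \<epsilon> - I \<xi>1 \<eta>2 \<epsilon> - (I \<xi>2 \<eta>1 \<epsilon> - I \<xi>2 \<eta>2 \<epsilon>))"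
      unfolding I_def integral_mult_right_zero using int
      by (simp add: Bochner_Integration.integral_diff)
    finally show ?thesis
      by simp
  qed
  have "((\<lambda>\<epsilon>. I \<xi>1 \<eta>1 \<epsilon> - I \<xi>1 \<eta>2 \<epsilon> - (I \<xi>2 \<eta>1 \<epsilon> - I \<xi>2 \<eta>2 \<epsilon>)) \<longlongrightarrow> 0) (at_right 0)"
    by (rule tendsto_eventually) (unfold eventually_at_right_field, use zero \<open>m > 0\<close> in blast)
  from tendsto_unique[OF _ lim this] show ?thesis
    by simp
qed

text \<open>The closed rectangle is the limit of its images under contraction towards the interior
  point \<open>x = L/2 + v\<close>, \<open>t = 1\<close>.\<close>

lemma parallelogram_identity:
  assumes le: "\<xi>1 \<le> \<xi>2" "\<eta>1 \<le> \<eta>2"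
    and dom: "(1 + v) * \<eta>2 \<le> (1 - v) * \<xi>1" "(1 - v) * \<xi>2 \<le> (1 + v) * \<eta>1 + 2 * L" "0 \<le> \<xi>1 + \<eta>1"
  shows "phi_char \<xi>2 \<eta>2 + phi_char \<xi>1 \<eta>1 = phi_char \<xi>2 \<eta>1 + phi_char \<xi>1 \<eta>2"
proof -
  define X Y where "X = (\<lambda>\<xi> \<delta>. \<xi> + \<delta> * (1 + (L / 2 + v) - \<xi>))" and "Y = (\<lambda>\<eta> \<delta>. \<eta> + \<delta> * (1 - (L / 2 + v) - \<eta>))"
  have mono: "(1 - v) * \<xi>1 \<le> (1 - v) * \<xi>2" "(1 + v) * \<eta>1 \<le> (1 + v) * \<eta>2"
    using le v by (auto intro!: mult_left_mono)
  have contract: "X a \<delta> + Y b \<delta> = (1 - \<delta>) * (a + b) + 2 * \<delta>"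
    "(1 - v) * X a \<delta> - (1 + v) * Y b \<delta> = (1 - \<delta>) * ((1 - v) * a - (1 + v) * b) + \<delta> * L"
    "(1 + v) * Y b \<delta> + 2 * L - (1 - v) * X a \<delta> = (1 - \<delta>) * ((1 + v) * b + 2 * L - (1 - v) * a) + \<delta> * L"
    for a b \<delta>
    by (simp_all add: X_def Y_def field_simps)
  have inside: "((X \<xi> \<delta> - Y \<eta> \<delta>) / 2, (X \<xi> \<delta> + Y \<eta> \<delta>) / 2) \<in> string_domain"
    if "(1 + v) * \<eta> \<le> (1 - v) * \<xi>" "(1 - v) * \<xi> \<le> (1 + v) * \<eta> + 2 * L" "0 \<le> \<xi> + \<eta>" "0 \<le> \<delta>" "\<delta> \<le> 1" for \<xi> \<eta> \<delta>
  proof -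
    have "0 \<le> (1 - \<delta>) * (\<xi> + \<eta>) + 2 * \<delta>"
      using that by simp
    moreover have "0 \<le> (1 - \<delta>) * ((1 - v) * \<xi> - (1 + v) * \<eta>) + \<delta> * L"
      using that L by simp
    moreover have "0 \<le> (1 - \<delta>) * ((1 + v) * \<eta> + 2 * L - (1 - v) * \<xi>) + \<delta> * L"
      using that L by simp
    ultimately have "0 \<le> X \<xi> \<delta> + Y \<eta> \<delta>" "0 \<le> (1 - v) * X \<xi> \<delta> - (1 + v) * Y \<eta> \<delta>"
      "0 \<le> (1 + v) * Y \<eta> \<delta> + 2 * L - (1 - v) * X \<xi> \<delta>"
      unfolding contract by auto
    then show ?thesis
      by (simp add: string_domain_def field_simps)
  qed
  have tend: "((\<lambda>\<delta>. phi_char (X \<xi> \<delta>) (Y \<eta> \<delta>)) \<longlongrightarrow> phi_char \<xi> \<eta>) (at_right 0)"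
    if d: "(1 + v) * \<eta> \<le> (1 - v) * \<xi>" "(1 - v) * \<xi> \<le> (1 + v) * \<eta> + 2 * L" "0 \<le> \<xi> + \<eta>" for \<xi> \<eta>
  proof -
    have "continuous_on {0..1} (\<lambda>\<delta>. (\<lambda>(x, t). \<phi> x t) ((X \<xi> \<delta> - Y \<eta> \<delta>) / 2, (X \<xi> \<delta> + Y \<eta> \<delta>) / 2))"
      by (rule continuous_on_compose2[OF continuous_phi])
        (use inside[OF d] in \<open>auto simp: X_def Y_def intro!: continuous_intros\<close>)
    then have "((\<lambda>\<delta>. phi_char (X \<xi> \<delta>) (Y \<eta> \<delta>)) \<longlongrightarrow> phi_char (X \<xi> 0) (Y \<eta> 0)) (at 0 within {0..1})"
      unfolding continuous_on_def phi_char_def by simp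
    then show ?thesis
      by (simp add: X_def Y_def at_within_Icc_at_right)
  qed
  have "((\<lambda>\<delta>. (phi_char (X \<xi>2 \<delta>) (Y \<eta>2 \<delta>) + phi_char (X \<xi>1 \<delta>) (Y \<eta>1 \<delta>))
        - (phi_char (X \<xi>2 \<delta>) (Y \<eta>1 \<delta>) + phi_char (X \<xi>1 \<delta>) (Y \<eta>2 \<delta>))) \<longlongrightarrow>
      (phi_char \<xi>2 \<eta>2 + phi_char \<xi>1 \<eta>1) - (phi_char \<xi>2 \<eta>1 + phi_char \<xi>1 \<eta>2)) (at_right 0)"
    using le dom mono by (intro tendsto_intros tend) linarith+
  moreover have "(phi_char (X \<xi>2 \<delta>) (Y \<eta>2 \<delta>) + phi_char (X \<xi>1 \<delta>) (Y \<eta>1 \<delta>))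
        - (phi_char (X \<xi>2 \<delta>) (Y \<eta>1 \<delta>) + phi_char (X \<xi>1 \<delta>) (Y \<eta>2 \<delta>)) = 0" if \<delta>: "0 < \<delta>" "\<delta> < 1" for \<delta>
  proof -
    have "(1 - \<delta>) * \<xi>1 \<le> (1 - \<delta>) * \<xi>2" "(1 - \<delta>) * \<eta>1 \<le> (1 - \<delta>) * \<eta>2"
      using le \<delta> by (auto intro!: mult_left_mono)
    moreover have "0 < (1 - \<delta>) * (\<xi>1 + \<eta>1) + 2 * \<delta>"
      using dom \<delta> by (intro add_nonneg_pos) auto
    moreover have "0 < (1 - \<delta>) * ((1 - v) * \<xi>1 - (1 + v) * \<eta>2) + \<delta> * L"
      using dom \<delta> L by (intro add_nonneg_pos) auto
    moreover have "0 < (1 - \<delta>) * ((1 + v) * \<eta>1 + 2 * L - (1 - v) * \<xi>2) + \<delta> * L"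
      using dom \<delta> L by (intro add_nonneg_pos) auto
    ultimately have "0 < X \<xi>1 \<delta> + Y \<eta>1 \<delta>" "0 < (1 - v) * X \<xi>1 \<delta> - (1 + v) * Y \<eta>2 \<delta>"
      "0 < (1 + v) * Y \<eta>1 \<delta> + 2 * L - (1 - v) * X \<xi>2 \<delta>" "X \<xi>1 \<delta> \<le> X \<xi>2 \<delta>" "Y \<eta>1 \<delta> \<le> Y \<eta>2 \<delta>"
      unfolding contract by (auto simp: X_def Y_def algebra_simps)
    then show ?thesis
      using parallelogram_identity_interior[of "X \<xi>1 \<delta>" "X \<xi>2 \<delta>" "Y \<eta>1 \<delta>" "Y \<eta>2 \<delta>"] by simp
  qed
  then have "((\<lambda>\<delta>. (phi_char (X \<xi>2 \<delta>) (Y \<eta>2 \<delta>) + phi_char (X \<xi>1 \<delta>) (Y \<eta>1 \<delta>))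
        - (phi_char (X \<xi>2 \<delta>) (Y \<eta>1 \<delta>) + phi_char (X \<xi>1 \<delta>) (Y \<eta>2 \<delta>))) \<longlongrightarrow> 0) (at_right 0)"
    by (intro tendsto_eventually) (unfold eventually_at_right_field, use zero_less_one in blast)
  ultimately have "(phi_char \<xi>2 \<eta>2 + phi_char \<xi>1 \<eta>1) - (phi_char \<xi>2 \<eta>1 + phi_char \<xi>1 \<eta>2) = 0"
    by (intro tendsto_unique[rotated]) auto
  then show ?thesis
    by simp
qed

end

text \<open>In the coordinates \<open>p = (1 - v)(t + x)/L\<close>, \<open>q = (1 + v)(t - x)/L\<close> the ends of the string are
  the lines \<open>p = q\<close> and \<open>p = q + 2\<close>. A function that vanishes on both lines and satisfies the
  parallelogram identity between them is \<open>H(p) - H(q)\<close> with \<open>H\<close> of period \<open>2\<close>: from one segment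
  \<open>q = m\<close> the identity propagates the representation to the whole strip
  \<open>m \<le> q \<le> m + 2\<close>, and the part with \<open>q < 0\<close> is reached by one reflection.\<close>

lemma periodic_difference_representation:
  fixes U :: "real \<Rightarrow> real \<Rightarrow> real"
  assumes \<alpha>: "0 < \<alpha>" "0 < \<beta>" "\<beta> \<le> \<alpha>"
    and par: "\<And>p1 p2 q1 q2. p1 \<le> p2 \<Longrightarrow> q1 \<le> q2 \<Longrightarrow> q2 \<le> p1 \<Longrightarrow> p2 \<le> q1 + 2 \<Longrightarrow> 0 \<le> \<alpha> * p1 + \<beta> * q1 \<Longrightarrow>
        U p2 q2 + U p1 q1 = U p2 q1 + U p1 q2"
    and left: "\<And>p. 0 \<le> p \<Longrightarrow> U p p = 0"
    and right: "\<And>q. 0 \<le> \<alpha> * (q + 2) + \<beta> * q \<Longrightarrow> U (q + 2) q = 0"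
  obtains H :: "real \<Rightarrow> real" where "\<And>s. H (s + 2) = H s" "H 0 = 0"
    "\<And>p q. q \<le> p \<Longrightarrow> p \<le> q + 2 \<Longrightarrow> 0 \<le> \<alpha> * p + \<beta> * q \<Longrightarrow> U p q = H p - H q"
proof -
  define H where "H = (\<lambda>s. U (s - 2 * of_int \<lfloor>s / 2\<rfloor>) 0)"
  have per: "H (s + 2) = H s" for s
  proof -
    have "\<lfloor>(s + 2) / 2\<rfloor> = \<lfloor>s / 2\<rfloor> + 1"
      by (simp add: add_divide_distrib)
    then show ?thesis
      by (simp add: H_def algebra_simps)
  qed
  have H0: "H 0 = 0" "H 2 = 0"
    using left[of 0] per[of 0] by (auto simp: H_def)
  have U20: "U 2 0 = 0"
    using right[of 0] \<alpha> by simp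
  have start: "U p 0 = H p - H 0" if "p \<in> {0..2}" for p
  proof (cases "p = 2")
    case True
    then show ?thesis using H0 U20 by simp
  next
    case False
    then have "\<lfloor>p / 2\<rfloor> = 0"
      using that by (simp add: floor_eq_iff)
    then show ?thesis
      using H0 by (simp add: H_def)
  qed
  have strip: "U p a = H p - H a"
    if base: "\<forall>p\<in>{m..m + 2}. U p m = H p - H m" and m: "0 \<le> m"
      and a: "a \<in> {m..m + 2}" and p: "p \<in> {a..a + 2}" for m a p
  proof -
    have short: "U p a = H p - H a" if "a \<in> {m..m + 2}" "p \<in> {a..m + 2}" for a p
    proof -
      have "U p a + U a m = U p m + U a a"
        using that m \<alpha> by (intro par) auto
      then show ?thesis
        using left[of a] base that m by auto
    qed
    show ?thesis
    proof (cases "p \<le> m + 2")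
      case True
      then show ?thesis using short a p by auto
    next
      case False
      have "U p a + U (m + 2) (p - 2) = U p (p - 2) + U (m + 2) a"
        using False a p m \<alpha> by (intro par) auto
      moreover have "U p (p - 2) = 0"
        using right[of "p - 2"] False m \<alpha> by simp
      moreover have "U (m + 2) (p - 2) = H (m + 2) - H (p - 2)" "U (m + 2) a = H (m + 2) - H a"
        using short False a p by auto
      ultimately show ?thesis
        using per[of "p - 2"] by simp
    qed
  qed
  have block: "\<forall>p\<in>{2 * real n..2 * real n + 2}. U p (2 * real n) = H p - H (2 * real n)" for n
  proof (induction n)
    case 0
    then show ?case using start by simp
  next
    case (Suc n)
    show ?case
      using strip[OF Suc] by (auto simp: algebra_simps)
  qed
  have nonneg: "U p q = H p - H q" if "0 \<le> q" "q \<le> p" "p \<le> q + 2" for p q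
  proof -
    define n where "n = nat \<lfloor>q / 2\<rfloor>"
    have "real n = of_int \<lfloor>q / 2\<rfloor>"
      using that by (simp add: n_def)
    then have "2 * real n \<le> q" "q \<le> 2 * real n + 2"
      by linarith+
    then show ?thesis
      using strip[OF block[of n]] that by auto
  qed
  show ?thesis
  proof (rule that[OF per H0(1)])
    fix p q assume pq: "q \<le> p" "p \<le> q + 2" "0 \<le> \<alpha> * p + \<beta> * q"
    show "U p q = H p - H q"
    proof (cases "0 \<le> q")
      case True
      then show ?thesis using nonneg pq by simp
    next
      case False
      have "0 \<le> p"
      proof (rule ccontr)
        assume "\<not> 0 \<le> p"
        then have "\<alpha> * p < 0" "\<beta> * q < 0"
          using False \<alpha> by (auto intro: mult_pos_neg)
        then show False using pq(3) by simp
      qed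
      have "\<alpha> * p \<le> \<alpha> * (q + 2)"
        using pq \<alpha> by (intro mult_left_mono) auto
      then have "U (q + 2) q = 0"
        using pq by (intro right) simp
      moreover have "U (q + 2) 0 + U p q = U (q + 2) q + U p 0"
        using False pq \<open>0 \<le> p\<close> by (intro par) auto
      moreover have "U (q + 2) 0 = H (q + 2)" "U p 0 = H p"
        using nonneg[of 0] False pq \<open>0 \<le> p\<close> H0 by auto
      ultimately show ?thesis
        using per[of q] by simp
    qed
  qed
qed

context moving_string
begin

text \<open>The points \<open>p = q\<close> and \<open>p = q + 2\<close> are the ends of the string, and \<open>\<alpha> p + \<beta> q = 2 t\<close>, so the hypotheses of
  \<open>periodic_difference_representation\<close> are the boundary conditions and the parallelogram identity.\<close>

lemma dAlembert_representation:
  obtains H :: "real \<Rightarrow> real" where "\<And>s. H (s + 2) = H s" "H 0 = 0" "continuous_on UNIV H"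
    "\<And>x t. 0 \<le> t \<Longrightarrow> v * t \<le> x \<Longrightarrow> x \<le> L + v * t \<Longrightarrow>
       \<phi> x t = H ((1 - v) * (t + x) / L) - H ((1 + v) * (t - x) / L)"
proof -
  define \<alpha> \<beta> where "\<alpha> = L / (1 - v)" and "\<beta> = L / (1 + v)"
  have \<alpha>: "0 < \<alpha>" "0 < \<beta>" "\<beta> \<le> \<alpha>" "(1 - v) * \<alpha> = L" "(1 + v) * \<beta> = L"
    using L v by (auto simp: \<alpha>_def \<beta>_def intro!: divide_left_mono mult_pos_pos)
  have sc: "(1 - v) * (\<alpha> * p) = L * p" "(1 + v) * (\<beta> * q) = L * q" for p q
    using \<alpha>(4,5) by (metis mult.assoc)+
  define U where "U = (\<lambda>p q. phi_char (\<alpha> * p) (\<beta> * q))"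
  have e: "L * p - L * q = 2 * ((\<alpha> * p - \<beta> * q) / 2 - v * ((\<alpha> * p + \<beta> * q) / 2))" for p q
    by (simp add: sc(1)[of p, symmetric] sc(2)[of q, symmetric] algebra_simps)
  have iff: "v * ((\<alpha> * p + \<beta> * q) / 2) \<le> (\<alpha> * p - \<beta> * q) / 2 \<longleftrightarrow> q \<le> p"
    "(\<alpha> * p - \<beta> * q) / 2 \<le> L + v * ((\<alpha> * p + \<beta> * q) / 2) \<longleftrightarrow> p \<le> q + 2" for p q
  proof -
    have half: "d - c = 2 * (b - a) \<Longrightarrow> (a \<le> b \<longleftrightarrow> c \<le> d) \<and> (b \<le> L + a \<longleftrightarrow> d \<le> c + 2 * L)"
      for a b c d :: real
      by auto
    have "v * ((\<alpha> * p + \<beta> * q) / 2) \<le> (\<alpha> * p - \<beta> * q) / 2 \<longleftrightarrow> L * q \<le> L * p"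
      using half[OF e] by (rule conjunct1)
    then show "v * ((\<alpha> * p + \<beta> * q) / 2) \<le> (\<alpha> * p - \<beta> * q) / 2 \<longleftrightarrow> q \<le> p"
      using L by simp
    have "(\<alpha> * p - \<beta> * q) / 2 \<le> L + v * ((\<alpha> * p + \<beta> * q) / 2) \<longleftrightarrow> L * p \<le> L * q + 2 * L"
      using half[OF e] by (rule conjunct2)
    also have "\<dots> \<longleftrightarrow> L * p \<le> L * (q + 2)"
      by (simp add: algebra_simps)
    finally show "(\<alpha> * p - \<beta> * q) / 2 \<le> L + v * ((\<alpha> * p + \<beta> * q) / 2) \<longleftrightarrow> p \<le> q + 2"
      using L by simp
  qed
  obtain H where per: "\<And>s. H (s + 2) = H s" and H0: "H 0 = 0"
    and rep: "\<And>p q. q \<le> p \<Longrightarrow> p \<le> q + 2 \<Longrightarrow> 0 \<le> \<alpha> * p + \<beta> * q \<Longrightarrow> U p q = H p - H q"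
  proof (rule periodic_difference_representation[OF \<alpha>(1-3), of U])
    fix p1 p2 q1 q2 :: real
    assume le: "p1 \<le> p2" "q1 \<le> q2" "q2 \<le> p1" "p2 \<le> q1 + 2" "0 \<le> \<alpha> * p1 + \<beta> * q1"
    have "L * q2 \<le> L * p1" "L * p2 \<le> L * (q1 + 2)" "\<alpha> * p1 \<le> \<alpha> * p2" "\<beta> * q1 \<le> \<beta> * q2"
      using le L \<alpha> by (auto intro!: mult_left_mono)
    then show "U p2 q2 + U p1 q1 = U p2 q1 + U p1 q2"
      unfolding U_def using le(5)
      by (intro parallelogram_identity) (simp_all only: sc distrib_left mult.commute[of L 2])
  next
    fix p :: real assume p: "0 \<le> p"
    have end_eq: "(\<alpha> * p - \<beta> * p) / 2 = v * ((\<alpha> * p + \<beta> * p) / 2)"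
      using e[of p p] by simp
    show "U p p = 0"
      unfolding U_def phi_char_def end_eq by (rule phi_ends(1)) (use \<alpha> p in simp)
  next
    fix q :: real assume q: "0 \<le> \<alpha> * (q + 2) + \<beta> * q"
    have end_eq: "(\<alpha> * (q + 2) - \<beta> * q) / 2 = L + v * ((\<alpha> * (q + 2) + \<beta> * q) / 2)"
      using e[of "q + 2" q] distrib_left[of L q 2] by simp
    show "U (q + 2) q = 0"
      unfolding U_def phi_char_def end_eq by (rule phi_ends(2)) (use q in simp)
  qed blast
  have per_n: "H (s + 2 * real n) = H s" for s n
  proof (induction n)
    case (Suc n)
    then show ?case using per[of "s + 2 * real n"] by (simp add: algebra_simps)
  qed simp
  \<comment> \<open>To the right of \<open>1\<close> the representation itself expresses \<open>H\<close> near \<open>s\<close> through \<open>\<phi>\<close> on a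
    characteristic segment with fixed \<open>q = s - 1\<close>; periodicity covers the rest.\<close>
  have cont1: "isCont H s" if s: "1 \<le> s" for s
  proof -
    define q where "q = s - 1"
    have "continuous_on {q..q + 2} (\<lambda>p. (\<lambda>(x, t). \<phi> x t) ((\<alpha> * p - \<beta> * q) / 2, (\<alpha> * p + \<beta> * q) / 2))"
    proof (rule continuous_on_compose2[OF continuous_phi])
      show "(\<lambda>p. ((\<alpha> * p - \<beta> * q) / 2, (\<alpha> * p + \<beta> * q) / 2)) ` {q..q + 2} \<subseteq> string_domain"
        using iff s \<alpha> by (auto simp: string_domain_def q_def)
    qed (auto intro!: continuous_intros)
    then have "continuous_on {q..q + 2} (\<lambda>p. H q + U p q)"
      by (auto simp: U_def phi_char_def intro!: continuous_intros)
    moreover have "H q + U p q = H p" if "p \<in> {q..q + 2}" for p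
    proof -
      have "0 \<le> \<alpha> * p + \<beta> * q"
        using that s \<alpha> by (auto simp: q_def intro!: add_nonneg_nonneg mult_nonneg_nonneg)
      then show ?thesis
        using rep[of q p] that by simp
    qed
    ultimately have "continuous_on {q..q + 2} H"
      by (subst (asm) continuous_on_cong[OF refl]) auto
    then show ?thesis
      by (rule continuous_on_interior) (simp add: q_def)
  qed
  have "isCont H s" for s
  proof -
    define n where "n = nat \<lceil>1 + \<bar>s\<bar>\<rceil>"
    have "1 \<le> s + 2 * real n"
      unfolding n_def by linarith
    then have "isCont H (s + 2 * real n)"
      by (rule cont1)
    then have "isCont (\<lambda>s. H (s + 2 * real n)) s"
      by (rule isCont_o2[where f = "\<lambda>s. s + 2 * real n" and g = H, rotated])
        (auto intro!: continuous_intros)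
    then show ?thesis
      by (simp add: per_n)
  qed
  then have cont: "continuous_on UNIV H"
    by (simp add: continuous_on_eq_continuous_at)
  show ?thesis
  proof (rule that[OF per H0 cont])
    fix x t assume xt: "0 \<le> t" "v * t \<le> x" "x \<le> L + v * t"
    define p q where "p = (1 - v) * (t + x) / L" and "q = (1 + v) * (t - x) / L"
    have pq: "\<alpha> * p = t + x" "\<beta> * q = t - x"
      using L v by (auto simp: p_def q_def \<alpha>_def \<beta>_def)
    have "q \<le> p" "p \<le> q + 2"
      using iff[where p = p and q = q] xt unfolding pq by (simp_all add: field_simps)
    then have "U p q = H p - H q"
      using rep[of q p] xt unfolding pq by simp
    then show "\<phi> x t = H ((1 - v) * (t + x) / L) - H ((1 + v) * (t - x) / L)"
      unfolding U_def phi_char_def pq by (simp add: p_def q_def)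
  qed
qed

end

section \<open>The profile is absolutely continuous\<close>

lemma integral_eq_of_zero_outside:
  fixes f :: "real \<Rightarrow> real"
  assumes "\<And>x. x \<in> S \<Longrightarrow> x \<notin> T \<Longrightarrow> f x = 0" "\<And>x. x \<in> T \<Longrightarrow> x \<notin> S \<Longrightarrow> g x = 0"
    and "\<And>x. x \<in> S \<Longrightarrow> x \<in> T \<Longrightarrow> f x = g x"
  shows "integral S f = integral T g"
proof -
  have "(\<lambda>x. if x \<in> S then f x else 0) = (\<lambda>x. if x \<in> T then g x else 0)"
    using assms by (auto simp: fun_eq_iff)
  then show ?thesis
    using integral_restrict_UNIV[of S f] integral_restrict_UNIV[of T g] by simp
qed

lemma has_integral_derivative_vanishing_ends:
  fixes F :: "real \<Rightarrow> real"
  assumes "a \<le> b" "\<And>x. (F has_real_derivative F' x) (at x)" "F a = 0" "F b = 0"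
  shows "(F' has_integral 0) {a..b}"
proof -
  have "(F has_vector_derivative F' x) (at x within {a..b})" for x
    using has_field_derivative_at_within[OF assms(2)]
    unfolding has_real_derivative_iff_has_vector_derivative .
  then have "(F' has_integral F b - F a) {a..b}"
    by (intro fundamental_theorem_of_calculus assms(1))
  then show ?thesis
    using assms(3,4) by simp
qed

lemma continuous_antiderivative:
  fixes f :: "real \<Rightarrow> real"
  assumes "continuous_on UNIV f"
  obtains F where "\<And>x. (F has_real_derivative f x) (at x)"
proof -
  have "\<exists>F. \<forall>x::real. -\<infinity> < ereal x \<longrightarrow> ereal x < \<infinity> \<longrightarrow> (F has_vector_derivative f x) (at x)"
    using assms by (intro einterval_antiderivative) (auto simp: continuous_on_eq_continuous_at)
  then show ?thesis
    using that by (auto simp: has_real_derivative_iff_has_vector_derivative)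
qed

context moving_string
begin

text \<open>Both the function and, as seen from the moving frame, the weight vary with time. The first change
  is controlled by continuity in mean square, the second by continuity of \<open>A\<close>.\<close>

lemma continuous_moving_pairing:
  assumes u: "C_L2 L v T u" and A: "continuous_on UNIV A"
  shows "continuous_on {0..T} (\<lambda>t. integral {0..L} (\<lambda>y. u (y + v * t) t * A (y + v * t)))"
  unfolding continuous_on_def
proof
  fix s assume s: "s \<in> {0..T}"
  define N where "N = (\<lambda>t. integral {0..L} (\<lambda>y. u (y + v * t) t * A (y + v * t)))"
  define D where "D = (\<lambda>t. integral {0..L} (\<lambda>y. (u (y + v * t) t - u (y + v * s) s)\<^sup>2))"
  define Q where "Q = (\<lambda>t. integral {0..L} (\<lambda>y. (A (y + v * t))\<^sup>2))"
  define R where "R = (\<lambda>t. integral {0..L} (\<lambda>y. (A (y + v * t) - A (y + v * s))\<^sup>2))"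
  define E where "E = integral {0..L} (\<lambda>y. (u (y + v * s) s)\<^sup>2)"
  have A': "continuous_on S (\<lambda>y. A (g y))" if "continuous_on S g" for g and S :: "'z::topological_space set"
    by (rule continuous_on_compose2[OF A that]) auto
  have D: "(D \<longlongrightarrow> 0) (at s within {0..T})"
    using u s by (simp add: C_L2_def D_def)
  have Q: "(Q \<longlongrightarrow> Q s) (at s within {0..T})"
  proof -
    have "continuous_on {0..T} (\<lambda>t. integral (cbox 0 L) (\<lambda>y. (A (y + v * t))\<^sup>2))"
      by (rule integral_continuous_on_param) (auto simp: case_prod_beta' intro!: continuous_intros A')
    then show ?thesis
      using s by (simp add: continuous_on_def Q_def)
  qed
  have R: "(R \<longlongrightarrow> R s) (at s within {0..T})"
  proof -
    have "continuous_on {0..T} (\<lambda>t. integral (cbox 0 L) (\<lambda>y. (A (y + v * t) - A (y + v * s))\<^sup>2))"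
      by (rule integral_continuous_on_param) (auto simp: case_prod_beta' intro!: continuous_intros A')
    from bspec[OF this[unfolded continuous_on_def] s] show ?thesis
      by (simp only: R_def cbox_interval)
  qed
  have us: "L2_on {0..L} (\<lambda>y. u (y + v * s) s)"
    by (rule L2_moving_frame[OF u s])
  have cA: "L2_on {0..L} (\<lambda>y. A (y + v * t))" for t
    by (intro L2_on_continuous A' continuous_intros)
  have bound: "\<bar>N t - N s\<bar> \<le> sqrt (D t) * sqrt (Q t) + sqrt E * sqrt (R t)" if t: "t \<in> {0..T}" for t
  proof -
    have ut: "L2_on {0..L} (\<lambda>y. u (y + v * t) t)"
      by (rule L2_moving_frame[OF u t])
    have "N t - N s = integral {0..L} (\<lambda>y. u (y + v * t) t * A (y + v * t) - u (y + v * s) s * A (y + v * s))"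
      unfolding N_def
      by (intro Henstock_Kurzweil_Integration.integral_diff[symmetric] L2_on_mult_integrable ut us cA)
    also have "\<dots> = integral {0..L} (\<lambda>y. (u (y + v * t) t - u (y + v * s) s) * A (y + v * t)
        + u (y + v * s) s * (A (y + v * t) - A (y + v * s)))"
      by (simp add: algebra_simps)
    also have "\<dots> = integral {0..L} (\<lambda>y. (u (y + v * t) t - u (y + v * s) s) * A (y + v * t))
        + integral {0..L} (\<lambda>y. u (y + v * s) s * (A (y + v * t) - A (y + v * s)))"
      by (intro Henstock_Kurzweil_Integration.integral_add L2_on_mult_integrable L2_on_diff ut us cA)
    finally have "\<bar>N t - N s\<bar> \<le> \<bar>integral {0..L} (\<lambda>y. (u (y + v * t) t - u (y + v * s) s) * A (y + v * t))\<bar>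
        + \<bar>integral {0..L} (\<lambda>y. u (y + v * s) s * (A (y + v * t) - A (y + v * s)))\<bar>"
      by linarith
    also have "\<dots> \<le> sqrt (D t) * sqrt (Q t) + sqrt E * sqrt (R t)"
      unfolding D_def Q_def E_def R_def
      by (intro add_mono Cauchy_Schwarz_integral_abs L2_on_diff ut us cA)
    finally show ?thesis .
  qed
  have "((\<lambda>t. sqrt (D t) * sqrt (Q t) + sqrt E * sqrt (R t)) \<longlongrightarrow>
      sqrt 0 * sqrt (Q s) + sqrt E * sqrt (R s)) (at s within {0..T})"
    by (intro tendsto_intros D Q R)
  then have "((\<lambda>t. sqrt (D t) * sqrt (Q t) + sqrt E * sqrt (R t)) \<longlongrightarrow> 0) (at s within {0..T})"
    by (simp add: R_def)
  then have "((\<lambda>t. N t - N s) \<longlongrightarrow> 0) (at s within {0..T})"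
    by (rule Lim_null_comparison[rotated]) (auto simp: eventually_at_filter bound)
  then show "(N \<longlongrightarrow> N s) (at s within {0..T})"
    by (simp add: LIM_zero_iff)
qed

end

text \<open>The profile \<open>H\<close> is fixed here; it exists by \<open>dAlembert_representation\<close>. Its two rescalings
  \<open>Hr\<close> and \<open>Hl\<close> are such that \<open>\<phi>(x, t) = Hr(t + x) - Hl(t - x)\<close>.\<close>

locale string_profile = moving_string +
  fixes H :: "real \<Rightarrow> real"
  assumes H_periodic: "\<And>s. H (s + 2) = H s"
    and H_0: "H 0 = 0"
    and H_continuous: "continuous_on UNIV H"
    and phi_eq_H: "\<And>x t. 0 \<le> t \<Longrightarrow> v * t \<le> x \<Longrightarrow> x \<le> L + v * t \<Longrightarrow>
       \<phi> x t = H ((1 - v) * (t + x) / L) - H ((1 + v) * (t - x) / L)"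
begin

definition Hr :: "real \<Rightarrow> real" where "Hr s = H ((1 - v) * s / L)"
definition Hl :: "real \<Rightarrow> real" where "Hl s = H ((1 + v) * s / L)"

lemma continuous_profile: "continuous_on S g \<Longrightarrow> continuous_on S (\<lambda>y. Hr (g y))"
  "continuous_on S g \<Longrightarrow> continuous_on S (\<lambda>y. Hl (g y))"
  unfolding Hr_def Hl_def
  by (rule continuous_on_compose2[OF H_continuous]; use L in \<open>auto intro!: continuous_intros\<close>)+

text \<open>For a smooth weight \<open>A\<close> the weak time derivative of \<open>\<integral> \<phi> A\<close> is computed in two ways: from
  \<open>\<phi>t\<close>, and from the representation of \<open>\<phi>\<close>, where differentiating in time and integrating by
  parts moves the derivative onto \<open>A\<close>. Equality for positive times extends to time \<open>0\<close> because
  both sides are continuous.\<close>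

lemma initial_velocity_pairing:
  assumes A: "smooth A" and c: "0 < c" "d < L" and A0: "\<And>x. \<not> (c \<le> x \<and> x \<le> d) \<Longrightarrow> A x = 0"
  shows "integral {0..L} (\<lambda>x. \<phi>t x 0 * A x) = - integral {0..L} (\<lambda>x. (Hr x + Hl (- x)) * deriv A x)"
proof -
  define \<tau> where "\<tau> = c"
  have v\<tau>: "v * t \<le> c" if "0 \<le> t" "t \<le> \<tau>" for t
    using c v that mult_mono[of v 1 t c] by (simp add: \<tau>_def)
  have tau: "0 < \<tau>"
    using c by (simp add: \<tau>_def)
  have nn: "0 \<le> v * t" if "0 \<le> t" for t
    using v that by simp
  have contA: "continuous_on S A" "continuous_on S (deriv A)" for S
    by (intro smooth_continuous smooth_deriv A)+
  define k where "k = (\<lambda>t. - integral {0..L} (\<lambda>x. (Hr (t + x) + Hl (t - x)) * deriv A x))"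
  define N where "N = (\<lambda>t. integral {0..L} (\<lambda>y. \<phi>t (y + v * t) t * A (y + v * t)))"
  have contN: "continuous_on {0..\<tau>} N"
    unfolding N_def by (rule continuous_moving_pairing[OF phi_C_L2(2)[OF tau] contA(1)])
  have contk: "continuous_on {0..\<tau>} k"
  proof -
    have "continuous_on {0..\<tau>} (\<lambda>t. integral (cbox 0 L) (\<lambda>x. (Hr (t + x) + Hl (t - x)) * deriv A x))"
      by (rule integral_continuous_on_param)
        (auto simp: case_prod_beta' intro!: continuous_intros continuous_profile
          continuous_on_compose2[OF contA(2)[of UNIV]])
    then show ?thesis
      unfolding k_def by (auto intro!: continuous_intros)
  qed
  obtain P where P: "\<And>x. (P has_real_derivative Hr x) (at x)"
    using continuous_antiderivative[OF continuous_profile(1)[OF continuous_on_id]] by blast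
  obtain Q where Q: "\<And>x. (Q has_real_derivative Hl x) (at x)"
    using continuous_antiderivative[OF continuous_profile(2)[OF continuous_on_id]] by blast
  have contPQ: "continuous_on S (\<lambda>y. P (g y))" "continuous_on S (\<lambda>y. Q (g y))"
    if "continuous_on S g" for g and S :: "'z::topological_space set"
    using that P Q by (auto intro!: continuous_on_compose2[of UNIV P] continuous_on_compose2[of UNIV Q]
        DERIV_continuous_on)
  define G where "G = (\<lambda>t. - integral {0..L} (\<lambda>x. (P (t + x) + Q (t - x)) * deriv A x))"
  have G: "(G has_real_derivative k t) (at t)" for t
  proof -
    have "((\<lambda>t. integral (cbox 0 L) (\<lambda>x. (P (t + x) + Q (t - x)) * deriv A x)) has_field_derivative
        integral (cbox 0 L) (\<lambda>x. (Hr (t + x) + Hl (t - x)) * deriv A x)) (at t within UNIV)"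
    proof (rule leibniz_rule_field_derivative)
      fix s x :: real
      show "((\<lambda>s. (P (s + x) + Q (s - x)) * deriv A x) has_real_derivative
          (Hr (s + x) + Hl (s - x)) * deriv A x) (at s within UNIV)"
        by (auto intro!: derivative_eq_intros DERIV_chain2[OF P] DERIV_chain2[OF Q])
      show "(\<lambda>x. (P (s + x) + Q (s - x)) * deriv A x) integrable_on cbox 0 L"
        by (intro integrable_continuous continuous_intros contPQ contA)
    qed (auto simp: case_prod_beta' intro!: continuous_intros continuous_profile
          continuous_on_compose2[OF contA(2)[of UNIV]])
    then show ?thesis
      unfolding G_def k_def by (auto intro!: derivative_intros)
  qed
  have ends: "A 0 = 0" "A L = 0"
    using A0[of 0] A0[of L] c by auto
  have M: "integral {v * t..L + v * t} (\<lambda>x. \<phi> x t * A x) = G t" if t: "0 \<le> t" "t \<le> \<tau>" for t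
  proof -
    have "integral {v * t..L + v * t} (\<lambda>x. \<phi> x t * A x) = integral {0..L} (\<lambda>x. (Hr (t + x) - Hl (t - x)) * A x)"
    proof (rule integral_eq_of_zero_outside)
      show "\<phi> x t * A x = 0" if "x \<in> {v * t..L + v * t}" "x \<notin> {0..L}" for x
        using that A0[of x] c by auto
      show "(Hr (t + x) - Hl (t - x)) * A x = 0" if "x \<in> {0..L}" "x \<notin> {v * t..L + v * t}" for x
        using that A0[of x] c v\<tau>[OF t] nn[OF t(1)] by auto
    qed (use phi_eq_H t in \<open>auto simp: Hr_def Hl_def\<close>)
    also have "\<dots> = - integral {0..L} (\<lambda>x. (P (t + x) + Q (t - x)) * deriv A x)"
    proof -
      have "((\<lambda>x. (Hr (t + x) - Hl (t - x)) * A x + (P (t + x) + Q (t - x)) * deriv A x) has_integral 0) {0..L}"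
        using ends L
        by (intro has_integral_derivative_vanishing_ends[of _ _ "\<lambda>x. (P (t + x) + Q (t - x)) * A x"])
          (auto intro!: derivative_eq_intros DERIV_chain2[OF P] DERIV_chain2[OF Q] smooth_has_deriv A
            simp: algebra_simps)
      moreover have "(\<lambda>x. (Hr (t + x) - Hl (t - x)) * A x) integrable_on {0..L}"
        "(\<lambda>x. (P (t + x) + Q (t - x)) * deriv A x) integrable_on {0..L}"
        by (intro integrable_continuous_interval continuous_intros continuous_profile contPQ contA)+
      ultimately show ?thesis
        using Henstock_Kurzweil_Integration.integral_add[of "\<lambda>x. (Hr (t + x) - Hl (t - x)) * A x" "{0..L}"]
        by (simp add: has_integral_iff)
    qed
    finally show ?thesis
      by (simp add: G_def)
  qed
  have N: "integral {v * t..L + v * t} (\<lambda>x. \<phi>t x t * A x) = N t" for t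
    using integral_affine[where m = 1 and f = "\<lambda>x. \<phi>t x t * A x" and k = "v * t" and a = 0 and b = L]
    by (simp add: N_def)
  have test: "integral {0..\<tau>} (\<lambda>t. (k t - N t) * bump \<delta> t0 t) = 0"
    if \<delta>: "0 < \<delta>" "\<delta> < t0" "t0 + \<delta> < \<tau>" for \<delta> t0
  proof -
    define B where "B = bump \<delta> t0"
    have B: "smooth B"
      using \<delta> by (simp add: B_def smooth_bump)
    have B0: "B t = 0" if "\<not> (t0 - \<delta> \<le> t \<and> t \<le> t0 + \<delta>)" for t
      unfolding B_def using that \<delta> by (intro bump_eq_0) auto
    have B0': "deriv B t = 0" if "\<not> (t0 - \<delta> \<le> t \<and> t \<le> t0 + \<delta>)" for t
    proof (rule DERIV_imp_deriv, rule DERIV_cong_ev[OF refl _ refl, THEN iffD1])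
      show "\<forall>\<^sub>F s in nhds t. (0::real) = B s"
      proof (rule eventually_mono[OF eventually_nhds_in_open])
        show "open (- {t0 - \<delta>..t0 + \<delta>})"
          by (intro open_Compl closed_atLeastAtMost)
      qed (use that B0 in auto)
    qed auto
    define \<theta> where "\<theta> = (\<lambda>x t. A (1 * x + 0 * t) * B (0 * x + 1 * t))"
    define K where "K = {c..d} \<times> {t0 - \<delta>..t0 + \<delta>}"
    have K: "K \<subseteq> moving_domain L v"
    proof clarify
      fix x t assume "(x, t) \<in> K"
      then have *: "c \<le> x" "x \<le> d" "t0 - \<delta> \<le> t" "t \<le> t0 + \<delta>"
        by (auto simp: K_def)
      then have t: "0 < t" "t < c"
        using \<delta> by (auto simp: \<tau>_def)
      then have "v * t < 1 * c"
        using v by (intro mult_strict_mono) auto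
      then show "(x, t) \<in> moving_domain L v"
        using * t c nn[of t] by (auto simp: moving_domain_def)
    qed
    have "test_fun2 L v \<theta>"
      unfolding test_fun2_def
    proof (intro conjI allI exI[of _ K])
      show "C_k2 n \<theta>" for n
        unfolding \<theta>_def by (rule C_k2_plane_wave_product[OF A B])
      show "(x, t) \<notin> K \<longrightarrow> \<theta> x t = 0" for x t
        using A0[of x] B0[of t] by (auto simp: K_def \<theta>_def)
      show "compact K"
        by (auto simp: K_def intro: compact_Times)
    qed (rule K)
    then have weak: "domain_integral L v (\<lambda>x t. \<phi> x t * dt \<theta> x t) = - domain_integral L v (\<lambda>x t. \<phi>t x t * \<theta> x t)"
      using sol by (simp add: weak_solution_def)
    have \<theta>: "\<theta> x t = A x * B t" and dt\<theta>: "dt \<theta> x t = A x * deriv B t" for x t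
      unfolding \<theta>_def dt_plane_wave_product[OF A B] by simp_all
    have lhs: "domain_integral L v (\<lambda>x t. \<phi> x t * dt \<theta> x t) = integral {0..\<tau>} (\<lambda>t. G t * deriv B t)"
      unfolding domain_integral_def dt\<theta> mult.assoc[symmetric] integral_mult_left
      by (rule integral_eq_of_zero_outside) (use \<delta> B0' M in auto)
    have rhs: "domain_integral L v (\<lambda>x t. \<phi>t x t * \<theta> x t) = integral {0..\<tau>} (\<lambda>t. N t * B t)"
      unfolding domain_integral_def \<theta> mult.assoc[symmetric] integral_mult_left N
      by (rule integral_eq_of_zero_outside) (use \<delta> B0 in auto)
    have cB: "continuous_on S B" "continuous_on S (deriv B)" for S
      by (intro smooth_continuous smooth_deriv B)+
    have cG: "continuous_on S G" for S
      using G by (intro DERIV_continuous_on) (rule has_field_derivative_at_within)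
    have "((\<lambda>t. k t * B t + G t * deriv B t) has_integral 0) {0..\<tau>}"
      using B0[of 0] B0[of \<tau>] \<delta> tau
      by (intro has_integral_derivative_vanishing_ends[of _ _ "\<lambda>t. G t * B t"])
        (auto intro!: derivative_eq_intros G smooth_has_deriv B)
    moreover have ints: "(\<lambda>t. k t * B t) integrable_on {0..\<tau>}" "(\<lambda>t. G t * deriv B t) integrable_on {0..\<tau>}"
      "(\<lambda>t. N t * B t) integrable_on {0..\<tau>}"
      by (intro integrable_continuous_interval continuous_intros cB cG contk contN)+
    ultimately have "integral {0..\<tau>} (\<lambda>t. k t * B t) + integral {0..\<tau>} (\<lambda>t. G t * deriv B t) = 0"
      using Henstock_Kurzweil_Integration.integral_add[OF ints(1,2)] by (simp add: has_integral_iff)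
    then have "integral {0..\<tau>} (\<lambda>t. k t * B t) = integral {0..\<tau>} (\<lambda>t. N t * B t)"
      using weak unfolding lhs rhs by simp
    then show ?thesis
      using Henstock_Kurzweil_Integration.integral_diff[OF ints(1,3)] by (simp add: B_def left_diff_distrib)
  qed
  have eq: "k t0 - N t0 = 0" if t0: "0 < t0" "t0 < \<tau>" for t0
  proof -
    have "((\<lambda>\<delta>. integral {0..\<tau>} (\<lambda>t. (k t - N t) * bump \<delta> t0 t)) \<longlongrightarrow> k t0 - N t0) (at_right 0)"
      by (rule bump_approximate_identity[OF _ t0]) (intro continuous_intros contk contN)
    moreover have "\<forall>\<^sub>F \<delta> in at_right 0. integral {0..\<tau>} (\<lambda>t. (k t - N t) * bump \<delta> t0 t) = 0"
      unfolding eventually_at_right_field using test t0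
      by (intro exI[of _ "min t0 (\<tau> - t0)"]) auto
    ultimately show ?thesis
      by (intro tendsto_unique[OF trivial_limit_at_right_real _ tendsto_eventually])
  qed
  have "k 0 - N 0 = 0"
  proof (rule continuous_constant_on_closure[where S = "{0<..<\<tau>}" and f = "\<lambda>t. k t - N t" and x = 0])
    show "continuous_on (closure {0<..<\<tau>}) (\<lambda>t. k t - N t)"
      using tau by (auto intro!: continuous_intros contk contN)
  qed (use eq tau in auto)
  then show ?thesis
    by (simp add: k_def N_def)
qed

text \<open>The weight in \<open>initial_velocity_pairing\<close> tends to the indicator function of \<open>[a, b]\<close>, and its
  derivative to the difference of two point masses.\<close>

lemma initial_velocity_increment:
  assumes ab: "0 < a" "a < b" "b < L"
  shows "integral {a..b} (\<lambda>x. \<phi>t x 0) = (Hr b + Hl (- b)) - (Hr a + Hl (- a))"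
proof -
  define \<kappa> where "\<kappa> = (\<lambda>x. Hr x + Hl (- x))"
  have \<kappa>: "continuous_on S \<kappa>" for S
    unfolding \<kappa>_def by (intro continuous_intros continuous_profile)
  have u: "L2_on {0..L} (\<lambda>x. \<phi>t x 0)"
    using L2_moving_frame[OF phi_C_L2(2)[of 1], of 0] by simp
  define A where "A = (\<lambda>\<epsilon> x. ramp \<epsilon> a x - ramp \<epsilon> b x)"
  have smooth: "smooth (A \<epsilon>)" for \<epsilon>
    using smooth_add[OF smooth_ramp smooth_mult[OF smooth_const smooth_ramp], of \<epsilon> a "-1" \<epsilon> b]
    by (simp add: A_def)
  define m where "m = min a (L - b)"
  have "m > 0"
    using ab by (simp add: m_def)
  have deriv_A: "deriv (A \<epsilon>) x = bump \<epsilon> a x - bump \<epsilon> b x" if "0 < \<epsilon>" for \<epsilon> x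
    unfolding A_def using that by (intro DERIV_imp_deriv DERIV_diff ramp_has_deriv) auto
  have cb: "continuous_on S (bump \<epsilon> c)" if "0 < \<epsilon>" for \<epsilon> c S
    using that by (intro smooth_continuous smooth_bump) auto
  have pairing: "integral {0..L} (\<lambda>x. \<phi>t x 0 * A \<epsilon> x) =
      integral {0..L} (\<lambda>x. \<kappa> x * bump \<epsilon> b x) - integral {0..L} (\<lambda>x. \<kappa> x * bump \<epsilon> a x)"
    if \<epsilon>: "0 < \<epsilon>" "\<epsilon> < m" for \<epsilon>
  proof -
    have "integral {0..L} (\<lambda>x. \<phi>t x 0 * A \<epsilon> x) = - integral {0..L} (\<lambda>x. \<kappa> x * deriv (A \<epsilon>) x)"
      unfolding \<kappa>_def
    proof (rule initial_velocity_pairing[OF smooth])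
      show "A \<epsilon> x = 0" if "\<not> (a - \<epsilon> \<le> x \<and> x \<le> b + \<epsilon>)" for x
        using that \<epsilon> ab by (auto simp: A_def ramp_left ramp_right not_le)
    qed (use \<epsilon> in \<open>auto simp: m_def\<close>)
    also have "\<dots> = integral {0..L} (\<lambda>x. \<kappa> x * bump \<epsilon> b x) - integral {0..L} (\<lambda>x. \<kappa> x * bump \<epsilon> a x)"
      using \<epsilon> by (simp add: deriv_A right_diff_distrib Henstock_Kurzweil_Integration.integral_diff
          integrable_continuous_interval continuous_on_mult \<kappa> cb)
    finally show ?thesis .
  qed
  have "((\<lambda>\<epsilon>. integral {0..L} (\<lambda>x. \<kappa> x * bump \<epsilon> b x) - integral {0..L} (\<lambda>x. \<kappa> x * bump \<epsilon> a x)) \<longlongrightarrow> \<kappa> b - \<kappa> a) (at_right 0)"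
    using ab by (intro tendsto_diff bump_approximate_identity \<kappa>) auto
  moreover have "\<forall>\<^sub>F \<epsilon> in at_right 0. integral {0..L} (\<lambda>x. \<kappa> x * bump \<epsilon> b x) - integral {0..L} (\<lambda>x. \<kappa> x * bump \<epsilon> a x)
      = integral {0..L} (\<lambda>x. \<phi>t x 0 * A \<epsilon> x)"
    unfolding eventually_at_right_field using pairing \<open>m > 0\<close> by (intro exI[of _ m]) auto
  ultimately have lim: "((\<lambda>\<epsilon>. integral {0..L} (\<lambda>x. \<phi>t x 0 * A \<epsilon> x)) \<longlongrightarrow> \<kappa> b - \<kappa> a) (at_right 0)"
    by (rule Lim_transform_eventually)
  define e where "e = (\<lambda>n. inverse (real (Suc n)))"
  have e: "filterlim e (at_right 0) sequentially"
    unfolding e_def filterlim_at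
    using LIMSEQ_inverse_real_of_nat by (auto intro!: always_eventually)
  \<comment> \<open>The value at the two jumps is the fixed number \<open>smooth_step 0\<close>, or its complement.\<close>
  define h where "h = (\<lambda>x. if x = a then smooth_step 0 else if x = b then 1 - smooth_step 0
      else if a < x \<and> x < b then 1 else 0)"
  have ramp_lim: "(\<lambda>n. ramp (e n) c x) \<longlonglongrightarrow> (if x < c then 0 else if x = c then smooth_step 0 else 1)" for c x
  proof -
    have ev: "\<forall>\<^sub>F n in sequentially. e n < \<bar>x - c\<bar>" if "x \<noteq> c"
      using order_tendstoD(2)[OF LIMSEQ_inverse_real_of_nat, of "\<bar>x - c\<bar>"] that by (simp add: e_def)
    have pos: "0 < e n" for n
      by (simp add: e_def)
    consider "x < c" | "x = c" | "c < x" by linarith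
    then show ?thesis
    proof cases
      case 1
      then have "\<forall>\<^sub>F n in sequentially. ramp (e n) c x = 0"
        using ev pos by (auto elim!: eventually_mono intro!: ramp_left)
      then show ?thesis
        using 1 by (auto intro: tendsto_eventually)
    next
      case 2
      then show ?thesis
        by (simp add: ramp_def)
    next
      case 3
      then have "\<forall>\<^sub>F n in sequentially. ramp (e n) c x = 1"
        using ev pos by (auto elim!: eventually_mono intro!: ramp_right)
      then show ?thesis
        using 3 by (auto intro: tendsto_eventually)
    qed
  qed
  have A_lim: "(\<lambda>n. A (e n) x) \<longlonglongrightarrow> h x" for x
  proof -
    have "(\<lambda>n. A (e n) x) \<longlonglongrightarrow> (if x < a then 0 else if x = a then smooth_step 0 else 1)
        - (if x < b then 0 else if x = b then smooth_step 0 else 1)"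
      unfolding A_def by (intro tendsto_diff ramp_lim)
    moreover have "(if x < a then 0 else if x = a then smooth_step 0 else 1)
        - (if x < b then 0 else if x = b then smooth_step 0 else 1) = h x"
      using ab by (auto simp: h_def)
    ultimately show ?thesis
      by (simp only:)
  qed
  have "(\<lambda>n. integral {0..L} (\<lambda>x. \<phi>t x 0 * A (e n) x)) \<longlonglongrightarrow> integral {0..L} (\<lambda>x. \<phi>t x 0 * h x)"
  proof (rule dominated_convergence)
    show "(\<lambda>x. \<phi>t x 0 * A (e n) x) integrable_on {0..L}" for n
      by (intro L2_on_mult_integrable u L2_on_continuous smooth_continuous smooth)
    show "(\<lambda>x. \<bar>\<phi>t x 0\<bar>) integrable_on {0..L}"
      using L2_on_mult[OF u L2_on_continuous[of 0 L "\<lambda>_. 1"]] by (simp add: absolutely_integrable_on_def)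
    show "norm (\<phi>t x 0 * A (e n) x) \<le> \<bar>\<phi>t x 0\<bar>" for n x
    proof -
      have "\<bar>A (e n) x\<bar> \<le> 1"
        using ramp_bounds[of "e n" a x] ramp_bounds[of "e n" b x] by (simp add: A_def abs_le_iff)
      then show ?thesis
        using mult_left_mono[of "\<bar>A (e n) x\<bar>" 1 "\<bar>\<phi>t x 0\<bar>"] by (simp add: abs_mult)
    qed
    show "(\<lambda>n. \<phi>t x 0 * A (e n) x) \<longlonglongrightarrow> \<phi>t x 0 * h x" for x
      by (intro tendsto_mult tendsto_const A_lim)
  qed
  moreover have "(\<lambda>n. integral {0..L} (\<lambda>x. \<phi>t x 0 * A (e n) x)) \<longlonglongrightarrow> \<kappa> b - \<kappa> a"
    by (rule filterlim_compose[OF lim e])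
  ultimately have "integral {0..L} (\<lambda>x. \<phi>t x 0 * h x) = \<kappa> b - \<kappa> a"
    by (rule LIMSEQ_unique)
  moreover have "integral {0..L} (\<lambda>x. \<phi>t x 0 * h x) = integral {0..L} (\<lambda>x. if x \<in> {a..b} then \<phi>t x 0 else 0)"
    by (rule integral_spike[of "{a, b}"]) (auto simp: h_def)
  moreover have "integral {0..L} (\<lambda>x. if x \<in> {a..b} then \<phi>t x 0 else 0) = integral {a..b} (\<lambda>x. \<phi>t x 0)"
    using ab by (intro integral_eq_of_zero_outside) auto
  ultimately show ?thesis
    by (simp add: \<kappa>_def)
qed

lemma initial_data_L2: "L2_on {0..L} (\<lambda>x. \<phi>x x 0)" "L2_on {0..L} (\<lambda>x. \<phi>t x 0)"
  using L2_moving_frame[OF phi_C_L2(1)[of 1], of 0] L2_moving_frame[OF phi_C_L2(2)[of 1], of 0] by simp_all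

text \<open>The initial position gives the difference \<open>Hr(x) - Hl(-x)\<close>, the initial velocity gives the sum.\<close>

lemma profile_eq_integral:
  assumes x: "x \<in> {0..L}"
  shows "Hr x = integral {0..x} (\<lambda>x. (\<phi>x x 0 + \<phi>t x 0) / 2)"
    and "Hl (- x) = integral {0..x} (\<lambda>x. (\<phi>t x 0 - \<phi>x x 0) / 2)"
proof -
  define W where "W = (\<lambda>x. (Hr x + Hl (- x)) - integral {0..x} (\<lambda>x. \<phi>t x 0))"
  have int: "(\<lambda>x. \<phi>x x 0) integrable_on {0..x}" "(\<lambda>x. \<phi>t x 0) integrable_on {0..x}" if "x \<le> L" for x
    by (intro L2_on_integrable L2_on_subinterval[OF initial_data_L2(1)] L2_on_subinterval[OF initial_data_L2(2)];
        use that in simp)+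
  have W: "continuous_on {0..L} W"
    unfolding W_def
    by (intro continuous_intros continuous_profile indefinite_integral_continuous_1 int) simp
  have const: "W y = W (L / 2)" if y: "y \<in> {0<..<L}" for y
  proof -
    have *: "W b = W a" if "0 < a" "a < b" "b < L" for a b
      using initial_velocity_increment[OF that] that
        Henstock_Kurzweil_Integration.integral_combine[of 0 a b "\<lambda>x. \<phi>t x 0"] int(2)[of b]
      by (simp add: W_def)
    show ?thesis
      using *[of y "L / 2"] *[of "L / 2" y] y L by (cases y "L / 2" rule: linorder_cases) auto
  qed
  have const': "W y = W (L / 2)" if "y \<in> {0..L}" for y
  proof (rule continuous_constant_on_closure[where S = "{0<..<L}" and f = W])
    show "continuous_on (closure {0<..<L}) W" "y \<in> closure {0<..<L}"
      using W that L by simp_all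
  qed (rule const)
  have "W x = W 0"
    using const'[OF x] const'[of 0] L by simp
  moreover have "W 0 = 0"
    by (simp add: W_def Hr_def Hl_def H_0)
  ultimately have 1: "Hr x + Hl (- x) = integral {0..x} (\<lambda>x. \<phi>t x 0)"
    by (simp add: W_def)
  have 2: "Hr x - Hl (- x) = integral {0..x} (\<lambda>x. \<phi>x x 0)"
    using phi_eq_H[of 0 x] phi_eq_integral[of 0 x] x by (simp add: Hr_def Hl_def)
  have "integral {0..x} (\<lambda>x. (\<phi>x x 0 + \<phi>t x 0) / 2) = (integral {0..x} (\<lambda>x. \<phi>x x 0) + integral {0..x} (\<lambda>x. \<phi>t x 0)) / 2"
    using int[of x] x by (simp add: Henstock_Kurzweil_Integration.integral_add)
  then show "Hr x = integral {0..x} (\<lambda>x. (\<phi>x x 0 + \<phi>t x 0) / 2)"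
    using 1 2 by simp
  have "integral {0..x} (\<lambda>x. (\<phi>t x 0 - \<phi>x x 0) / 2) = (integral {0..x} (\<lambda>x. \<phi>t x 0) - integral {0..x} (\<lambda>x. \<phi>x x 0)) / 2"
    using int[of x] x by (simp add: Henstock_Kurzweil_Integration.integral_diff)
  then show "Hl (- x) = integral {0..x} (\<lambda>x. (\<phi>t x 0 - \<phi>x x 0) / 2)"
    using 1 2 by simp
qed

end

section \<open>Fourier series of square integrable functions\<close>

definition trig :: "int \<Rightarrow> real \<Rightarrow> complex" where
  "trig n s = exp (of_int n * of_real pi * \<i> * of_real s)"

lemma trig_0 [simp]: "trig 0 s = 1" "trig n 0 = 1"
  by (simp_all add: trig_def)

lemma trig_mult: "trig n s * trig m s = trig (n + m) s"
  by (simp add: trig_def exp_add[symmetric] algebra_simps)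

lemma cnj_trig: "cnj (trig n s) = trig (- n) s"
  by (simp add: trig_def exp_cnj)

lemma norm_trig [simp]: "norm (trig n s) = 1"
  by (simp add: trig_def norm_exp_eq_Re)

lemma trig_add: "trig n (s + r) = trig n s * trig n r"
  by (simp add: trig_def exp_add[symmetric] algebra_simps)

lemma trig_2: "trig n 2 = 1"
  by (auto simp: trig_def exp_eq_1 intro!: exI[of _ n])

lemma trig_periodic: "trig n (s + 2) = trig n s"
  by (simp add: trig_add trig_2)

lemma trig_has_vector_derivative:
  "((\<lambda>s. trig n s) has_vector_derivative of_int n * of_real pi * \<i> * trig n s) (at s within S)"
proof -
  have "((\<lambda>z. exp (of_int n * of_real pi * \<i> * z)) has_field_derivative
      exp (of_int n * of_real pi * \<i> * of_real s) * (of_int n * of_real pi * \<i>)) (at (of_real s))"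
    by (auto intro!: derivative_eq_intros)
  from has_vector_derivative_real_field[OF this] show ?thesis
    by (simp add: trig_def mult.commute)
qed

lemma continuous_trig [continuous_intros]: "continuous_on S (\<lambda>s. trig n s)"
  unfolding trig_def by (intro continuous_intros)

lemma trig_has_integral:
  assumes "n \<noteq> 0" "a \<le> b"
  shows "(trig n has_integral (trig n b - trig n a) / (of_int n * of_real pi * \<i>)) {a..b}"
proof -
  have "((\<lambda>s. of_int n * of_real pi * \<i> * trig n s) has_integral trig n b - trig n a) {a..b}"
    using assms by (intro fundamental_theorem_of_calculus trig_has_vector_derivative)
  from has_integral_mult_right[OF this, of "inverse (of_int n * of_real pi * \<i>)"] assms
  show ?thesis
    by (simp add: field_simps)
qed

lemma trig_orthogonal: "(trig n has_integral (if n = 0 then 2 else 0)) {c..c + 2}"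
proof (cases "n = 0")
  case True
  then have "trig n = (\<lambda>_. 1)"
    by (simp add: fun_eq_iff)
  then show ?thesis
    using True has_integral_const_real[of "1::complex" c "c + 2"] by (simp add: scaleR_conv_of_real)
next
  case False
  then show ?thesis
    using trig_has_integral[of n c "c + 2"] by (simp add: trig_periodic)
qed

lemma L2_on_abs_integrable:
  assumes "L2_on {a..b} f"
  shows "f absolutely_integrable_on {a..b}"
  using L2_on_mult[OF assms L2_on_continuous[of a b "\<lambda>_. 1"]] by simp

lemma integrable_times_continuous:
  fixes g :: "real \<Rightarrow> complex"
  assumes f: "L2_on {a..b} f" and g: "continuous_on {a..b} g"
  shows "(\<lambda>s. of_real (f s) * g s) integrable_on {a..b}"
proof -
  have bil: "bilinear (\<lambda>(z::complex) (r::real). r *\<^sub>R z)"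
    by (auto simp: bilinear_def linear_iff algebra_simps)
  have meas: "g \<in> borel_measurable (lebesgue_on {a..b})"
    by (rule continuous_imp_measurable_on_sets_lebesgue[OF g]) auto
  have "bounded (g ` {a..b})"
    by (intro compact_imp_bounded compact_continuous_image g) auto
  from absolutely_integrable_bounded_measurable_product[OF bil meas _ this L2_on_abs_integrable[OF f]]
  show ?thesis
    by (simp add: absolutely_integrable_on_def scaleR_conv_of_real)
qed

definition fourier_coeff :: "real \<Rightarrow> (real \<Rightarrow> real) \<Rightarrow> int \<Rightarrow> complex" where
  "fourier_coeff c f n = integral {c..c + 2} (\<lambda>s. of_real (f s) * trig (- n) s) / 2"

text \<open>Expanding the square, every trigonometric polynomial has an explicit mean square distance
  from \<open>f\<close>. Best approximation by partial Fourier sums and Bessel's inequality are both read off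
  from this formula.\<close>

lemma trig_polynomial_distance:
  assumes f: "L2_on {c..c + 2} f" and F: "finite F"
  shows "((\<lambda>s. (cmod ((\<Sum>n\<in>F. a n * trig n s) - of_real (f s)))\<^sup>2) has_integral
    integral {c..c + 2} (\<lambda>s. (f s)\<^sup>2)
      + 2 * (\<Sum>n\<in>F. (cmod (a n - fourier_coeff c f n))\<^sup>2 - (cmod (fourier_coeff c f n))\<^sup>2)) {c..c + 2}"
proof -
  define d where "d = fourier_coeff c f"
  define P where "P = (\<lambda>s. \<Sum>n\<in>F. a n * trig n s)"
  have cross: "((\<lambda>s. \<Sum>n\<in>F. cnj (a n) * (of_real (f s) * trig (- n) s)) has_integral (\<Sum>n\<in>F. cnj (a n) * (2 * d n))) {c..c + 2}"
  proof (intro has_integral_sum[OF F] has_integral_mult_right)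
    show "((\<lambda>s. of_real (f s) * trig (- n) s) has_integral 2 * d n) {c..c + 2}" for n
      using integrable_integral[OF integrable_times_continuous[OF f continuous_trig]]
      by (simp add: d_def fourier_coeff_def)
  qed
  have square: "((\<lambda>s. \<Sum>n\<in>F. \<Sum>m\<in>F. a n * cnj (a m) * trig (n - m) s) has_integral (\<Sum>n\<in>F. \<Sum>m\<in>F. a n * cnj (a m) * (if n - m = 0 then 2 else 0))) {c..c + 2}"
    by (intro has_integral_sum[OF F] has_integral_mult_right trig_orthogonal)
  have "(\<Sum>n\<in>F. \<Sum>m\<in>F. a n * cnj (a m) * (if n - m = 0 then 2 else 0)) = (\<Sum>n\<in>F. 2 * (a n * cnj (a n)))"
  proof (rule sum.cong[OF refl])
    fix n assume "n \<in> F"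
    have "(\<Sum>m\<in>F. a n * cnj (a m) * (if n - m = 0 then 2 else 0)) = (\<Sum>m\<in>F. if n = m then 2 * (a n * cnj (a m)) else 0)"
      by (intro sum.cong) auto
    then show "(\<Sum>m\<in>F. a n * cnj (a m) * (if n - m = 0 then 2 else 0)) = 2 * (a n * cnj (a n))"
      using F \<open>n \<in> F\<close> by simp
  qed
  with square have square': "((\<lambda>s. \<Sum>n\<in>F. \<Sum>m\<in>F. a n * cnj (a m) * trig (n - m) s) has_integral (\<Sum>n\<in>F. 2 * (a n * cnj (a n)))) {c..c + 2}"
    by simp
  have pointwise: "(cmod (P s - of_real (f s)))\<^sup>2 =
      Re (\<Sum>n\<in>F. \<Sum>m\<in>F. a n * cnj (a m) * trig (n - m) s) - 2 * Re (\<Sum>n\<in>F. cnj (a n) * (of_real (f s) * trig (- n) s)) + (f s)\<^sup>2" for s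
  proof -
    have "(\<Sum>n\<in>F. \<Sum>m\<in>F. a n * cnj (a m) * trig (n - m) s) = P s * cnj (P s)"
    proof -
      have "trig (n - m) s = trig n s * trig (- m) s" for n m
        using trig_mult[of n s "- m"] by simp
      then show ?thesis
        by (simp add: P_def cnj_trig sum_product mult_ac)
    qed
    moreover have "(\<Sum>n\<in>F. cnj (a n) * (of_real (f s) * trig (- n) s)) = of_real (f s) * cnj (P s)"
      by (simp add: P_def cnj_trig sum_distrib_left mult_ac)
    ultimately show ?thesis
      unfolding cmod_power2 by (simp add: power2_eq_square algebra_simps)
  qed
  have "((\<lambda>s. (cmod (P s - of_real (f s)))\<^sup>2) has_integral
      Re (\<Sum>n\<in>F. 2 * (a n * cnj (a n))) - 2 * Re (\<Sum>n\<in>F. cnj (a n) * (2 * d n)) + integral {c..c + 2} (\<lambda>s. (f s)\<^sup>2)) {c..c + 2}"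
    unfolding pointwise
    using has_integral_linear[OF square' bounded_linear_Re] has_integral_linear[OF cross bounded_linear_Re]
    by (intro has_integral_add has_integral_diff has_integral_mult_right integrable_integral L2_on_square f)
      (simp_all add: o_def)
  also have "Re (\<Sum>n\<in>F. 2 * (a n * cnj (a n))) - 2 * Re (\<Sum>n\<in>F. cnj (a n) * (2 * d n))
      = (\<Sum>n\<in>F. 2 * ((cmod (a n - d n))\<^sup>2 - (cmod (d n))\<^sup>2))"
    unfolding Re_sum sum_distrib_left sum_subtractf[symmetric] cmod_power2
    by (intro sum.cong) (auto simp: power2_eq_square algebra_simps)
  finally show ?thesis
    by (simp add: P_def d_def sum_distrib_left add.commute)
qed

subsection \<open>Density of trigonometric polynomials\<close>

inductive trig_polynomial :: "(real \<Rightarrow> complex) \<Rightarrow> bool" where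
  monomial: "trig_polynomial (\<lambda>s. a * trig n s)"
| add: "trig_polynomial P \<Longrightarrow> trig_polynomial Q \<Longrightarrow> trig_polynomial (\<lambda>s. P s + Q s)"

lemma trig_polynomial_mult:
  assumes "trig_polynomial P" "trig_polynomial Q"
  shows "trig_polynomial (\<lambda>s. P s * Q s)"
  using assms
proof (induction P rule: trig_polynomial.induct)
  case (monomial a n)
  from \<open>trig_polynomial Q\<close> show ?case
  proof (induction Q rule: trig_polynomial.induct)
    case (monomial b m)
    have "(\<lambda>s. a * trig n s * (b * trig m s)) = (\<lambda>s. (a * b) * trig (n + m) s)"
      by (simp add: trig_mult[symmetric] mult_ac)
    then show ?case
      by (simp only: trig_polynomial.monomial)
  next
    case (add P Q)
    then show ?case
      using trig_polynomial.add by (simp add: distrib_left)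
  qed
next
  case (add P P')
  then show ?case
    using trig_polynomial.add by (simp add: distrib_right)
qed

lemma trig_polynomial_eq_sum:
  assumes "trig_polynomial P"
  shows "\<exists>F a. finite F \<and> P = (\<lambda>s. \<Sum>n\<in>F. a n * trig n s)"
  using assms
proof (induction rule: trig_polynomial.induct)
  case (monomial a n)
  show ?case
    by (intro exI[of _ "{n}"] exI[of _ "\<lambda>_. a"]) simp
next
  case (add P Q)
  then obtain F a G b where F: "finite F" "P = (\<lambda>s. \<Sum>n\<in>F. a n * trig n s)"
    and G: "finite G" "Q = (\<lambda>s. \<Sum>n\<in>G. b n * trig n s)"
    by blast
  define e where "e = (\<lambda>n. (if n \<in> F then a n else 0) + (if n \<in> G then b n else 0))"
  have "P s + Q s = (\<Sum>n\<in>F \<union> G. e n * trig n s)" for s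
  proof -
    have "P s = (\<Sum>n\<in>F \<union> G. (if n \<in> F then a n else 0) * trig n s)"
      unfolding F using F(1) G(1) by (intro sum.mono_neutral_cong_left) auto
    moreover have "Q s = (\<Sum>n\<in>F \<union> G. (if n \<in> G then b n else 0) * trig n s)"
      unfolding G using F(1) G(1) by (intro sum.mono_neutral_cong_left) auto
    ultimately show ?thesis
      by (simp add: e_def distrib_right sum.distrib)
  qed
  then show ?case
    using F(1) G(1) by (intro exI[of _ "F \<union> G"] exI[of _ e]) auto
qed

text \<open>On the unit circle the real and imaginary parts of \<open>z\<close> are combinations of \<open>z\<close> and \<open>1/z\<close>. The
  circle is parametrised from \<open>c\<close> so that its branch point is the end of the period in use.\<close>

lemma real_polynomial_on_circle_is_trig_polynomial:
  assumes "real_polynomial_function (p :: complex \<Rightarrow> real)"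
  shows "trig_polynomial (\<lambda>s. of_real (p (trig 1 (s - c))))"
  using assms
proof (induction rule: real_polynomial_function.induct)
  case (linear f)
  define \<alpha> \<beta> where "\<alpha> = (of_real (f 1) - \<i> * of_real (f \<i>)) / 2" and "\<beta> = (of_real (f 1) + \<i> * of_real (f \<i>)) / 2"
  have f: "f z = Re z * f 1 + Im z * f \<i>" for z
  proof -
    interpret bounded_linear f by (rule linear)
    have "z = Re z *\<^sub>R 1 + Im z *\<^sub>R \<i>"
      by (simp add: complex_eq_iff)
    from arg_cong[OF this, of f] show ?thesis
      by (simp only: add scaleR real_scaleR_def)
  qed
  have "of_real (f z) = \<alpha> * z + \<beta> * cnj z" for z
    by (simp add: f[of z] complex_eq_iff \<alpha>_def \<beta>_def field_simps)
  then have "(\<lambda>s. complex_of_real (f (trig 1 (s - c)))) = (\<lambda>s. (\<alpha> * trig 1 (- c)) * trig 1 s + (\<beta> * trig (- 1) (- c)) * trig (- 1) s)"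
    using trig_add[of _ _ "- c"] by (simp add: cnj_trig mult_ac)
  then show ?case
    by (simp only: trig_polynomial.intros)
next
  case (const r)
  show ?case
    using trig_polynomial.monomial[of "of_real r" 0] by simp
next
  case (add f g)
  then show ?case
    using trig_polynomial.add by simp
next
  case (mult f g)
  then show ?case
    using trig_polynomial_mult by simp
qed

text \<open>A continuous function with equal values at the ends of a period is a continuous function on
  the unit circle, where the Stone-Weierstrass theorem applies.\<close>

lemma uniform_trig_approximation:
  fixes g :: "real \<Rightarrow> real"
  assumes g: "continuous_on {c..c + 2} g" "g c = g (c + 2)" and "e > 0"
  obtains F a where "finite F" "\<And>s. s \<in> {c..c + 2} \<Longrightarrow> cmod ((\<Sum>n\<in>F. a n * trig n s) - of_real (g s)) < e"
proof -
  define p where "p = (\<lambda>t. g (c + 2 * t))"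
  define G where "G = p \<circ> (\<lambda>z. Arg2pi z / (2 * pi))"
  have "path p"
    unfolding path_def p_def by (rule continuous_on_compose2[OF g(1)]) (auto intro!: continuous_intros)
  moreover have "pathfinish p = pathstart p"
    using g(2) by (simp add: p_def pathfinish_def pathstart_def)
  ultimately have "homotopic_loops UNIV p p"
    by (simp add: homotopic_loops_refl)
  from homotopic_with_imp_continuous[OF homotopic_loops_imp_homotopic_circlemaps[OF this]]
  have "continuous_on (sphere 0 1) G"
    by (simp add: G_def)
  then obtain q where q: "real_polynomial_function q" "\<And>z. z \<in> sphere 0 1 \<Longrightarrow> \<bar>G z - q z\<bar> < e"
    using Stone_Weierstrass_real_polynomial_function[of "sphere 0 1" G e] \<open>e > 0\<close> by auto
  have Gg: "G (trig 1 (s - c)) = g s" if s: "s \<in> {c..c + 2}" for s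
  proof (cases "s = c + 2")
    case True
    then show ?thesis
      using g(2) Arg2pi_of_real[of 1] by (simp add: G_def p_def trig_2)
  next
    case False
    have "Arg2pi (trig 1 (s - c)) = pi * (s - c)"
      by (rule Arg2pi_unique[of 1]) (use s False in \<open>auto simp: trig_def mult_ac\<close>)
    moreover have "c + 2 * (pi * (s - c) / (2 * pi)) = s"
      by (simp add: field_simps)
    ultimately show ?thesis
      by (simp only: G_def p_def o_def)
  qed
  obtain F a where F: "finite F" "(\<lambda>s. of_real (q (trig 1 (s - c)))) = (\<lambda>s. \<Sum>n\<in>F. a n * trig n s)"
    using trig_polynomial_eq_sum[OF real_polynomial_on_circle_is_trig_polynomial[OF q(1)]] by blast
  show ?thesis
  proof (rule that[OF F(1)])
    fix s assume "s \<in> {c..c + 2}"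
    then have "\<bar>g s - q (trig 1 (s - c))\<bar> < e"
      using q(2)[of "trig 1 (s - c)"] Gg by simp
    moreover have "(\<Sum>n\<in>F. a n * trig n s) - of_real (g s) = of_real (q (trig 1 (s - c)) - g s)"
      using fun_cong[OF F(2), of s] by simp
    ultimately show "cmod ((\<Sum>n\<in>F. a n * trig n s) - of_real (g s)) < e"
      by (simp only: norm_of_real abs_minus_commute)
  qed
qed

text \<open>Lebesgue measurable functions are almost everywhere limits of continuous functions. Cutting
  off large values first, and cutting the approximants off at the ends of the interval, dominated
  convergence gives approximation in mean square.\<close>

lemma L2_on_truncate_approximation:
  assumes f: "L2_on {a..b} f" and e: "e > 0"
  obtains M :: nat where "L2_on {a..b} (\<lambda>x. max (- real M) (min (real M) (f x)))"
    "integral {a..b} (\<lambda>x. (f x - max (- real M) (min (real M) (f x)))\<^sup>2) < e"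
proof -
  define T where "T = (\<lambda>(M::nat) x. max (- real M) (min (real M) (f x)))"
  have T: "L2_on {a..b} (T M)" for M
  proof -
    have meas: "T M \<in> borel_measurable (lebesgue_on {a..b})"
      unfolding T_def using L2_on_measurable[OF f] by measurable
    have "(\<lambda>x. (T M x)\<^sup>2) absolutely_integrable_on {a..b}"
    proof (rule measurable_bounded_by_integrable_imp_absolutely_integrable[OF _ _ L2_on_square[OF f]])
      show "(\<lambda>x. (T M x)\<^sup>2) \<in> borel_measurable (lebesgue_on {a..b})"
        using meas by measurable
      show "norm ((T M x)\<^sup>2) \<le> (f x)\<^sup>2" for x
        unfolding real_norm_def abs_power2
        by (rule iffD1[OF abs_le_square_iff]) (auto simp: T_def max_def min_def)
    qed auto
    then show ?thesis
      using meas by (auto simp: L2_on_def absolutely_integrable_on_def)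
  qed
  have "(\<lambda>M. integral {a..b} (\<lambda>x. (f x - T M x)\<^sup>2)) \<longlonglongrightarrow> integral {a..b} (\<lambda>x. 0)"
  proof (rule dominated_convergence[OF _ L2_on_square[OF f]])
    show "(\<lambda>x. (f x - T M x)\<^sup>2) integrable_on {a..b}" for M
      by (rule L2_on_square[OF L2_on_diff[OF f T]])
    show "norm ((f x - T M x)\<^sup>2) \<le> (f x)\<^sup>2" for M x
      unfolding real_norm_def abs_power2
      by (rule iffD1[OF abs_le_square_iff]) (auto simp: T_def max_def min_def)
    show "(\<lambda>M. (f x - T M x)\<^sup>2) \<longlonglongrightarrow> 0" for x
    proof (rule tendsto_eventually)
      have "T M x = f x" if "nat \<lceil>\<bar>f x\<bar>\<rceil> \<le> M" for M
      proof -
        have "\<bar>f x\<bar> \<le> real M"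
          using that by linarith
        then show ?thesis
          by (auto simp: T_def max_def min_def)
      qed
      then show "\<forall>\<^sub>F M in sequentially. (f x - T M x)\<^sup>2 = 0"
        by (intro eventually_sequentiallyI[of "nat \<lceil>\<bar>f x\<bar>\<rceil>"]) simp
    qed
  qed
  then have "\<forall>\<^sub>F M in sequentially. integral {a..b} (\<lambda>x. (f x - T M x)\<^sup>2) < e"
    using e by (intro order_tendstoD(2)[of _ "0::real"]) simp_all
  then obtain M where "integral {a..b} (\<lambda>x. (f x - T M x)\<^sup>2) < e"
    by (auto simp: eventually_sequentially)
  then show ?thesis
    using that[of M] T[of M] by (simp add: T_def)
qed

lemma L2_on_continuous_approximation:
  assumes f: "L2_on {a..b} f" and ab: "a < b" and e: "e > 0"
  obtains g where "continuous_on {a..b} g" "g a = 0" "g b = 0"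
    "integral {a..b} (\<lambda>x. (f x - g x)\<^sup>2) < e"
proof -
  obtain M :: nat where fM': "L2_on {a..b} (\<lambda>x. max (- real M) (min (real M) (f x)))"
    and fM_close: "integral {a..b} (\<lambda>x. (f x - max (- real M) (min (real M) (f x)))\<^sup>2) < e / 4"
    using L2_on_truncate_approximation[OF f, of "e / 4"] e by auto
  define fM where "fM = (\<lambda>x. max (- real M) (min (real M) (f x)))"
  have fM: "L2_on {a..b} fM"
    using fM' by (simp add: fM_def)
  have "f measurable_on {a..b}"
    using L2_on_measurable[OF f] by (subst measurable_on_iff_borel_measurable) auto
  then obtain N g where N: "negligible N" and g: "\<And>n. continuous_on UNIV (g n :: real \<Rightarrow> real)"
    and lim: "\<And>x. x \<notin> N \<Longrightarrow> (\<lambda>n. g n x) \<longlonglongrightarrow> (if x \<in> {a..b} then f x else 0)"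
    unfolding measurable_on_def by blast
  define \<rho> where "\<rho> = (\<lambda>(n::nat) x. min 1 (real n * (x - a)) * min 1 (real n * (b - x)))"
  define h where "h = (\<lambda>n x. \<rho> n x * max (- real M) (min (real M) (g n x)))"
  have h: "continuous_on {a..b} (h n)" for n
    unfolding h_def \<rho>_def by (intro continuous_intros continuous_on_subset[OF g]) auto
  have h_bound: "\<bar>h n x\<bar> \<le> real M" if "x \<in> {a..b}" for n x
  proof -
    have "0 \<le> \<rho> n x" "\<rho> n x \<le> 1"
      using that unfolding \<rho>_def by (auto intro!: mult_le_one)
    moreover have "\<bar>max (- real M) (min (real M) (g n x))\<bar> \<le> real M"
      by (auto simp: max_def min_def)
    ultimately have "\<bar>\<rho> n x\<bar> * \<bar>max (- real M) (min (real M) (g n x))\<bar> \<le> 1 * real M"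
      by (intro mult_mono) auto
    then show ?thesis
      by (simp add: h_def abs_mult)
  qed
  have cutoff: "(\<lambda>n. min 1 (real n * y)) \<longlonglongrightarrow> 1" if "0 < y" for y :: real
  proof (rule tendsto_eventually)
    obtain k :: nat where k: "1 < real k * y"
      using reals_Archimedean3[OF \<open>0 < y\<close>] by blast
    have "1 \<le> real n * y" if "k \<le> n" for n
    proof -
      have "real k * y \<le> real n * y"
        using that \<open>0 < y\<close> by (intro mult_right_mono) auto
      with k show ?thesis
        by linarith
    qed
    then show "\<forall>\<^sub>F n in sequentially. min 1 (real n * y) = 1"
      by (intro eventually_sequentiallyI[of k]) (simp add: min_def)
  qed
  define Z where "Z = N \<union> {a, b}"
  have Z: "negligible Z"
    unfolding Z_def by (rule negligible_Un[OF N negligible_finite]) simp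
  have h_lim: "(\<lambda>n. h n x) \<longlonglongrightarrow> fM x" if "x \<in> {a..b}" "x \<notin> Z" for x
  proof -
    have "(\<lambda>n. h n x) \<longlonglongrightarrow> (1 * 1) * max (- real M) (min (real M) (f x))"
      unfolding h_def \<rho>_def using lim[of x] that
      by (intro tendsto_mult cutoff tendsto_max tendsto_min tendsto_const) (auto simp: Z_def)
    then show ?thesis
      by (simp add: fM_def)
  qed
  have int: "(\<lambda>x. (fM x - h n x)\<^sup>2) integrable_on {a..b}" for n
    by (intro L2_on_square L2_on_diff fM L2_on_continuous h)
  have spike: "integral {a..b} (\<lambda>x. (fM x - h n x)\<^sup>2) = integral {a..b} (\<lambda>x. if x \<in> Z then 0 else (fM x - h n x)\<^sup>2)" for n
    by (rule integral_spike[OF Z]) auto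
  have "(\<lambda>n. integral {a..b} (\<lambda>x. if x \<in> Z then 0 else (fM x - h n x)\<^sup>2)) \<longlonglongrightarrow> integral {a..b} (\<lambda>x. 0)"
  proof (rule dominated_convergence)
    show "(\<lambda>x. if x \<in> Z then 0 else (fM x - h n x)\<^sup>2) integrable_on {a..b}" for n
      by (rule integrable_spike[OF int Z]) auto
    show "(\<lambda>x. (2 * real M)\<^sup>2) integrable_on {a..b}"
      by (rule integrable_const_ivl)
    show "norm (if x \<in> Z then 0 else (fM x - h n x)\<^sup>2) \<le> (2 * real M)\<^sup>2" if "x \<in> {a..b}" for n x
    proof -
      have "\<bar>fM x - h n x\<bar> \<le> 2 * real M"
        using h_bound[OF that, of n] by (auto simp: fM_def max_def min_def)
      then have "(fM x - h n x)\<^sup>2 \<le> (2 * real M)\<^sup>2"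
        by (intro iffD1[OF abs_le_square_iff]) simp
      then show ?thesis
        by simp
    qed
    show "(\<lambda>n. if x \<in> Z then 0 else (fM x - h n x)\<^sup>2) \<longlonglongrightarrow> 0" if "x \<in> {a..b}" for x
    proof (cases "x \<in> Z")
      case False
      have "(\<lambda>n. (fM x - h n x)\<^sup>2) \<longlonglongrightarrow> (fM x - fM x)\<^sup>2"
        by (intro tendsto_intros h_lim that False)
      then show ?thesis
        using False by simp
    qed simp
  qed
  then have "\<forall>\<^sub>F n in sequentially. integral {a..b} (\<lambda>x. (fM x - h n x)\<^sup>2) < e / 4"
    unfolding spike[symmetric] using e by (intro order_tendstoD(2)[of _ "0::real"]) simp_all
  then obtain n where n: "integral {a..b} (\<lambda>x. (fM x - h n x)\<^sup>2) < e / 4"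
    by (auto simp: eventually_sequentially)
  have "integral {a..b} (\<lambda>x. (f x - h n x)\<^sup>2) \<le> 2 * integral {a..b} (\<lambda>x. (f x - fM x)\<^sup>2) + 2 * integral {a..b} (\<lambda>x. (fM x - h n x)\<^sup>2)"
    using square_integral_add_le[OF L2_on_diff[OF f fM] L2_on_diff[OF fM L2_on_continuous[OF h[of n]]]] by simp
  also have "\<dots> < e"
    using n fM_close by (simp add: fM_def)
  finally show ?thesis
    using that[OF h, of n] by (simp add: h_def \<rho>_def)
qed

lemma mean_square_trig_approximation:
  assumes f: "L2_on {c..c + 2} f" and e: "e > 0"
  obtains F a where "finite F" "integral {c..c + 2} (\<lambda>s. (cmod ((\<Sum>n\<in>F. a n * trig n s) - of_real (f s)))\<^sup>2) < e"
proof -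
  obtain g where g: "continuous_on {c..c + 2} g" "g c = 0" "g (c + 2) = 0"
    and close: "integral {c..c + 2} (\<lambda>x. (f x - g x)\<^sup>2) < e / 4"
    using L2_on_continuous_approximation[OF f, of "e / 4"] e by auto
  define \<delta> where "\<delta> = sqrt (e / 8)"
  have \<delta>: "\<delta> > 0" "\<delta>\<^sup>2 = e / 8"
    using e by (auto simp: \<delta>_def)
  obtain F a where F: "finite F" and a: "\<And>s. s \<in> {c..c + 2} \<Longrightarrow> cmod ((\<Sum>n\<in>F. a n * trig n s) - of_real (g s)) < \<delta>"
    using uniform_trig_approximation[OF g(1) _ \<delta>(1)] g by auto
  have "integral {c..c + 2} (\<lambda>s. (cmod ((\<Sum>n\<in>F. a n * trig n s) - of_real (f s)))\<^sup>2)
      \<le> integral {c..c + 2} (\<lambda>s. 2 * (f s - g s)\<^sup>2 + 2 * \<delta>\<^sup>2)"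
  proof (rule integral_le)
    show "(\<lambda>s. (cmod ((\<Sum>n\<in>F. a n * trig n s) - of_real (f s)))\<^sup>2) integrable_on {c..c + 2}"
      using trig_polynomial_distance[OF f F] by blast
    show "(\<lambda>s. 2 * (f s - g s)\<^sup>2 + 2 * \<delta>\<^sup>2) integrable_on {c..c + 2}"
      by (intro integrable_add integrable_on_mult_right L2_on_square L2_on_diff f L2_on_continuous g) auto
    fix s assume s: "s \<in> {c..c + 2}"
    define u v where "u = cmod ((\<Sum>n\<in>F. a n * trig n s) - of_real (g s))" and "v = \<bar>f s - g s\<bar>"
    have "cmod ((\<Sum>n\<in>F. a n * trig n s) - of_real (f s)) \<le> u + v"
    proof -
      have "cmod (of_real (g s) - of_real (f s)) = v"
        unfolding v_def by (metis abs_minus_commute norm_of_real of_real_diff)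
      then show ?thesis
        using dist_triangle[of "\<Sum>n\<in>F. a n * trig n s" "of_real (f s)" "of_real (g s)"]
        by (simp add: u_def dist_norm)
    qed
    then have "(cmod ((\<Sum>n\<in>F. a n * trig n s) - of_real (f s)))\<^sup>2 \<le> (u + v)\<^sup>2"
      by (intro power_mono) auto
    also have "\<dots> \<le> 2 * v\<^sup>2 + 2 * u\<^sup>2"
      using sum_squares_bound[of u v] by (simp add: power2_sum)
    also have "u\<^sup>2 \<le> \<delta>\<^sup>2"
      using a[OF s] by (intro power_mono) (auto simp: u_def)
    finally show "(cmod ((\<Sum>n\<in>F. a n * trig n s) - of_real (f s)))\<^sup>2 \<le> 2 * (f s - g s)\<^sup>2 + 2 * \<delta>\<^sup>2"
      by (simp add: v_def)
  qed
  also have "\<dots> = 2 * integral {c..c + 2} (\<lambda>s. (f s - g s)\<^sup>2) + 4 * \<delta>\<^sup>2"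
    using L2_on_square[OF L2_on_diff[OF f L2_on_continuous[OF g(1)]]]
    by (subst Henstock_Kurzweil_Integration.integral_add) auto
  also have "\<dots> < e"
    using close \<delta> by simp
  finally show ?thesis
    using that F by blast
qed

text \<open>A trigonometric polynomial close to \<open>f\<close> involves finitely many modes, and any partial sum that
  contains them is at least as close, by \<open>trig_polynomial_distance\<close>.\<close>

lemma fourier_series_converges:
  assumes f: "L2_on {c..c + 2} f"
  shows "(\<lambda>N. integral {c..c + 2} (\<lambda>s. (cmod ((\<Sum>n\<in>{- int N..int N}. fourier_coeff c f n * trig n s) - of_real (f s)))\<^sup>2)) \<longlonglongrightarrow> 0"
proof (rule LIMSEQ_I)
  fix e :: real assume "e > 0"
  then obtain F a where F: "finite F"
    and a: "integral {c..c + 2} (\<lambda>s. (cmod ((\<Sum>n\<in>F. a n * trig n s) - of_real (f s)))\<^sup>2) < e"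
    using mean_square_trig_approximation[OF f] by blast
  define N0 where "N0 = nat (Max (insert 0 (abs ` F)))"
  have N0: "F \<subseteq> {- int N..int N}" if "N0 \<le> N" for N
  proof
    fix n assume "n \<in> F"
    then have "\<bar>n\<bar> \<le> Max (insert 0 (abs ` F))"
      using F by (intro Max_ge) auto
    then show "n \<in> {- int N..int N}"
      using that by (auto simp: N0_def)
  qed
  show "\<exists>N0. \<forall>N\<ge>N0. norm (integral {c..c + 2} (\<lambda>s. (cmod ((\<Sum>n\<in>{- int N..int N}. fourier_coeff c f n * trig n s) - of_real (f s)))\<^sup>2) - 0) < e"
  proof (intro exI[of _ N0] allI impI)
    fix N assume N: "N0 \<le> N"
    define a' where "a' = (\<lambda>n. if n \<in> F then a n else 0)"
    have eq: "(\<Sum>n\<in>{- int N..int N}. a' n * trig n s) = (\<Sum>n\<in>F. a n * trig n s)" for s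
      using N0[OF N] by (intro sum.mono_neutral_cong_right) (auto simp: a'_def)
    let ?d = "fourier_coeff c f"
    have "integral {c..c + 2} (\<lambda>s. (cmod ((\<Sum>n\<in>{- int N..int N}. ?d n * trig n s) - of_real (f s)))\<^sup>2)
        = integral {c..c + 2} (\<lambda>s. (f s)\<^sup>2) + 2 * (\<Sum>n\<in>{- int N..int N}. (cmod (?d n - ?d n))\<^sup>2 - (cmod (?d n))\<^sup>2)"
      by (rule integral_unique[OF trig_polynomial_distance[OF f]]) simp
    also have "\<dots> \<le> integral {c..c + 2} (\<lambda>s. (f s)\<^sup>2) + 2 * (\<Sum>n\<in>{- int N..int N}. (cmod (a' n - ?d n))\<^sup>2 - (cmod (?d n))\<^sup>2)"
      by (intro add_left_mono mult_left_mono sum_mono) auto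
    also have "\<dots> = integral {c..c + 2} (\<lambda>s. (cmod ((\<Sum>n\<in>{- int N..int N}. a' n * trig n s) - of_real (f s)))\<^sup>2)"
      by (rule integral_unique[OF trig_polynomial_distance[OF f], symmetric]) simp
    also have "\<dots> < e"
      using a by (simp add: eq)
    finally have "integral {c..c + 2} (\<lambda>s. (cmod ((\<Sum>n\<in>{- int N..int N}. ?d n * trig n s) - of_real (f s)))\<^sup>2) < e" .
    moreover have "0 \<le> integral {c..c + 2} (\<lambda>s. (cmod ((\<Sum>n\<in>{- int N..int N}. ?d n * trig n s) - of_real (f s)))\<^sup>2)"
      by (rule integral_nonneg) (use trig_polynomial_distance[OF f, of "{- int N..int N}" ?d] in auto)
    ultimately show "norm (integral {c..c + 2} (\<lambda>s. (cmod ((\<Sum>n\<in>{- int N..int N}. ?d n * trig n s) - of_real (f s)))\<^sup>2) - 0) < e"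
      by simp
  qed
qed

lemma Bessel_inequality:
  assumes f: "L2_on {c..c + 2} f" and F: "finite F"
  shows "(\<Sum>n\<in>F. (cmod (fourier_coeff c f n))\<^sup>2) \<le> integral {c..c + 2} (\<lambda>s. (f s)\<^sup>2) / 2"
proof -
  have "0 \<le> integral {c..c + 2} (\<lambda>s. (f s)\<^sup>2) + 2 * (\<Sum>n\<in>F. (cmod (fourier_coeff c f n - fourier_coeff c f n))\<^sup>2 - (cmod (fourier_coeff c f n))\<^sup>2)"
    by (rule has_integral_nonneg[OF trig_polynomial_distance[OF f F]]) auto
  then show ?thesis
    by (simp add: sum_negf)
qed

section \<open>Series with square summable derivative\<close>

lemma inverse_square_summable_on_int:
  "(\<lambda>n::int. inverse ((real_of_int n)\<^sup>2)) summable_on (UNIV - {0})"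
proof -
  have nat: "(\<lambda>n. inverse ((real (Suc n))\<^sup>2)) summable_on UNIV"
    by (intro norm_summable_imp_summable_on) (use inverse_power_summable[of 2, where 'a = real] summable_Suc_iff[of "\<lambda>n. inverse ((real n)\<^sup>2)"] in \<open>simp del: of_nat_Suc\<close>)
  have "(\<lambda>n::int. inverse ((real_of_int n)\<^sup>2)) summable_on (range (\<lambda>n. int (Suc n)))"
    by (subst summable_on_reindex) (use nat in \<open>auto simp: o_def inj_on_def\<close>)
  moreover have "(\<lambda>n::int. inverse ((real_of_int n)\<^sup>2)) summable_on (range (\<lambda>n. - int (Suc n)))"
  proof (subst summable_on_reindex)
    have "((\<lambda>n::int. inverse ((real_of_int n)\<^sup>2)) \<circ> (\<lambda>n. - int (Suc n))) = (\<lambda>n. inverse ((real (Suc n))\<^sup>2))"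
      by (simp only: fun_eq_iff o_def of_int_minus of_int_of_nat_eq power2_minus) simp
    then show "((\<lambda>n::int. inverse ((real_of_int n)\<^sup>2)) \<circ> (\<lambda>n. - int (Suc n))) summable_on UNIV"
      using nat by simp
  qed (auto simp: inj_on_def)
  ultimately have "(\<lambda>n::int. inverse ((real_of_int n)\<^sup>2)) summable_on (range (\<lambda>n. int (Suc n)) \<union> range (\<lambda>n. - int (Suc n)))"
    by (rule summable_on_Un_disjoint) auto
  moreover have "range (\<lambda>n. int (Suc n)) \<union> range (\<lambda>n. - int (Suc n)) = UNIV - {0}"
  proof safe
    fix n :: int assume "n \<notin> range (\<lambda>n. - int (Suc n))" "n \<noteq> 0"
    then have "n > 0"
      using rangeI[of "\<lambda>n. - int (Suc n)" "nat (- n - 1)"] by (cases "n < 0") auto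
    then show "n \<in> range (\<lambda>n. int (Suc n))"
      by (intro image_eqI[of _ _ "nat (n - 1)"]) auto
  qed auto
  ultimately show ?thesis
    by simp
qed

text \<open>From \<open>x y \<le> x\<^sup>2 + y\<^sup>2\<close> with \<open>x = |n c\<^sub>n|\<close> and \<open>y = 1/|n|\<close>.\<close>

lemma coeff_abs_summable:
  assumes "(\<lambda>n. (cmod (of_int n * c n))\<^sup>2) summable_on (UNIV - {0})"
  shows "(\<lambda>n. norm (c n)) summable_on (UNIV - {0})"
proof (rule Infinite_Sum.abs_summable_on_comparison_test)
  have "(\<lambda>n. (cmod (of_int n * c n))\<^sup>2 + inverse ((real_of_int n)\<^sup>2)) summable_on (UNIV - {0})"
    by (intro summable_on_add assms inverse_square_summable_on_int)
  then show "(\<lambda>n. norm ((cmod (of_int n * c n))\<^sup>2 + inverse ((real_of_int n)\<^sup>2))) summable_on (UNIV - {0})"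
    by simp
  fix n :: int assume "n \<in> UNIV - {0}"
  then have "cmod (c n) = cmod (of_int n * c n) * inverse \<bar>real_of_int n\<bar>"
    by (simp add: norm_mult)
  also have "\<dots> \<le> (cmod (of_int n * c n))\<^sup>2 + (inverse \<bar>real_of_int n\<bar>)\<^sup>2"
  proof -
    have "2 * x * y \<le> x\<^sup>2 + y\<^sup>2 \<Longrightarrow> 0 \<le> x * y \<Longrightarrow> x * y \<le> x\<^sup>2 + y\<^sup>2" for x y :: real
      by linarith
    from this[OF sum_squares_bound mult_nonneg_nonneg] show ?thesis
      by simp
  qed
  finally show "cmod (c n) \<le> norm ((cmod (of_int n * c n))\<^sup>2 + inverse ((real_of_int n)\<^sup>2))"
    by (simp add: power_inverse)
qed

lemma has_sum_of_symmetric_partial_sums: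
  fixes f :: "int \<Rightarrow> complex"
  assumes "f summable_on (UNIV - {0})"
    and lim: "(\<lambda>N. \<Sum>n\<in>{- int N..int N} - {0}. f n) \<longlonglongrightarrow> l"
  shows "(f has_sum l) (UNIV - {0})"
proof -
  have "filterlim (\<lambda>N. {- int N..int N} - {0}) (finite_subsets_at_top (UNIV - {0})) sequentially"
    unfolding filterlim_finite_subsets_at_top
  proof (intro allI impI)
    fix X :: "int set" assume X: "finite X \<and> X \<subseteq> UNIV - {0}"
    define K where "K = nat (Max (insert 0 (abs ` X)))"
    have "X \<subseteq> {- int N..int N} - {0}" if "K \<le> N" for N
    proof
      fix n assume "n \<in> X"
      then have "\<bar>n\<bar> \<le> Max (insert 0 (abs ` X))"
        using X by (intro Max_ge) auto
      then have "n \<in> {- int N..int N}"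
        using that by (auto simp: K_def)
      then show "n \<in> {- int N..int N} - {0}"
        using X \<open>n \<in> X\<close> by auto
    qed
    then show "\<forall>\<^sub>F N in sequentially. finite ({- int N..int N} - {0}) \<and> X \<subseteq> {- int N..int N} - {0} \<and>
        {- int N..int N} - {0} \<subseteq> UNIV - {0}"
      by (intro eventually_sequentiallyI[of K]) auto
  qed
  moreover have "(sum f \<longlongrightarrow> infsum f (UNIV - {0})) (finite_subsets_at_top (UNIV - {0}))"
    using has_sum_infsum[OF assms(1)] by (simp add: has_sum_def)
  ultimately have "(\<lambda>N. \<Sum>n\<in>{- int N..int N} - {0}. f n) \<longlonglongrightarrow> infsum f (UNIV - {0})"
    by (rule filterlim_compose[rotated])
  then have "infsum f (UNIV - {0}) = l"
    using lim LIMSEQ_unique by blast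
  then show ?thesis
    using has_sum_infsum[OF assms(1)] by simp
qed

lemma L2_on_cmod_difference:
  fixes S :: "real \<Rightarrow> complex"
  assumes g: "L2_on {a..b} g" and S: "continuous_on {a..b} S"
  shows "L2_on {a..b} (\<lambda>s. cmod (S s - of_real (g s)))"
proof -
  have sq: "(\<lambda>s. (Re (S s) - g s)\<^sup>2 + (Im (S s))\<^sup>2) integrable_on {a..b}"
    by (intro integrable_add L2_on_square L2_on_diff g L2_on_continuous continuous_intros S)
  have "(\<lambda>s. S s - of_real (g s)) \<in> borel_measurable (lebesgue_on {a..b})"
    using L2_on_measurable[OF g] continuous_imp_measurable_on_sets_lebesgue[OF S]
    by (intro borel_measurable_diff) (auto intro: measurable_compose[OF _ borel_measurable_of_real])
  then show ?thesis
    using sq by (auto simp: L2_on_def cmod_power2)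
qed

text \<open>Convergence in mean square of the differentiated series may be integrated over subintervals,
  which gives the series of the primitive at every point.\<close>

lemma trig_series_of_primitive:
  fixes h g :: "real \<Rightarrow> real"
  assumes g: "L2_on {c..c + 2} g"
    and h: "\<And>s. s \<in> {c..c + 2} \<Longrightarrow> h s = h c + integral {c..s} g"
    and per: "h (c + 2) = h c"
  obtains b where "(\<lambda>n. (cmod (of_int n * b n))\<^sup>2) summable_on (UNIV - {0})"
    "\<And>s. s \<in> {c..c + 2} \<Longrightarrow> ((\<lambda>n. b n * (trig n s - trig n c)) has_sum of_real (h s - h c)) (UNIV - {0})"
    "(\<lambda>N. integral {c..c + 2} (\<lambda>s. (cmod ((\<Sum>n\<in>{- int N..int N} - {0}. b n * (of_int n * of_real pi * \<i>) * trig n s) - of_real (g s)))\<^sup>2)) \<longlonglongrightarrow> 0"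
proof -
  define d where "d = fourier_coeff c g"
  define b where "b = (\<lambda>n. d n / (of_int n * of_real pi * \<i>))"
  have bd: "b n * (of_int n * of_real pi * \<i>) = d n" if "n \<noteq> 0" for n
    using that by (simp add: b_def)
  have "integral {c..c + 2} (\<lambda>s. complex_of_real (g s)) = of_real (integral {c..c + 2} g)"
    using integral_linear[OF L2_on_integrable[OF g] bounded_linear_of_real[where 'a = complex]] by (simp add: o_def)
  then have d0: "d 0 = 0"
    using h[of "c + 2"] per by (simp add: d_def fourier_coeff_def)
  have S_eq: "(\<Sum>n\<in>{- int N..int N} - {0}. b n * (of_int n * of_real pi * \<i>) * trig n s) = (\<Sum>n\<in>{- int N..int N}. d n * trig n s)" for N s
    using d0 bd by (intro sum.mono_neutral_cong_left) auto
  define S where "S = (\<lambda>N s. \<Sum>n\<in>{- int N..int N}. d n * trig n s)"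
  have conv: "(\<lambda>N. integral {c..c + 2} (\<lambda>s. (cmod (S N s - of_real (g s)))\<^sup>2)) \<longlonglongrightarrow> 0"
    using fourier_series_converges[OF g] by (simp add: S_def d_def)
  have S: "continuous_on A (S N)" for N A
    unfolding S_def by (intro continuous_intros)
  have summable: "(\<lambda>n. (cmod (of_int n * b n))\<^sup>2) summable_on (UNIV - {0})"
  proof (rule nonneg_bdd_above_summable_on)
    have "(\<Sum>n\<in>F. (cmod (of_int n * b n))\<^sup>2) \<le> integral {c..c + 2} (\<lambda>s. (g s)\<^sup>2) / 2"
      if F: "F \<subseteq> UNIV - {0}" "finite F" for F
    proof -
      have "(\<Sum>n\<in>F. (cmod (of_int n * b n))\<^sup>2) \<le> (\<Sum>n\<in>F. (cmod (d n))\<^sup>2)"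
      proof (rule sum_mono)
        fix n assume "n \<in> F"
        then have "n \<noteq> 0"
          using F by auto
        then have "cmod (of_int n * b n) = cmod (d n) / pi"
          by (simp add: b_def norm_mult norm_divide)
        also have "\<dots> \<le> cmod (d n)"
          using pi_gt3 by (simp add: divide_le_eq mult_le_cancel_left1)
        finally show "(cmod (of_int n * b n))\<^sup>2 \<le> (cmod (d n))\<^sup>2"
          by (intro power_mono) auto
      qed
      also have "\<dots> \<le> integral {c..c + 2} (\<lambda>s. (g s)\<^sup>2) / 2"
        unfolding d_def by (rule Bessel_inequality[OF g F(2)])
      finally show ?thesis .
    qed
    then show "bdd_above (sum (\<lambda>n. (cmod (of_int n * b n))\<^sup>2) ` {F. F \<subseteq> UNIV - {0} \<and> finite F})"
      by (intro bdd_aboveI2[where M = "integral {c..c + 2} (\<lambda>s. (g s)\<^sup>2) / 2"]) auto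
  qed auto
  have has_sum: "((\<lambda>n. b n * (trig n s - trig n c)) has_sum of_real (h s - h c)) (UNIV - {0})" if s: "s \<in> {c..c + 2}" for s
  proof (rule has_sum_of_symmetric_partial_sums)
    have "(\<lambda>n. norm (2 * b n)) summable_on (UNIV - {0})"
      using summable_on_cmult_right[OF coeff_abs_summable[OF summable], of 2] by (simp add: norm_mult)
    then have "(\<lambda>n. norm (b n * (trig n s - trig n c))) summable_on (UNIV - {0})"
    proof (rule Infinite_Sum.abs_summable_on_comparison_test)
      fix n
      have "cmod (trig n s - trig n c) \<le> 2"
        using norm_triangle_ineq4[of "trig n s" "trig n c"] by simp
      then show "norm (b n * (trig n s - trig n c)) \<le> norm (2 * b n)"
        using mult_left_mono[of "cmod (trig n s - trig n c)" 2 "cmod (b n)"] by (simp add: norm_mult mult.commute)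
    qed
    then show "(\<lambda>n. b n * (trig n s - trig n c)) summable_on (UNIV - {0})"
      by (rule Infinite_Sum.abs_summable_summable)
    define r where "r = (\<lambda>N s. cmod (S N s - of_real (g s)))"
    have r: "L2_on {c..c + 2} (r N)" for N
      unfolding r_def by (rule L2_on_cmod_difference[OF g S])
    have gs: "(\<lambda>s. complex_of_real (g s)) integrable_on {c..s}"
      "integral {c..s} (\<lambda>s. complex_of_real (g s)) = of_real (h s - h c)"
    proof -
      have "g integrable_on {c..s}"
        using s by (intro L2_on_integrable L2_on_subinterval[OF g]) auto
      from integrable_linear[OF this bounded_linear_of_real[where 'a = complex]]
        integral_linear[OF this bounded_linear_of_real[where 'a = complex]] h[OF s]
      show "(\<lambda>s. complex_of_real (g s)) integrable_on {c..s}"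
        "integral {c..s} (\<lambda>s. complex_of_real (g s)) = of_real (h s - h c)"
        by (simp_all add: o_def)
    qed
    have partial: "(\<Sum>n\<in>{- int N..int N} - {0}. b n * (trig n s - trig n c)) = integral {c..s} (S N)" for N
    proof -
      have "((\<lambda>s. \<Sum>n\<in>{- int N..int N} - {0}. d n * trig n s) has_integral
          (\<Sum>n\<in>{- int N..int N} - {0}. d n * ((trig n s - trig n c) / (of_int n * of_real pi * \<i>)))) {c..s}"
        using s by (intro has_integral_sum has_integral_mult_right trig_has_integral) auto
      moreover have "(\<lambda>s. \<Sum>n\<in>{- int N..int N} - {0}. d n * trig n s) = S N"
        unfolding S_def using d0 by (intro ext sum.mono_neutral_left) auto
      ultimately show ?thesis
        by (simp add: integral_unique b_def)
    qed
    have bound: "norm (integral {c..s} (S N) - of_real (h s - h c)) \<le> sqrt 2 * sqrt (integral {c..c + 2} (\<lambda>s. (r N s)\<^sup>2))" for N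
    proof -
      have Sint: "S N integrable_on {c..s}"
        by (intro integrable_continuous_interval S)
      have "norm (integral {c..s} (\<lambda>s. S N s - of_real (g s))) \<le> integral {c..s} (r N)"
      proof (rule integral_norm_bound_integral)
        show "(\<lambda>s. S N s - of_real (g s)) integrable_on {c..s}"
          by (intro integrable_diff Sint gs)
        show "r N integrable_on {c..s}"
          using s by (intro L2_on_integrable L2_on_subinterval[OF r]) auto
      qed (simp add: r_def)
      also have "\<dots> \<le> sqrt 2 * sqrt (integral {c..c + 2} (\<lambda>s. (r N s)\<^sup>2))"
        using integral_subinterval_L2_bound[OF r[of N], of c s] s by simp
      finally show ?thesis
        using Henstock_Kurzweil_Integration.integral_diff[OF Sint gs(1)] gs(2) by simp
    qed
    have "(\<lambda>N. sqrt 2 * sqrt (integral {c..c + 2} (\<lambda>s. (r N s)\<^sup>2))) \<longlonglongrightarrow> sqrt 2 * sqrt 0"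
      using conv unfolding r_def by (intro tendsto_intros)
    then have "(\<lambda>N. integral {c..s} (S N) - of_real (h s - h c)) \<longlonglongrightarrow> 0"
      by (intro Lim_null_comparison[OF always_eventually[OF allI[OF bound]]]) simp
    then show "(\<lambda>N. \<Sum>n\<in>{- int N..int N} - {0}. b n * (trig n s - trig n c)) \<longlonglongrightarrow> of_real (h s - h c)"
      unfolding partial by (simp add: LIM_zero_iff)
  qed
  show ?thesis
    by (rule that[OF summable has_sum]) (use conv in \<open>simp_all add: S_eq S_def\<close>)
qed

text \<open>A trigonometric series with absolutely summable coefficients that is constant on a period
  converges uniformly to that constant; integrating against a mode kills the constant and isolates
  one coefficient.\<close>

lemma trig_series_unique:
  assumes b: "(\<lambda>n. norm (b n)) summable_on (UNIV - {0})"
    and zero: "\<And>s. s \<in> {0..2} \<Longrightarrow> ((\<lambda>n. b n * (trig n s - 1)) has_sum 0) (UNIV - {0})"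
    and m: "m \<noteq> 0"
  shows "b m = 0"
proof -
  define C where "C = infsum b (UNIV - {0})"
  have sum_b: "(b has_sum C) (UNIV - {0})"
    unfolding C_def by (rule has_sum_infsum[OF Infinite_Sum.abs_summable_summable[OF b]])
  have C: "infsum (\<lambda>n. b n * trig n s) (UNIV - {0}) = C" if "s \<in> {0..2}" for s
    using has_sum_add[OF zero[OF that] sum_b] by (intro infsumI) (simp add: algebra_simps)
  have unif: "uniform_limit {0..2} (\<lambda>X s. \<Sum>n\<in>X. b n * trig n s) (\<lambda>s. infsum (\<lambda>n. b n * trig n s) (UNIV - {0})) (finite_subsets_at_top (UNIV - {0}))"
    by (rule Weierstrass_m_test_general[OF _ b]) (simp add: norm_mult)
  have "cmod (b m) \<le> e" if e: "e > 0" for e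
  proof -
    have "\<forall>\<^sub>F X in finite_subsets_at_top (UNIV - {0}). \<forall>s\<in>{0..2}. dist (\<Sum>n\<in>X. b n * trig n s) (infsum (\<lambda>n. b n * trig n s) (UNIV - {0})) < e"
      using uniform_limitD[OF unif e] .
    moreover have "\<forall>\<^sub>F X in finite_subsets_at_top (UNIV - {0}). finite X \<and> {m} \<subseteq> X \<and> X \<subseteq> UNIV - {0}"
      unfolding eventually_finite_subsets_at_top using m by (intro exI[of _ "{m}"]) auto
    ultimately have "\<forall>\<^sub>F X in finite_subsets_at_top (UNIV - {0}).
        (\<forall>s\<in>{0..2}. dist (\<Sum>n\<in>X. b n * trig n s) (infsum (\<lambda>n. b n * trig n s) (UNIV - {0})) < e) \<and> finite X \<and> {m} \<subseteq> X \<and> X \<subseteq> UNIV - {0}"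
      by (rule eventually_conj)
    then obtain X where X: "\<And>s. s \<in> {0..2} \<Longrightarrow> dist (\<Sum>n\<in>X. b n * trig n s) C < e" "finite X" "m \<in> X"
      using C by (force dest!: eventually_happens)
    have "((\<lambda>s. (\<Sum>n\<in>X. b n * trig (n - m) s) - C * trig (- m) s) has_integral
        ((\<Sum>n\<in>X. b n * (if n - m = 0 then 2 else 0)) - C * (if - m = 0 then 2 else 0))) {0..0 + 2}"
      by (intro has_integral_diff has_integral_sum X has_integral_mult_right trig_orthogonal)
    moreover have "(\<Sum>n\<in>X. b n * (if n - m = 0 then 2 else 0)) = (\<Sum>n\<in>X. if n = m then 2 * b m else 0)"
      by (intro sum.cong) auto
    ultimately have hi: "((\<lambda>s. (\<Sum>n\<in>X. b n * trig (n - m) s) - C * trig (- m) s) has_integral 2 * b m) {0..2}"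
      using X m by simp
    have "norm (2 * b m) \<le> e * measure lborel {0..2::real}"
    proof (rule has_integral_bound_real[OF _ finite.emptyI hi])
      fix s :: real assume "s \<in> {0..2} - {}"
      then have s: "s \<in> {0..2}"
        by simp
      have "trig (n - m) s = trig n s * trig (- m) s" for n
        using trig_mult[of n s "- m"] by simp
      then have "(\<Sum>n\<in>X. b n * trig (n - m) s) - C * trig (- m) s = ((\<Sum>n\<in>X. b n * trig n s) - C) * trig (- m) s"
        by (simp add: left_diff_distrib sum_distrib_right mult.assoc)
      then have "norm ((\<Sum>n\<in>X. b n * trig (n - m) s) - C * trig (- m) s) = dist (\<Sum>n\<in>X. b n * trig n s) C"
        by (simp add: norm_mult dist_norm)
      then show "norm ((\<Sum>n\<in>X. b n * trig (n - m) s) - C * trig (- m) s) \<le> e"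
        using X(1)[OF s] by simp
    qed (use e in auto)
    then show ?thesis
      by (simp add: norm_mult)
  qed
  then have "cmod (b m) \<le> 0"
    by (rule field_le_epsilon) simp
  then show ?thesis
    by simp
qed

section \<open>Periodic functions\<close>

lemma periodic_has_integral:
  fixes F :: "real \<Rightarrow> real"
  assumes per: "\<And>s. F (s + 2) = F s" and F: "(F has_integral I) {c..c + 2}"
  shows "(F has_integral real J * I) {c..c + 2 * real J}"
proof (induction J)
  case 0
  show ?case
    using has_integral_refl(2)[of F c] by simp
next
  case (Suc J)
  have per_n: "F (s + 2 * real n) = F s" for s n
  proof (induction n)
    case (Suc n)
    then show ?case using per[of "s + 2 * real n"] by (simp add: algebra_simps)
  qed simp
  have "(F \<circ> (+) (2 * real J)) = F"
    using per_n by (auto simp: fun_eq_iff add.commute)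
  then have "(F has_integral I) {c + 2 * real J..c + 2 + 2 * real J}"
    using has_integral_shift_Icc_real[of F "2 * real J" I c "c + 2"] F by simp
  from has_integral_combine[OF _ _ Suc this] show ?case
    by (simp add: algebra_simps)
qed

lemma periodic_L2_on:
  assumes per: "\<And>s. g (s + 2) = g s" and g: "L2_on {c..c + 2} g"
  shows "L2_on {c..c + 2 * real J} g"
  using periodic_has_integral[of g _ c J, OF per integrable_integral[OF L2_on_integrable[OF g]]]
    periodic_has_integral[of "\<lambda>s. (g s)\<^sup>2" _ c J, OF _ integrable_integral[OF L2_on_square[OF g]]] per
  by (intro L2_onI_integrable) auto

lemma periodic_shift:
  fixes f :: "real \<Rightarrow> 'b"
  assumes per: "\<And>s. f (s + 2) = f s"
  shows "f (s - 2 * of_int k) = f s"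
proof -
  have nat: "f (s + 2 * real n) = f s" for s n
  proof (induction n)
    case (Suc n)
    then show ?case using per[of "s + 2 * real n"] by (simp add: algebra_simps)
  qed simp
  show ?thesis
  proof (cases k rule: int_cases2)
    case (nonneg n)
    then show ?thesis using nat[of "s - 2 * real n" n] by simp
  next
    case (nonpos n)
    then show ?thesis using nat[of s n] by simp
  qed
qed

lemma has_sum_difference:
  fixes f g :: "'a \<Rightarrow> complex"
  assumes "(f has_sum a) A" "(g has_sum b) A"
  shows "((\<lambda>x. f x - g x) has_sum (a - b)) A"
  using has_sum_add[OF assms(1), of "\<lambda>x. - g x" "- b"] assms(2) by (simp add: has_sum_uminus)

section \<open>The derivative of the profile, the energy and the series\<close>

context string_profile
begin

text \<open>On the period \<open>[-(1 + v), 1 - v]\<close> the derivative of \<open>H\<close> is given by the initial data: on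
  \<open>[-(1 + v), 0]\<close> by the right-moving wave, a function of \<open>t - x\<close>, and on \<open>[0, 1 - v]\<close> by the
  left-moving wave.\<close>

definition left_moving :: "real \<Rightarrow> real" where "left_moving x = (\<phi>x x 0 + \<phi>t x 0) / 2"
definition right_moving :: "real \<Rightarrow> real" where "right_moving x = (\<phi>x x 0 - \<phi>t x 0) / 2"

definition period_deriv :: "real \<Rightarrow> real" where
  "period_deriv s = (if s < 0 then L / (1 + v) * right_moving (L / (1 + v) * (- s))
     else L / (1 - v) * left_moving (L / (1 - v) * s))"

definition H_deriv :: "real \<Rightarrow> real" where
  "H_deriv s = period_deriv (s - 2 * of_int \<lfloor>(s + (1 + v)) / 2\<rfloor>)"

lemma H_deriv_periodic: "H_deriv (s + 2) = H_deriv s"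
proof -
  have "(s + 2 + (1 + v)) / 2 = (s + (1 + v)) / 2 + 1"
    by (simp add: field_simps)
  then have "\<lfloor>(s + 2 + (1 + v)) / 2\<rfloor> = \<lfloor>(s + (1 + v)) / 2\<rfloor> + 1"
    by (simp only: one_add_floor)
  then show ?thesis
    by (simp add: H_deriv_def algebra_simps)
qed

lemma H_deriv_base:
  assumes "- (1 + v) \<le> s" "s < 1 - v"
  shows "H_deriv s = period_deriv s"
proof -
  have "\<lfloor>(s + (1 + v)) / 2\<rfloor> = 0"
    using assms by (simp add: floor_eq_iff)
  then show ?thesis
    by (simp add: H_deriv_def)
qed

lemma waves_L2: "L2_on {0..L} left_moving" "L2_on {0..L} right_moving"
  using L2_on_cmult[OF L2_on_add[OF initial_data_L2], of "1/2"]
    L2_on_cmult[OF L2_on_diff[OF initial_data_L2], of "1/2"]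
  by (simp_all add: left_moving_def[abs_def] right_moving_def[abs_def])

lemma rescaled_integrals:
  fixes f :: "real \<Rightarrow> real"
  assumes m: "0 < m"
  shows "integral {0..s} (\<lambda>s. m * f (m * s)) = integral {0..m * s} f"
    and "integral {0..s} (\<lambda>s. (m * f (m * s))\<^sup>2) = m * integral {0..m * s} (\<lambda>x. (f x)\<^sup>2)"
    and "integral {- s..0} (\<lambda>s. m * f (m * (- s))) = integral {0..m * s} f"
    and "integral {- s..0} (\<lambda>s. (m * f (m * (- s)))\<^sup>2) = m * integral {0..m * s} (\<lambda>x. (f x)\<^sup>2)"
proof -
  show 1: "integral {0..s} (\<lambda>s. m * f (m * s)) = integral {0..m * s} f"
    using integral_affine[where m = m and f = f and k = 0 and a = 0 and b = s] m by simp
  show 2: "integral {0..s} (\<lambda>s. (m * f (m * s))\<^sup>2) = m * integral {0..m * s} (\<lambda>x. (f x)\<^sup>2)"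
    unfolding power_mult_distrib integral_mult_right
    using integral_affine[where m = m and f = "\<lambda>x. (f x)\<^sup>2" and k = 0 and a = 0 and b = s] m
    by (simp add: power2_eq_square[of m])
  show "integral {- s..0} (\<lambda>s. m * f (m * (- s))) = integral {0..m * s} f"
    using 1 Henstock_Kurzweil_Integration.integral_reflect_real[where f = "\<lambda>s. m * f (m * s)" and a = 0 and b = s]
    by simp
  show "integral {- s..0} (\<lambda>s. (m * f (m * (- s)))\<^sup>2) = m * integral {0..m * s} (\<lambda>x. (f x)\<^sup>2)"
    using 2 Henstock_Kurzweil_Integration.integral_reflect_real[where f = "\<lambda>s. (m * f (m * s))\<^sup>2" and a = 0 and b = s]
    by simp
qed

lemma scale_pos: "0 < L / (1 - v)" "0 < L / (1 + v)"
  using L v by auto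

lemma H_deriv_L2_halves: "L2_on {- (1 + v)..0} H_deriv" "L2_on {0..1 - v} H_deriv"
proof -
  have "L2_on {0..1 + v} (\<lambda>s. L / (1 + v) * right_moving (L / (1 + v) * s + 0))"
    using L v waves_L2 by (intro L2_on_cmult L2_on_affine) auto
  from L2_on_reflect[OF this]
  have "L2_on {- (1 + v)..0} (\<lambda>s. L / (1 + v) * right_moving (L / (1 + v) * (- s)))"
    by simp
  then show "L2_on {- (1 + v)..0} H_deriv"
    by (rule L2_on_cong) (use v in \<open>simp_all add: H_deriv_base period_deriv_def\<close>)
  have "L2_on {0..1 - v} (\<lambda>s. L / (1 - v) * left_moving (L / (1 - v) * s + 0))"
    using L v waves_L2 by (intro L2_on_cmult L2_on_affine) auto
  then show "L2_on {0..1 - v} H_deriv"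
    by (rule L2_on_cong) (use v in \<open>simp_all add: H_deriv_base period_deriv_def\<close>)
qed

lemma H_deriv_L2: "L2_on {- (1 + v)..- (1 + v) + 2} H_deriv"
  using L2_on_combine[OF _ _ H_deriv_L2_halves] v by simp

lemma H_deriv_integrals:
  shows "0 \<le> s \<Longrightarrow> s \<le> 1 - v \<Longrightarrow> integral {0..s} H_deriv = integral {0..L / (1 - v) * s} left_moving"
    and "0 \<le> s \<Longrightarrow> s \<le> 1 + v \<Longrightarrow> integral {- s..0} H_deriv = integral {0..L / (1 + v) * s} right_moving"
    and "integral {0..1 - v} (\<lambda>s. (H_deriv s)\<^sup>2) = L / (1 - v) * integral {0..L} (\<lambda>x. (left_moving x)\<^sup>2)"
    and "integral {- (1 + v)..0} (\<lambda>s. (H_deriv s)\<^sup>2) = L / (1 + v) * integral {0..L} (\<lambda>x. (right_moving x)\<^sup>2)"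
proof -
  have right: "H_deriv s = L / (1 - v) * left_moving (L / (1 - v) * s)" if "s \<in> {0..1 - v} - {1 - v}" for s
    using that v by (auto simp: H_deriv_base period_deriv_def)
  have left: "H_deriv s = L / (1 + v) * right_moving (L / (1 + v) * (- s))" if "s \<in> {- (1 + v)..0} - {0}" for s
    using that v by (auto simp: H_deriv_base period_deriv_def)
  show "integral {0..s} H_deriv = integral {0..L / (1 - v) * s} left_moving" if "0 \<le> s" "s \<le> 1 - v"
    unfolding rescaled_integrals(1)[OF scale_pos(1), symmetric]
    by (rule integral_spike[of "{1 - v}"]) (use that right in auto)
  show "integral {- s..0} H_deriv = integral {0..L / (1 + v) * s} right_moving" if "0 \<le> s" "s \<le> 1 + v"
    unfolding rescaled_integrals(3)[OF scale_pos(2), symmetric]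
    by (rule integral_spike[of "{0}"]) (use that left in auto)
  have "integral {0..1 - v} (\<lambda>s. (H_deriv s)\<^sup>2) = integral {0..1 - v} (\<lambda>s. (L / (1 - v) * left_moving (L / (1 - v) * s))\<^sup>2)"
    by (rule integral_spike[of "{1 - v}"]) (use right in auto)
  then show "integral {0..1 - v} (\<lambda>s. (H_deriv s)\<^sup>2) = L / (1 - v) * integral {0..L} (\<lambda>x. (left_moving x)\<^sup>2)"
    using rescaled_integrals(2)[OF scale_pos(1), where s = "1 - v" and f = left_moving] v by simp
  have "integral {- (1 + v)..0} (\<lambda>s. (H_deriv s)\<^sup>2) = integral {- (1 + v)..0} (\<lambda>s. (L / (1 + v) * right_moving (L / (1 + v) * (- s)))\<^sup>2)"
    by (rule integral_spike[of "{0}"]) (use left in auto)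
  then show "integral {- (1 + v)..0} (\<lambda>s. (H_deriv s)\<^sup>2) = L / (1 + v) * integral {0..L} (\<lambda>x. (right_moving x)\<^sup>2)"
    using rescaled_integrals(4)[OF scale_pos(2), where s = "1 + v" and f = right_moving] v by simp
qed

lemma H_eq_integral:
  assumes s: "s \<in> {- (1 + v)..- (1 + v) + 2}"
  shows "H s = H (- (1 + v)) + integral {- (1 + v)..s} H_deriv"
proof -
  have pos: "H s = integral {0..s} H_deriv" if "0 \<le> s" "s \<le> 1 - v" for s
  proof -
    have x: "L / (1 - v) * s \<in> {0..L}"
      using that L v by (auto simp: divide_le_eq mult_left_mono)
    have "H s = Hr (L / (1 - v) * s)"
      using L v by (simp add: Hr_def)
    also have "\<dots> = integral {0..s} H_deriv"
      unfolding profile_eq_integral(1)[OF x] H_deriv_integrals(1)[OF that] left_moving_def[abs_def] by simp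
    finally show ?thesis .
  qed
  have neg: "H (- s) = - integral {- s..0} H_deriv" if "0 \<le> s" "s \<le> 1 + v" for s
  proof -
    have x: "L / (1 + v) * s \<in> {0..L}"
      using that L v by (auto simp: divide_le_eq mult_left_mono)
    have "H (- s) = Hl (- (L / (1 + v) * s))"
      using L v by (simp add: Hl_def)
    also have "\<dots> = integral {0..L / (1 + v) * s} (\<lambda>x. - right_moving x)"
    proof -
      have "(\<lambda>x. (\<phi>t x 0 - \<phi>x x 0) / 2) = (\<lambda>x. - right_moving x)"
        by (simp add: fun_eq_iff right_moving_def field_simps)
      then show ?thesis
        using profile_eq_integral(2)[OF x] by (simp only:)
    qed
    also have "\<dots> = - integral {- s..0} H_deriv"
      unfolding H_deriv_integrals(2)[OF that] by simp
    finally show ?thesis .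
  qed
  have combine: "integral {- (1 + v)..a} H_deriv + integral {a..b} H_deriv = integral {- (1 + v)..b} H_deriv"
    if "- (1 + v) \<le> a" "a \<le> b" "b \<le> - (1 + v) + 2" for a b
    using that by (intro Henstock_Kurzweil_Integration.integral_combine L2_on_integrable
        L2_on_subinterval[OF H_deriv_L2]) auto
  show ?thesis
  proof (cases "0 \<le> s")
    case True
    then show ?thesis
      using combine[of 0 s] pos[of s] neg[of "1 + v"] s v by simp
  next
    case False
    then show ?thesis
      using combine[of s 0] neg[of "- s"] neg[of "1 + v"] s v by simp
  qed
qed

text \<open>In terms of the two waves the energy density is \<open>(1 + v)\<close> times the square of the left-moving one
  plus \<open>(1 - v)\<close> times the square of the right-moving one, without a cross term.\<close>

lemma energy_eq_H_deriv:
  "energy L v \<phi>x \<phi>t 0 = (1 - v\<^sup>2) / L * integral {- (1 + v)..- (1 + v) + 2} (\<lambda>s. (H_deriv s)\<^sup>2)"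
proof -
  have int: "(\<lambda>x. (left_moving x)\<^sup>2) integrable_on {0..L}" "(\<lambda>x. (right_moving x)\<^sup>2) integrable_on {0..L}"
    by (intro L2_on_square waves_L2)+
  have "energy L v \<phi>x \<phi>t 0 = 1 / 2 * integral {0..L} (\<lambda>x. 2 * (1 + v) * (left_moving x)\<^sup>2 + 2 * (1 - v) * (right_moving x)\<^sup>2)"
  proof -
    have "(\<phi>t x 0 + v * \<phi>x x 0)\<^sup>2 + (1 - v\<^sup>2) * (\<phi>x x 0)\<^sup>2 = 2 * (1 + v) * (left_moving x)\<^sup>2 + 2 * (1 - v) * (right_moving x)\<^sup>2" for x
      by (simp add: left_moving_def right_moving_def power2_eq_square field_simps)
    then show ?thesis
      by (simp add: energy_def)
  qed
  also have "\<dots> = (1 + v) * integral {0..L} (\<lambda>x. (left_moving x)\<^sup>2) + (1 - v) * integral {0..L} (\<lambda>x. (right_moving x)\<^sup>2)"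
    unfolding Henstock_Kurzweil_Integration.integral_add[OF integrable_on_mult_right[OF int(1)]
        integrable_on_mult_right[OF int(2)]] integral_mult_right
    by (simp add: algebra_simps)
  also have "\<dots> = (1 - v\<^sup>2) / L * (integral {- (1 + v)..0} (\<lambda>s. (H_deriv s)\<^sup>2) + integral {0..1 - v} (\<lambda>s. (H_deriv s)\<^sup>2))"
  proof -
    have "1 - v\<^sup>2 = (1 - v) * (1 + v)"
      by (simp add: power2_eq_square algebra_simps)
    then have "(1 - v\<^sup>2) / L * (L / (1 + v)) = 1 - v" "(1 - v\<^sup>2) / L * (L / (1 - v)) = 1 + v"
      using L v by simp_all
    then show ?thesis
      unfolding H_deriv_integrals(3,4) distrib_left mult.assoc[symmetric] by simp
  qed
  also have "integral {- (1 + v)..0} (\<lambda>s. (H_deriv s)\<^sup>2) + integral {0..1 - v} (\<lambda>s. (H_deriv s)\<^sup>2)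
      = integral {- (1 + v)..- (1 + v) + 2} (\<lambda>s. (H_deriv s)\<^sup>2)"
    using v Henstock_Kurzweil_Integration.integral_combine[OF _ _ L2_on_square[OF H_deriv_L2], of 0] by simp
  finally show ?thesis .
qed

lemma mode_eq_trig: "mode L v n x t = trig n ((1 - v) * (t + x) / L) - trig n ((1 + v) * (t - x) / L)"
  by (simp add: mode_def trig_def)

text \<open>The primitive of the Fourier series of \<open>H'\<close> represents \<open>\<phi>\<close>, so a representation exists; two of them
  differ by a series that vanishes on the characteristic \<open>x = t\<close>, hence by zero.\<close>

lemma series_coeff_properties:
  defines "b \<equiv> series_coeff L v \<phi>"
  shows "(\<lambda>N. integral {- (1 + v)..- (1 + v) + 2} (\<lambda>s. (cmod ((\<Sum>n\<in>{- int N..int N} - {0}.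
      b n * (of_int n * of_real pi * \<i>) * trig n s) - of_real (H_deriv s)))\<^sup>2)) \<longlonglongrightarrow> 0"
proof -
  define c where "c = - (1 + v)"
  obtain a where a: "(\<lambda>n. (cmod (of_int n * a n))\<^sup>2) summable_on (UNIV - {0})"
    and a_sum: "\<And>s. s \<in> {c..c + 2} \<Longrightarrow> ((\<lambda>n. a n * (trig n s - trig n c)) has_sum of_real (H s - H c)) (UNIV - {0})"
    and a_conv: "(\<lambda>N. integral {c..c + 2} (\<lambda>s. (cmod ((\<Sum>n\<in>{- int N..int N} - {0}.
      a n * (of_int n * of_real pi * \<i>) * trig n s) - of_real (H_deriv s)))\<^sup>2)) \<longlonglongrightarrow> 0"
  proof (rule trig_series_of_primitive)
    show "L2_on {c..c + 2} H_deriv"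
      unfolding c_def by (rule H_deriv_L2)
    show "H s = H c + integral {c..s} H_deriv" if "s \<in> {c..c + 2}" for s
      using that unfolding c_def by (rule H_eq_integral)
    show "H (c + 2) = H c"
      by (rule H_periodic)
  qed blast
  have all: "((\<lambda>n. a n * (trig n s - trig n c)) has_sum of_real (H s - H c)) (UNIV - {0})" for s
  proof -
    define s' where "s' = s - 2 * of_int \<lfloor>(s - c) / 2\<rfloor>"
    have "s' \<in> {c..c + 2}"
      unfolding s'_def using floor_correct[of "(s - c) / 2"] by (simp add: field_simps)
    moreover have "trig n s' = trig n s" "H s' = H s" for n
      unfolding s'_def by (intro periodic_shift trig_periodic H_periodic)+
    ultimately show ?thesis
      using a_sum[of s'] by simp
  qed
  have "series_rep L v \<phi> a"
    unfolding series_rep_def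
  proof (intro conjI a allI impI ballI)
    fix t x assume "0 \<le> t" "x \<in> {v * t..L + v * t}"
    then show "((\<lambda>n. a n * mode L v n x t) has_sum of_real (\<phi> x t)) (UNIV - {0})"
      using has_sum_difference[OF all[of "(1 - v) * (t + x) / L"] all[of "(1 + v) * (t - x) / L"]]
      by (simp add: phi_eq_H mode_eq_trig right_diff_distrib)
  qed
  then have b: "series_rep L v \<phi> b"
    unfolding b_def series_coeff_def by (rule someI[of "series_rep L v \<phi>"])
  have "b n = a n" if n: "n \<noteq> 0" for n
  proof -
    have "(\<lambda>n. norm (b n - a n)) summable_on (UNIV - {0})"
    proof -
      have "(\<lambda>n. norm (b n) + norm (a n)) summable_on (UNIV - {0})"
        using b a by (intro summable_on_add coeff_abs_summable) (auto simp: series_rep_def)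
      then have "(\<lambda>n. norm (norm (b n) + norm (a n))) summable_on (UNIV - {0})"
        by simp
      then show ?thesis
        by (rule Infinite_Sum.abs_summable_on_comparison_test) (simp add: norm_triangle_ineq4)
    qed
    then have "b n - a n = 0"
    proof (rule trig_series_unique[OF _ _ n])
      \<comment> \<open>Along the characteristic \<open>x = t\<close> the second exponential in each mode is \<open>1\<close>.\<close>
      fix s :: real assume s: "s \<in> {0..2}"
      define t where "t = (L * s / 2) / (1 - v)"
      have vt: "(1 - v) * t = L * s / 2"
      proof -
        have "(1 - v) * (y / (1 - v)) = y" for y
          using v by simp
        then show ?thesis
          by (simp only: t_def)
      qed
      have t: "0 \<le> t" "v * t \<le> t" "t \<le> L + v * t"
      proof -
        show "0 \<le> t"
          using s L v by (simp add: t_def)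
        then show "v * t \<le> t"
          using v mult_right_mono[of v 1 t] by simp
        have "(1 - v) * t \<le> L"
          using s L by (simp add: vt)
        then show "t \<le> L + v * t"
          by (simp add: algebra_simps)
      qed
      have "(1 - v) * (t + t) / L = s"
        unfolding distrib_left vt using L by simp
      then have modes: "mode L v n t t = trig n s - 1" for n
        by (simp add: mode_eq_trig)
      have "((\<lambda>n. r n * (trig n s - 1)) has_sum of_real (\<phi> t t)) (UNIV - {0})" if "series_rep L v \<phi> r" for r
      proof -
        have "((\<lambda>n. r n * mode L v n t t) has_sum of_real (\<phi> t t)) (UNIV - {0})"
          using that t by (simp add: series_rep_def)
        then show ?thesis
          by (simp only: modes)
      qed
      from has_sum_difference[OF this[OF b] this[OF \<open>series_rep L v \<phi> a\<close>]]
      show "((\<lambda>n. (b n - a n) * (trig n s - 1)) has_sum 0) (UNIV - {0})"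
        by (simp add: left_diff_distrib)
    qed
    then show ?thesis
      by simp
  qed
  then have "(\<Sum>n\<in>{- int N..int N} - {0}. b n * (of_int n * of_real pi * \<i>) * trig n s)
      = (\<Sum>n\<in>{- int N..int N} - {0}. a n * (of_int n * of_real pi * \<i>) * trig n s)" for N s
    by (intro sum.cong) auto
  then show ?thesis
    using a_conv by (simp add: c_def)
qed

section \<open>Boundary traces\<close>

lemma mode_vector_derivative:
  "vector_derivative (\<lambda>x. mode L v n x t) (at x) = of_int n * of_real pi * \<i> *
     (of_real ((1 - v) / L) * trig n ((1 - v) * (t + x) / L) + of_real ((1 + v) / L) * trig n ((1 + v) * (t - x) / L))"
proof -
  define F where "F = (\<lambda>z. exp (of_int n * of_real pi * \<i> * (of_real (1 - v) * (of_real t + z) / of_real L))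
    - exp (of_int n * of_real pi * \<i> * (of_real (1 + v) * (of_real t - z) / of_real L)))"
  have "(F has_field_derivative of_int n * of_real pi * \<i> *
     (of_real ((1 - v) / L) * trig n ((1 - v) * (t + x) / L) + of_real ((1 + v) / L) * trig n ((1 + v) * (t - x) / L))) (at (of_real x))"
    unfolding F_def trig_def using L by (auto intro!: derivative_eq_intros simp: field_simps)
  from has_vector_derivative_real_field[OF this]
  have "((\<lambda>x. mode L v n x t) has_vector_derivative of_int n * of_real pi * \<i> *
     (of_real ((1 - v) / L) * trig n ((1 - v) * (t + x) / L) + of_real ((1 + v) / L) * trig n ((1 + v) * (t - x) / L))) (at x)"
    by (simp add: F_def mode_def)
  then show ?thesis
    by (rule vector_derivative_at)
qed

text \<open>Along a boundary curve both phases agree up to a multiple of the period, so the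
  differentiated series is the Fourier series of \<open>H'\<close>, read at the speed \<open>(1 - v\<^sup>2)/L\<close>. The trace is
  determined almost everywhere as a limit in mean square, which fixes the integral of its square.\<close>

lemma trace_square_integral:
  assumes phase: "\<And>t. (1 - v) * (t + \<gamma> t) / L = (1 - v\<^sup>2) / L * t + k"
    and phase': "\<And>n t. trig n ((1 + v) * (t - \<gamma> t) / L) = trig n ((1 - v\<^sup>2) / L * t + k)"
    and k: "- (1 + v) \<le> k" and T: "0 < T"
  shows "L2_on {0..T} (dx_trace L v \<phi> \<gamma>)"
    and "integral {0..T} (\<lambda>t. (dx_trace L v \<phi> \<gamma> t)\<^sup>2) =
      4 / (L * (1 - v\<^sup>2)) * integral {k..(1 - v\<^sup>2) / L * T + k} (\<lambda>s. (H_deriv s)\<^sup>2)"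
proof -
  define c where "c = - (1 + v)"
  define m where "m = (1 - v\<^sup>2) / L"
  have "v\<^sup>2 < 1"
    using v mult_strict_mono[of v 1 v 1] by (simp add: power2_eq_square)
  then have m: "0 < m"
    using L by (simp add: m_def)
  define b where "b = series_coeff L v \<phi>"
  define S where "S = (\<lambda>N s. \<Sum>n\<in>{- int N..int N} - {0}. b n * (of_int n * of_real pi * \<i>) * trig n s)"
  define r where "r = (\<lambda>N s. cmod (S N s - of_real (H_deriv s)))"
  define D where "D = (\<lambda>N t. \<Sum>n\<in>{- int N..int N} - {0}. b n * vector_derivative (\<lambda>x. mode L v n x t) (at (\<gamma> t)))"
  have D: "D N t = of_real (2 / L) * S N (m * t + k)" for N t
  proof -
    have "vector_derivative (\<lambda>x. mode L v n x t) (at (\<gamma> t)) = of_real (2 / L) * (of_int n * of_real pi * \<i> * trig n (m * t + k))" for n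
      unfolding mode_vector_derivative phase phase' m_def[symmetric]
      using L by (simp add: field_simps)
    then show ?thesis
      by (simp add: D_def S_def sum_distrib_left mult_ac)
  qed
  have S: "continuous_on A (S N)" for N A
    unfolding S_def by (intro continuous_intros)
  have Sp: "S N (s + 2) = S N s" for N s
    by (simp add: S_def trig_periodic)
  have L2: "L2_on {c..c + 2} H_deriv"
    using H_deriv_L2 by (simp add: c_def)
  have r: "L2_on {c..c + 2} (r N)" for N
    unfolding r_def by (rule L2_on_cmod_difference[OF L2 S])
  have rp: "r N (s + 2) = r N s" for N s
    by (simp add: r_def Sp H_deriv_periodic)
  have conv: "(\<lambda>N. integral {c..c + 2} (\<lambda>s. (r N s)\<^sup>2)) \<longlonglongrightarrow> 0"
    using series_coeff_properties by (simp add: r_def S_def b_def c_def)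
  define h where "h = (\<lambda>t. 2 / L * H_deriv (m * t + k))"
  have range: "\<exists>J. {k..m * T + k} \<subseteq> {c..c + 2 * real J}" for T
  proof -
    obtain J :: nat where "m * T + k - c \<le> real J"
      using real_arch_simple by blast
    then show ?thesis
      using k by (intro exI[of _ J]) (auto simp: c_def)
  qed
  have h: "L2_on {0..T} h" if "0 < T" for T
  proof -
    obtain J where J: "{k..m * T + k} \<subseteq> {c..c + 2 * real J}"
      using range by blast
    have "L2_on {m * 0 + k..m * T + k} H_deriv"
      using L2_on_subinterval[OF periodic_L2_on[OF H_deriv_periodic L2] J] by simp
    then show ?thesis
      unfolding h_def by (intro L2_on_cmult L2_on_affine[OF m])
  qed
  have Dh: "(\<lambda>N. integral {0..T} (\<lambda>t. (cmod (D N t - of_real (h t)))\<^sup>2)) \<longlonglongrightarrow> 0" if "0 < T" for T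
  proof -
    obtain J where J: "{k..m * T + k} \<subseteq> {c..c + 2 * real J}"
      using range by blast
    have eq: "integral {0..T} (\<lambda>t. (cmod (D N t - of_real (h t)))\<^sup>2) = (2 / L)\<^sup>2 / m * integral {k..m * T + k} (\<lambda>s. (r N s)\<^sup>2)" for N
    proof -
      have "(cmod (D N t - of_real (h t)))\<^sup>2 = (2 / L)\<^sup>2 * (r N (m * t + k))\<^sup>2" for t
      proof -
        have "D N t - of_real (h t) = of_real (2 / L) * (S N (m * t + k) - of_real (H_deriv (m * t + k)))"
          by (simp add: D h_def right_diff_distrib)
        then show ?thesis
          using L by (simp only: norm_mult r_def power_mult_distrib norm_of_real power2_abs)
      qed
      then show ?thesis
        using integral_affine[where m = m and f = "\<lambda>s. (r N s)\<^sup>2" and k = k and a = 0 and b = T] m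
        by (simp add: divide_inverse mult_ac)
    qed
    have le: "integral {k..m * T + k} (\<lambda>s. (r N s)\<^sup>2) \<le> real J * integral {c..c + 2} (\<lambda>s. (r N s)\<^sup>2)" for N
    proof -
      have "((\<lambda>s. (r N s)\<^sup>2) has_integral real J * integral {c..c + 2} (\<lambda>s. (r N s)\<^sup>2)) {c..c + 2 * real J}"
        by (rule periodic_has_integral) (simp_all add: rp integrable_integral[OF L2_on_square[OF r]])
      then show ?thesis
        using integral_subset_le[OF J, of "\<lambda>s. (r N s)\<^sup>2"]
          integrable_on_subinterval[of "\<lambda>s. (r N s)\<^sup>2" "{c..c + 2 * real J}", OF _ J]
        by (simp add: has_integral_iff)
    qed
    have nonneg: "0 \<le> integral {k..m * T + k} (\<lambda>s. (r N s)\<^sup>2)" for N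
      by (cases "(\<lambda>s. (r N s)\<^sup>2) integrable_on {k..m * T + k}")
        (auto intro: integral_nonneg simp: not_integrable_integral)
    have "(\<lambda>N. (2 / L)\<^sup>2 / m * (real J * integral {c..c + 2} (\<lambda>s. (r N s)\<^sup>2))) \<longlonglongrightarrow> (2 / L)\<^sup>2 / m * (real J * 0)"
      by (intro tendsto_intros conv)
    then have upper: "(\<lambda>N. (2 / L)\<^sup>2 / m * (real J * integral {c..c + 2} (\<lambda>s. (r N s)\<^sup>2))) \<longlonglongrightarrow> 0"
      by simp
    have "0 \<le> (2 / L)\<^sup>2 / m"
      using m by simp
    note bounds = mult_nonneg_nonneg[OF this nonneg] mult_left_mono[OF le this]
    show ?thesis
      unfolding eq
      by (rule tendsto_sandwich[OF always_eventually[OF allI[OF bounds(1)]]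
            always_eventually[OF allI[OF bounds(2)]] tendsto_const upper])
  qed
  have "is_dx_trace L v \<phi> \<gamma> h"
    unfolding is_dx_trace_def using h Dh by (auto simp: D_def b_def)
  then have tr: "is_dx_trace L v \<phi> \<gamma> (dx_trace L v \<phi> \<gamma>)"
    unfolding dx_trace_def by (rule someI[of "is_dx_trace L v \<phi> \<gamma>"])
  define g where "g = dx_trace L v \<phi> \<gamma>"
  have g: "L2_on {0..T} g"
    and Dg: "(\<lambda>N. integral {0..T} (\<lambda>t. (cmod (D N t - of_real (g t)))\<^sup>2)) \<longlonglongrightarrow> 0"
    using tr T by (auto simp: is_dx_trace_def g_def D_def b_def)
  show "L2_on {0..T} (dx_trace L v \<phi> \<gamma>)"
    using g by (simp add: g_def)
  have contD: "continuous_on {0..T} (D N)" for N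
    unfolding D by (intro continuous_intros continuous_on_compose2[OF S[of UNIV]]) auto
  note h = h[OF T] and Dh = Dh[OF T]
  have zero: "integral {0..T} (\<lambda>t. (g t - h t)\<^sup>2) = 0"
  proof -
    have "integral {0..T} (\<lambda>t. (g t - h t)\<^sup>2) \<le> 2 * integral {0..T} (\<lambda>t. (cmod (D N t - of_real (g t)))\<^sup>2)
        + 2 * integral {0..T} (\<lambda>t. (cmod (D N t - of_real (h t)))\<^sup>2)" for N
    proof -
      note sq = L2_on_square[OF L2_on_cmod_difference[OF g contD]] L2_on_square[OF L2_on_cmod_difference[OF h contD]]
      have "integral {0..T} (\<lambda>t. (g t - h t)\<^sup>2) \<le> integral {0..T} (\<lambda>t. 2 * (cmod (D N t - of_real (g t)))\<^sup>2 + 2 * (cmod (D N t - of_real (h t)))\<^sup>2)"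
      proof (rule integral_le)
        show "(\<lambda>t. (g t - h t)\<^sup>2) integrable_on {0..T}"
          by (intro L2_on_square L2_on_diff g h)
        show "(\<lambda>t. 2 * (cmod (D N t - of_real (g t)))\<^sup>2 + 2 * (cmod (D N t - of_real (h t)))\<^sup>2) integrable_on {0..T}"
          by (intro integrable_add integrable_on_mult_right sq)
        show "(g t - h t)\<^sup>2 \<le> 2 * (cmod (D N t - of_real (g t)))\<^sup>2 + 2 * (cmod (D N t - of_real (h t)))\<^sup>2" for t
        proof -
          define u w where "u = cmod (D N t - of_real (g t))" and "w = cmod (D N t - of_real (h t))"
          have "\<bar>g t - h t\<bar> = cmod (of_real (g t) - of_real (h t))"
            by (metis norm_of_real of_real_diff)
          also have "\<dots> \<le> u + w"
            using norm_triangle_ineq4[of "D N t - of_real (h t)" "D N t - of_real (g t)"] by (simp add: u_def w_def)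
          finally have "(g t - h t)\<^sup>2 \<le> (u + w)\<^sup>2"
            by (intro iffD1[OF abs_le_square_iff]) simp
          also have "\<dots> \<le> 2 * u\<^sup>2 + 2 * w\<^sup>2"
            using sum_squares_bound[of u w] by (simp add: power2_sum)
          finally show ?thesis
            by (simp add: u_def w_def)
        qed
      qed
      also have "\<dots> = 2 * integral {0..T} (\<lambda>t. (cmod (D N t - of_real (g t)))\<^sup>2)
        + 2 * integral {0..T} (\<lambda>t. (cmod (D N t - of_real (h t)))\<^sup>2)"
        using sq by (simp add: Henstock_Kurzweil_Integration.integral_add)
      finally show ?thesis .
    qed
    moreover have "(\<lambda>N. 2 * integral {0..T} (\<lambda>t. (cmod (D N t - of_real (g t)))\<^sup>2)
        + 2 * integral {0..T} (\<lambda>t. (cmod (D N t - of_real (h t)))\<^sup>2)) \<longlonglongrightarrow> 2 * 0 + 2 * 0"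
      by (intro tendsto_intros Dg Dh)
    ultimately have "integral {0..T} (\<lambda>t. (g t - h t)\<^sup>2) \<le> 0"
      by (intro LIMSEQ_le_const) auto
    moreover have "0 \<le> integral {0..T} (\<lambda>t. (g t - h t)\<^sup>2)"
      by (intro integral_nonneg L2_on_square L2_on_diff g h) auto
    ultimately show ?thesis
      by simp
  qed
  have "integral {0..T} (\<lambda>t. (g t)\<^sup>2) - integral {0..T} (\<lambda>t. (h t)\<^sup>2) = integral {0..T} (\<lambda>t. (g t - h t) * (g t + h t))"
    using L2_on_square[OF g] L2_on_square[OF h]
    by (subst Henstock_Kurzweil_Integration.integral_diff[symmetric]) (auto simp: power2_eq_square algebra_simps)
  moreover have "\<bar>integral {0..T} (\<lambda>t. (g t - h t) * (g t + h t))\<bar> \<le> 0"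
    using Cauchy_Schwarz_integral_abs[OF L2_on_diff[OF g h] L2_on_add[OF g h]] zero by simp
  ultimately have "integral {0..T} (\<lambda>t. (g t)\<^sup>2) = integral {0..T} (\<lambda>t. (h t)\<^sup>2)"
    by simp
  also have "\<dots> = (2 / L)\<^sup>2 / m * integral {k..m * T + k} (\<lambda>s. (H_deriv s)\<^sup>2)"
    using integral_affine[where m = m and f = "\<lambda>s. (H_deriv s)\<^sup>2" and k = k and a = 0 and b = T] m
    by (simp add: h_def power_mult_distrib divide_inverse mult_ac)
  also have "(2 / L)\<^sup>2 / m = 4 / (L * (1 - v\<^sup>2))"
    using L by (simp add: m_def power2_eq_square field_simps)
  finally show "integral {0..T} (\<lambda>t. (dx_trace L v \<phi> \<gamma> t)\<^sup>2) =
      4 / (L * (1 - v\<^sup>2)) * integral {k..(1 - v\<^sup>2) / L * T + k} (\<lambda>s. (H_deriv s)\<^sup>2)"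
    by (simp add: g_def m_def)
qed

lemma left_trace_square_integral:
  assumes "0 < T"
  shows "L2_on {0..T} (left_trace L v \<phi>)"
    and "integral {0..T} (\<lambda>t. (left_trace L v \<phi> t)\<^sup>2) =
      4 / (L * (1 - v\<^sup>2)) * integral {0..(1 - v\<^sup>2) / L * T} (\<lambda>s. (H_deriv s)\<^sup>2)"
proof -
  have phase: "(1 - v) * (t + v * t) / L = (1 - v\<^sup>2) / L * t + 0"
    and "(1 + v) * (t - v * t) / L = (1 - v\<^sup>2) / L * t + 0" for t
    by (simp_all add: power2_eq_square field_simps)
  then have phase': "trig n ((1 + v) * (t - v * t) / L) = trig n ((1 - v\<^sup>2) / L * t + 0)" for n t
    by (simp only:)
  show "L2_on {0..T} (left_trace L v \<phi>)"
    and "integral {0..T} (\<lambda>t. (left_trace L v \<phi> t)\<^sup>2) =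
      4 / (L * (1 - v\<^sup>2)) * integral {0..(1 - v\<^sup>2) / L * T} (\<lambda>s. (H_deriv s)\<^sup>2)"
    using trace_square_integral[of "\<lambda>t. v * t" 0 T, OF phase phase'] assms v
    by (simp_all add: left_trace_def)
qed

lemma right_trace_square_integral:
  assumes "0 < T"
  shows "L2_on {0..T} (right_trace L v \<phi>)"
    and "integral {0..T} (\<lambda>t. (right_trace L v \<phi> t)\<^sup>2) =
      4 / (L * (1 - v\<^sup>2)) * integral {1 - v..(1 - v\<^sup>2) / L * T + (1 - v)} (\<lambda>s. (H_deriv s)\<^sup>2)"
proof -
  have phase: "(1 - v) * (t + (L + v * t)) / L = (1 - v\<^sup>2) / L * t + (1 - v)" for t
    using L by (simp add: power2_eq_square field_simps)
  have "(1 + v) * (t - (L + v * t)) / L + 2 = (1 - v\<^sup>2) / L * t + (1 - v)" for t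
    using L by (simp add: power2_eq_square field_simps)
  then have phase': "trig n ((1 + v) * (t - (L + v * t)) / L) = trig n ((1 - v\<^sup>2) / L * t + (1 - v))" for n t
    by (metis trig_periodic)
  show "L2_on {0..T} (right_trace L v \<phi>)"
    and "integral {0..T} (\<lambda>t. (right_trace L v \<phi> t)\<^sup>2) =
      4 / (L * (1 - v\<^sup>2)) * integral {1 - v..(1 - v\<^sup>2) / L * T + (1 - v)} (\<lambda>s. (H_deriv s)\<^sup>2)"
    using trace_square_integral[of "\<lambda>t. L + v * t" "1 - v" T, OF phase phase'] assms v
    by (simp_all add: right_trace_def)
qed

end

section \<open>Observability\<close>

context moving_string
begin

abbreviation traces_square :: "real \<Rightarrow> real" where
  "traces_square t \<equiv> (left_trace L v \<phi> t)\<^sup>2 + (right_trace L v \<phi> t)\<^sup>2"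

lemma one_minus_square_pos: "0 < 1 - v\<^sup>2"
  using v mult_strict_mono[of v 1 v 1] by (simp add: power2_eq_square)

lemma
  shows traces_L2: "0 < T \<Longrightarrow> L2_on {0..T} (left_trace L v \<phi>)" "0 < T \<Longrightarrow> L2_on {0..T} (right_trace L v \<phi>)"
    and trace_energy_identity: "integral {0..L / (1 + v)} (\<lambda>t. (left_trace L v \<phi> t)\<^sup>2)
          + integral {0..L / (1 - v)} (\<lambda>t. (right_trace L v \<phi> t)\<^sup>2)
        = 4 * energy L v \<phi>x \<phi>t 0 / (1 - v\<^sup>2)\<^sup>2"
    and energy_nonneg: "0 \<le> energy L v \<phi>x \<phi>t 0"
    and trace_direct_inequality: "0 < T \<Longrightarrow> (1 - v\<^sup>2) / L * T + 2 \<le> 2 * real J \<Longrightarrow>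
        integral {0..T} traces_square \<le> 8 * real J / (1 - v\<^sup>2)\<^sup>2 * energy L v \<phi>x \<phi>t 0"
proof -
  obtain H where H: "\<And>s. H (s + 2) = H s" "H 0 = 0" "continuous_on UNIV H"
    "\<And>x t. 0 \<le> t \<Longrightarrow> v * t \<le> x \<Longrightarrow> x \<le> L + v * t \<Longrightarrow>
       \<phi> x t = H ((1 - v) * (t + x) / L) - H ((1 + v) * (t - x) / L)"
    using dAlembert_representation by blast
  interpret string_profile L v \<phi>0 \<phi>1 \<phi> \<phi>x \<phi>t H
    by unfold_locales (use H in auto)
  define c where "c = - (1 + v)"
  define I where "I = (\<lambda>a b. integral {a..b} (\<lambda>s. (H_deriv s)\<^sup>2))"
  note sq_pos = one_minus_square_pos
  have E: "energy L v \<phi>x \<phi>t 0 = (1 - v\<^sup>2) / L * I c (c + 2)"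
    using energy_eq_H_deriv by (simp add: I_def c_def)
  have L2: "L2_on {c..c + 2} H_deriv"
    using H_deriv_L2 by (simp add: c_def)
  have I_eq: "4 / (L * (1 - v\<^sup>2)) * I c (c + 2) = 4 * energy L v \<phi>x \<phi>t 0 / (1 - v\<^sup>2)\<^sup>2"
  proof -
    have scale: "4 / (L * w) * X = 4 * (w / L * X) / w\<^sup>2" if "w \<noteq> 0" for w X
      using L that by (simp add: power2_eq_square field_simps)
    show ?thesis
      unfolding E by (rule scale) (use sq_pos in simp)
  qed
  have left: "integral {0..T} (\<lambda>t. (left_trace L v \<phi> t)\<^sup>2) = 4 / (L * (1 - v\<^sup>2)) * I 0 ((1 - v\<^sup>2) / L * T)"
    and right: "integral {0..T} (\<lambda>t. (right_trace L v \<phi> t)\<^sup>2) = 4 / (L * (1 - v\<^sup>2)) * I (1 - v) ((1 - v\<^sup>2) / L * T + (1 - v))"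
    if "0 < T" for T
    using left_trace_square_integral(2)[OF that] right_trace_square_integral(2)[OF that] by (simp_all add: I_def)
  show L2l: "0 < T \<Longrightarrow> L2_on {0..T} (left_trace L v \<phi>)" and L2r: "0 < T \<Longrightarrow> L2_on {0..T} (right_trace L v \<phi>)" for T
    using left_trace_square_integral(1) right_trace_square_integral(1) by auto
  have I_nonneg: "0 \<le> I c (c + 2)"
    unfolding I_def by (intro integral_nonneg L2_on_square L2) auto
  then show "0 \<le> energy L v \<phi>x \<phi>t 0"
    using L sq_pos by (simp add: E)
  show "integral {0..L / (1 + v)} (\<lambda>t. (left_trace L v \<phi> t)\<^sup>2) + integral {0..L / (1 - v)} (\<lambda>t. (right_trace L v \<phi> t)\<^sup>2)
        = 4 * energy L v \<phi>x \<phi>t 0 / (1 - v\<^sup>2)\<^sup>2"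
  proof -
    have "1 - v\<^sup>2 = (1 - v) * (1 + v)"
      by (simp add: power2_eq_square algebra_simps)
    then have times: "(1 - v\<^sup>2) / L * (L / (1 + v)) = 1 - v" "(1 - v\<^sup>2) / L * (L / (1 - v)) + (1 - v) = 2"
      using L v by simp_all
    \<comment> \<open>The two observation windows together cover one period, up to a shift by \<open>2\<close>.\<close>
    have shift: "I (1 - v) 2 = I c 0"
    proof -
      have "(\<lambda>s. (H_deriv s)\<^sup>2) \<circ> (+) 2 = (\<lambda>s. (H_deriv s)\<^sup>2)"
        using H_deriv_periodic by (auto simp: fun_eq_iff add.commute)
      then show ?thesis
        using integral_shift_Icc_real[of c 0 "\<lambda>s. (H_deriv s)\<^sup>2" 2] by (simp add: I_def c_def)
    qed
    have "I c 0 + I 0 (1 - v) = I c (c + 2)"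
      using v Henstock_Kurzweil_Integration.integral_combine[OF _ _ L2_on_square[OF L2], of 0] by (simp add: I_def c_def)
    then have "I 0 (1 - v) + I (1 - v) 2 = I c (c + 2)"
      by (simp add: shift)
    then have "4 / (L * (1 - v\<^sup>2)) * I 0 (1 - v) + 4 / (L * (1 - v\<^sup>2)) * I (1 - v) 2 = 4 / (L * (1 - v\<^sup>2)) * I c (c + 2)"
      by (metis distrib_left)
    then show ?thesis
      unfolding left[OF scale_pos(2)] right[OF scale_pos(1)] times I_eq .
  qed
  show "integral {0..T} traces_square \<le> 8 * real J / (1 - v\<^sup>2)\<^sup>2 * energy L v \<phi>x \<phi>t 0"
    if T: "0 < T" and J: "(1 - v\<^sup>2) / L * T + 2 \<le> 2 * real J" for T J
  proof -
    have full: "((\<lambda>s. (H_deriv s)\<^sup>2) has_integral real J * I c (c + 2)) {c..c + 2 * real J}"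
      unfolding I_def
      by (rule periodic_has_integral) (simp_all add: H_deriv_periodic integrable_integral[OF L2_on_square[OF L2]])
    have part: "I a b \<le> real J * I c (c + 2)" if "c \<le> a" "b \<le> c + 2 * real J" for a b
    proof -
      have sub: "{a..b} \<subseteq> {c..c + 2 * real J}"
        using that by auto
      show ?thesis
        using full integral_subset_le[OF sub, of "\<lambda>s. (H_deriv s)\<^sup>2"]
          integrable_on_subinterval[of "\<lambda>s. (H_deriv s)\<^sup>2" "{c..c + 2 * real J}", OF _ sub]
        by (simp add: I_def has_integral_iff)
    qed
    have "integral {0..T} traces_square = 4 / (L * (1 - v\<^sup>2)) * (I 0 ((1 - v\<^sup>2) / L * T) + I (1 - v) ((1 - v\<^sup>2) / L * T + (1 - v)))"
      using left[OF T] right[OF T] L2_on_square[OF L2l[OF T]] L2_on_square[OF L2r[OF T]]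
      by (simp add: Henstock_Kurzweil_Integration.integral_add distrib_left)
    also have "\<dots> \<le> 4 / (L * (1 - v\<^sup>2)) * (real J * I c (c + 2) + real J * I c (c + 2))"
    proof (intro mult_left_mono add_mono)
      show "I 0 ((1 - v\<^sup>2) / L * T) \<le> real J * I c (c + 2)"
        by (rule part) (use J v in \<open>simp_all add: c_def\<close>)
      show "I (1 - v) ((1 - v\<^sup>2) / L * T + (1 - v)) \<le> real J * I c (c + 2)"
        by (rule part) (use J v in \<open>simp_all add: c_def\<close>)
    qed (use L sq_pos in simp)
    also have "\<dots> = 2 * real J * (4 / (L * (1 - v\<^sup>2)) * I c (c + 2))"
      by (simp add: field_simps)
    also have "\<dots> = 8 * real J / (1 - v\<^sup>2)\<^sup>2 * energy L v \<phi>x \<phi>t 0"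
      unfolding I_eq by simp
    finally show ?thesis .
  qed
qed

text \<open>Up to time \<open>L/(1 - v)\<close>, the longer of the two windows in \<open>trace_energy_identity\<close>, both ends have
  seen their full share of the period.\<close>

lemma observability_inequality:
  assumes T: "L / (1 - v) \<le> T"
  shows "energy L v \<phi>x \<phi>t 0 \<le> (1 - v\<^sup>2)\<^sup>2 / 4 * integral {0..T} traces_square"
proof -
  have pos: "0 < L / (1 - v)" "0 < L / (1 + v)"
    using L v by auto
  have le: "L / (1 + v) \<le> T"
  proof -
    have "L / (1 + v) \<le> L / (1 - v)"
      using L v by (intro divide_left_mono) auto
    then show ?thesis
      using T by simp
  qed
  have T0: "0 < T"
    using pos T by simp
  note int = L2_on_square[OF traces_L2(1)[OF T0]] L2_on_square[OF traces_L2(2)[OF T0]]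
  have "4 * energy L v \<phi>x \<phi>t 0 / (1 - v\<^sup>2)\<^sup>2 =
      integral {0..L / (1 + v)} (\<lambda>t. (left_trace L v \<phi> t)\<^sup>2) + integral {0..L / (1 - v)} (\<lambda>t. (right_trace L v \<phi> t)\<^sup>2)"
    by (rule trace_energy_identity[symmetric])
  also have "\<dots> \<le> integral {0..T} (\<lambda>t. (left_trace L v \<phi> t)\<^sup>2) + integral {0..T} (\<lambda>t. (right_trace L v \<phi> t)\<^sup>2)"
    using le T int L2_on_square[OF traces_L2(1)[OF pos(2)]] L2_on_square[OF traces_L2(2)[OF pos(1)]]
    by (intro add_mono integral_subset_le) auto
  also have "\<dots> = integral {0..T} traces_square"
    by (rule Henstock_Kurzweil_Integration.integral_add[symmetric, OF int])
  finally have "(1 - v\<^sup>2)\<^sup>2 / 4 * (4 * energy L v \<phi>x \<phi>t 0 / (1 - v\<^sup>2)\<^sup>2) \<le> (1 - v\<^sup>2)\<^sup>2 / 4 * integral {0..T} traces_square"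
    by (intro mult_left_mono) auto
  then show ?thesis
    using one_minus_square_pos by simp
qed

end

theorem theorem4:
  fixes L v :: real
  assumes "0 < L" and "0 < v" and "v < 1"
  shows
    "(\<forall>\<phi>0 \<phi>1 \<phi> \<phi>x \<phi>t.
        H1_0 0 L \<phi>0 \<longrightarrow> L2_on {0..L} \<phi>1 \<longrightarrow> weak_solution L v \<phi>0 \<phi>1 \<phi> \<phi>x \<phi>t \<longrightarrow>
        integral {0..L / (1 + v)} (\<lambda>t. (left_trace L v \<phi> t)\<^sup>2)
          + integral {0..L / (1 - v)} (\<lambda>t. (right_trace L v \<phi> t)\<^sup>2)
        = 4 * energy L v \<phi>x \<phi>t 0 / (1 - v\<^sup>2)\<^sup>2)
     \<and>
     (\<forall>T\<ge>0. \<exists>K2. \<forall>\<phi>0 \<phi>1 \<phi> \<phi>x \<phi>t.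
        H1_0 0 L \<phi>0 \<longrightarrow> L2_on {0..L} \<phi>1 \<longrightarrow> weak_solution L v \<phi>0 \<phi>1 \<phi> \<phi>x \<phi>t \<longrightarrow>
        integral {0..T} (\<lambda>t. (left_trace L v \<phi> t)\<^sup>2 + (right_trace L v \<phi> t)\<^sup>2)
          \<le> K2 * energy L v \<phi>x \<phi>t 0)
     \<and>
     (\<forall>T\<ge>L / (1 - v).
        observable_both L v T \<and>
        (\<forall>\<phi>0 \<phi>1 \<phi> \<phi>x \<phi>t.
           H1_0 0 L \<phi>0 \<longrightarrow> L2_on {0..L} \<phi>1 \<longrightarrow> weak_solution L v \<phi>0 \<phi>1 \<phi> \<phi>x \<phi>t \<longrightarrow>
           energy L v \<phi>x \<phi>t 0
             \<le> (1 - v\<^sup>2)\<^sup>2 / 4 *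
                integral {0..T} (\<lambda>t. (left_trace L v \<phi> t)\<^sup>2 + (right_trace L v \<phi> t)\<^sup>2)))"
proof -
  have string: "moving_string L v \<phi>0 \<phi>1 \<phi> \<phi>x \<phi>t" if "weak_solution L v \<phi>0 \<phi>1 \<phi> \<phi>x \<phi>t" for \<phi>0 \<phi>1 \<phi> \<phi>x \<phi>t
    using assms that by unfold_locales
  have pos: "0 < 1 - v\<^sup>2"
    using assms mult_strict_mono[of v 1 v 1] by (simp add: power2_eq_square)
  have direct: "\<exists>K2. \<forall>\<phi>0 \<phi>1 \<phi> \<phi>x \<phi>t. weak_solution L v \<phi>0 \<phi>1 \<phi> \<phi>x \<phi>t \<longrightarrow>
      integral {0..T} (\<lambda>t. (left_trace L v \<phi> t)\<^sup>2 + (right_trace L v \<phi> t)\<^sup>2) \<le> K2 * energy L v \<phi>x \<phi>t 0"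
    if T: "0 \<le> T" for T
  proof -
    obtain J :: nat where J: "(1 - v\<^sup>2) / L * T + 2 \<le> real J"
      using real_arch_simple by blast
    have "integral {0..T} (\<lambda>t. (left_trace L v \<phi> t)\<^sup>2 + (right_trace L v \<phi> t)\<^sup>2)
        \<le> 8 * real J / (1 - v\<^sup>2)\<^sup>2 * energy L v \<phi>x \<phi>t 0"
      if sol: "weak_solution L v \<phi>0 \<phi>1 \<phi> \<phi>x \<phi>t" for \<phi>0 \<phi>1 \<phi> \<phi>x \<phi>t
    proof (cases "T = 0")
      case True
      have "0 \<le> 8 * real J / (1 - v\<^sup>2)\<^sup>2 * energy L v \<phi>x \<phi>t 0"
        using moving_string.energy_nonneg[OF string[OF sol]] by (intro mult_nonneg_nonneg) auto
      then show ?thesis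
        using True by simp
    next
      case False
      then show ?thesis
        using T J by (intro moving_string.trace_direct_inequality[OF string[OF sol]]) auto
    qed
    then show ?thesis
      by blast
  qed
  have observe: "energy L v \<phi>x \<phi>t 0 \<le> (1 - v\<^sup>2)\<^sup>2 / 4 *
      integral {0..T} (\<lambda>t. (left_trace L v \<phi> t)\<^sup>2 + (right_trace L v \<phi> t)\<^sup>2)"
    if "L / (1 - v) \<le> T" "weak_solution L v \<phi>0 \<phi>1 \<phi> \<phi>x \<phi>t" for T \<phi>0 \<phi>1 \<phi> \<phi>x \<phi>t
    using moving_string.observability_inequality[OF string[OF that(2)] that(1)] .
  have observable: "observable_both L v T" if "L / (1 - v) \<le> T" for T
    unfolding observable_both_def using observe[OF that] pos
    by (intro exI[of _ "(1 - v\<^sup>2)\<^sup>2 / 4"]) auto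
  show ?thesis
  proof (intro conjI allI impI)
    show "\<exists>K2. \<forall>\<phi>0 \<phi>1 \<phi> \<phi>x \<phi>t.
        H1_0 0 L \<phi>0 \<longrightarrow> L2_on {0..L} \<phi>1 \<longrightarrow> weak_solution L v \<phi>0 \<phi>1 \<phi> \<phi>x \<phi>t \<longrightarrow>
        integral {0..T} (\<lambda>t. (left_trace L v \<phi> t)\<^sup>2 + (right_trace L v \<phi> t)\<^sup>2)
          \<le> K2 * energy L v \<phi>x \<phi>t 0" if "0 \<le> T" for T
      using direct[OF that] by blast
    show "energy L v \<phi>x \<phi>t 0 \<le> (1 - v\<^sup>2)\<^sup>2 / 4 *
        integral {0..T} (\<lambda>t. (left_trace L v \<phi> t)\<^sup>2 + (right_trace L v \<phi> t)\<^sup>2)"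
      if "L / (1 - v) \<le> T" "weak_solution L v \<phi>0 \<phi>1 \<phi> \<phi>x \<phi>t" for T \<phi>0 \<phi>1 \<phi> \<phi>x \<phi>t
      using that by (rule observe)
  qed (simp_all add: observable moving_string.trace_energy_identity[OF string])
qed

end
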